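(* (C*-Frobenius Reciprocity) Let $A\subset B$ be a unital inclusion of C*-algebras admitting a faithful conditional expectation $E:B\twoheadrightarrow A$, and let $K\in\mathsf{Bim_{fgp}}(A)$. Then the maps $$\Psi_K:\mathsf{C^*Alg}_{A-A}(K\to\mathcal B)^\diamondsuit\to\mathsf{C^*Alg}_{A-B}(K\boxtimes_AB\to B),\qquad \Psi_K(g)(k\boxtimes b):=\check g(k)b,$$ $$\Phi_K:\mathsf{C^*Alg}_{A-B}(K\boxtimes_AB\to B)\to\mathsf{C^*Alg}_{A-A}(K\to\mathcal B)^\diamondsuit,\qquad \Phi_K(f)(k):=f(k\boxtimes1_A)\Omega$$ are well-defined and assemble, as $K$ varies over $\mathsf{Bim_{fgp}}(A)$, into mutually inverse natural isomorphisms $$\Psi:\mathsf{C^*Alg}_{A-A}(-\to\mathcal B)^\diamondsuit\Rightarrow\mathsf{C^*Alg}_{A-B}(-\boxtimes_AB\to B),\qquad \Phi:\mathsf{C^*Alg}_{A-B}(-\boxtimes_AB\to B)\Rightarrow\mathsf{C^*Alg}_{A-A}(-\to\mathcal B)^\diamondsuit$$ of linear functors $\mathsf{Bim_{fgp}}(A)^{\mathrm{op}}\to\mathsf{Vec}$.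
   Context: A right $A$-$B$ C*-correspondence ($A,B$ unital C*-algebras) is a right Hilbert $B$-module $X$ (inner product $\langle\cdot\mid\cdot\rangle_B$ linear in the second variable) with a unital $*$-homomorphism from $A$ to the adjointable operators on $X_B$. $\mathsf{C^*Alg}_{A-B}(X\to Y)$ is the space of adjointable $A$-$B$ bimodular maps and $\boxtimes_A$ the interior tensor product. A Hilbert $A$-$A$ bimodule is a right $A$-$A$ correspondence which also has a left $A$-valued inner product making it a left Hilbert $A$-module with right action by adjointables, with equivalent norms; it is fgp if it is finitely generated projective as a left and as a right Hilbert module. $\mathsf{Bim_{fgp}}(A)$ is the category of fgp Hilbert $A$-$A$ bimodules with adjointable bimodular maps. $\mathcal B$ denotes the completion of $B$ for the $A$-valued inner product $\langle b_1\mid b_2\rangle_A=E(b_1^*b_2)$, a right $B$-$A$ (hence $A$-$A$) correspondence; $b\mapsto b\Omega$ denotes the (injective, since $E$ is faithful) embedding of $B$ onto the dense subspace $B\Omega\subset\mathcal B$. The diamond space is $$\mathsf{C^*Alg}_{A-A}(K\to\mathcal B)^\diamondsuit=\{f\in\mathsf{C^*Alg}_{A-A}(K\to\mathcal B): f[K]\subset B\Omega\},$$ and for $f$ in it, $\check f:K\to B$ is defined by $\check f(k)\Omega=f(k)$. In $K\boxtimes_AB$ and in the target $B$, $B$ is regarded as a right $A$-$B$ correspondence with inner product $\langle b\mid b'\rangle_B=b^*b'$. Both functors act on morphisms by precomposition: $\psi:K\to L$ sends $f$ to $f\circ\psi$, respectively $f\circ(\psi\boxtimes\mathrm{id}_B)$.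 *)

theory Defs
  imports "HOL-Analysis.Analysis"
begin

section \<open>Unital C*-algebras, subalgebras, conditional expectations\<close>

class cstar_algebra = real_normed_algebra_1 + banach +
  fixes scaleC :: "complex \<Rightarrow> 'a \<Rightarrow> 'a"  (infixr "*\<^sub>c" 75)
    and star :: "'a \<Rightarrow> 'a"  ("_\<^sup>\<star>" [1000] 1000)
  assumes scaleC_add_right: "c *\<^sub>c (x + y) = c *\<^sub>c x + c *\<^sub>c y"
    and scaleC_add_left: "(c + d) *\<^sub>c x = c *\<^sub>c x + d *\<^sub>c x"
    and scaleC_scaleC: "c *\<^sub>c d *\<^sub>c x = (c * d) *\<^sub>c x"
    and scaleR_scaleC: "r *\<^sub>R x = complex_of_real r *\<^sub>c x"
    and mult_scaleC_left: "(c *\<^sub>c x) * y = c *\<^sub>c (x * y)"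
    and mult_scaleC_right: "x * (c *\<^sub>c y) = c *\<^sub>c (x * y)"
    and norm_scaleC: "norm (c *\<^sub>c x) = cmod c * norm x"
    and star_star: "(x\<^sup>\<star>)\<^sup>\<star> = x"
    and star_add: "(x + y)\<^sup>\<star> = x\<^sup>\<star> + y\<^sup>\<star>"
    and star_scaleC: "(c *\<^sub>c x)\<^sup>\<star> = cnj c *\<^sub>c x\<^sup>\<star>"
    and star_mult: "(x * y)\<^sup>\<star> = y\<^sup>\<star> * x\<^sup>\<star>"
    and cstar_identity: "norm (x\<^sup>\<star> * x) = (norm x)\<^sup>2"

definition cstar_subalgebra :: "'b::cstar_algebra set \<Rightarrow> bool" where
  "cstar_subalgebra A \<longleftrightarrow> closed A \<and> 1 \<in> A \<and>
     (\<forall>x\<in>A. \<forall>y\<in>A. x + y \<in> A \<and> x * y \<in> A) \<and>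
     (\<forall>x\<in>A. x\<^sup>\<star> \<in> A \<and> (\<forall>c. c *\<^sub>c x \<in> A))"

definition positive_in :: "'b::cstar_algebra set \<Rightarrow> 'b \<Rightarrow> bool" where
  "positive_in S a \<longleftrightarrow> (\<exists>c\<in>S. a = c\<^sup>\<star> * c)"

definition faithful_conditional_expectation ::
    "'b::cstar_algebra set \<Rightarrow> ('b \<Rightarrow> 'b) \<Rightarrow> bool" where
  "faithful_conditional_expectation A E \<longleftrightarrow>
     (\<forall>b. E b \<in> A) \<and> (\<forall>a\<in>A. E a = a) \<and>
     (\<forall>b b'. E (b + b') = E b + E b') \<and> (\<forall>c b. E (c *\<^sub>c b) = c *\<^sub>c E b) \<and>
     (\<forall>a\<in>A. \<forall>a'\<in>A. \<forall>b. E (a * b * a') = a * E b * a') \<and>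
     (\<forall>b. positive_in A (E (b\<^sup>\<star> * b))) \<and>
     (\<forall>b. E (b\<^sup>\<star> * b) = 0 \<longrightarrow> b = 0)"


section \<open>Complex vector spaces with explicit carrier\<close>

record 'v cvs =
  carr :: "'v set"
  add :: "'v \<Rightarrow> 'v \<Rightarrow> 'v"
  zero :: 'v
  csc :: "complex \<Rightarrow> 'v \<Rightarrow> 'v"

definition cvector_space :: "('v, 'm) cvs_scheme \<Rightarrow> bool" where
  "cvector_space V \<longleftrightarrow>
     zero V \<in> carr V \<and>
     (\<forall>x\<in>carr V. \<forall>y\<in>carr V. add V x y \<in> carr V \<and> add V x y = add V y x) \<and>
     (\<forall>x\<in>carr V. \<forall>y\<in>carr V. \<forall>z\<in>carr V. add V (add V x y) z = add V x (add V y z)) \<and>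
     (\<forall>x\<in>carr V. add V (zero V) x = x) \<and>
     (\<forall>x\<in>carr V. \<exists>y\<in>carr V. add V x y = zero V) \<and>
     (\<forall>c. \<forall>x\<in>carr V. csc V c x \<in> carr V) \<and>
     (\<forall>c. \<forall>x\<in>carr V. \<forall>y\<in>carr V. csc V c (add V x y) = add V (csc V c x) (csc V c y)) \<and>
     (\<forall>c d. \<forall>x\<in>carr V. csc V (c + d) x = add V (csc V c x) (csc V d x)) \<and>
     (\<forall>c d. \<forall>x\<in>carr V. csc V c (csc V d x) = csc V (c * d) x) \<and>
     (\<forall>x\<in>carr V. csc V 1 x = x)"

definition clinear_map ::
    "('v, 'm) cvs_scheme \<Rightarrow> ('w, 'n) cvs_scheme \<Rightarrow> ('v \<Rightarrow> 'w) \<Rightarrow> bool" where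
  "clinear_map V W f \<longleftrightarrow>
     (\<forall>x\<in>carr V. f x \<in> carr W) \<and>
     (\<forall>x\<in>carr V. \<forall>y\<in>carr V. f (add V x y) = add W (f x) (f y)) \<and>
     (\<forall>c. \<forall>x\<in>carr V. f (csc V c x) = csc W c (f x))"

definition diff :: "('v, 'm) cvs_scheme \<Rightarrow> 'v \<Rightarrow> 'v \<Rightarrow> 'v" where
  "diff V x y = add V x (csc V (-1) y)"

definition cauchy_seq :: "('v, 'm) cvs_scheme \<Rightarrow> ('v \<Rightarrow> real) \<Rightarrow> (nat \<Rightarrow> 'v) \<Rightarrow> bool" where
  "cauchy_seq V nrm s \<longleftrightarrow> (\<forall>n. s n \<in> carr V) \<and>
     (\<forall>e>0. \<exists>N. \<forall>m\<ge>N. \<forall>n\<ge>N. nrm (diff V (s m) (s n)) < e)"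

definition complete_for :: "('v, 'm) cvs_scheme \<Rightarrow> ('v \<Rightarrow> real) \<Rightarrow> bool" where
  "complete_for V nrm \<longleftrightarrow> (\<forall>s. cauchy_seq V nrm s \<longrightarrow>
     (\<exists>x\<in>carr V. (\<lambda>n. nrm (diff V (s n) x)) \<longlonglongrightarrow> 0))"


section \<open>Hilbert modules, correspondences, bimodules\<close>

text \<open>The coefficient algebras are unital C*-subalgebras of one C*-algebra \<^typ>\<open>'b\<close>; the two
  actions and the inner products are only meaningful on the relevant subalgebras. The right inner
  product \<open>rip\<close> is linear in the second, the left inner product \<open>lip\<close> in the first variable.\<close>

record ('v, 'b) corr = "'v cvs" +
  lact :: "'b \<Rightarrow> 'v \<Rightarrow> 'v"
  ract :: "'v \<Rightarrow> 'b \<Rightarrow> 'v"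
  rip :: "'v \<Rightarrow> 'v \<Rightarrow> 'b"

record ('v, 'b) bimod = "('v, 'b) corr" +
  lip :: "'v \<Rightarrow> 'v \<Rightarrow> 'b"

definition rnorm :: "('v, 'b::cstar_algebra, 'm) corr_scheme \<Rightarrow> 'v \<Rightarrow> real" where
  "rnorm X x = sqrt (norm (rip X x x))"

definition lnorm :: "('v, 'b::cstar_algebra, 'm) bimod_scheme \<Rightarrow> 'v \<Rightarrow> real" where
  "lnorm X x = sqrt (norm (lip X x x))"

definition right_module ::
    "'b::cstar_algebra set \<Rightarrow> ('v, 'b, 'm) corr_scheme \<Rightarrow> bool" where
  "right_module S X \<longleftrightarrow> cvector_space X \<and>
     (\<forall>x\<in>carr X. \<forall>s\<in>S. ract X x s \<in> carr X) \<and>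
     (\<forall>x\<in>carr X. \<forall>y\<in>carr X. \<forall>s\<in>S. ract X (add X x y) s = add X (ract X x s) (ract X y s)) \<and>
     (\<forall>x\<in>carr X. \<forall>s\<in>S. \<forall>t\<in>S. ract X x (s + t) = add X (ract X x s) (ract X x t)) \<and>
     (\<forall>x\<in>carr X. \<forall>s\<in>S. \<forall>t\<in>S. ract X (ract X x s) t = ract X x (s * t)) \<and>
     (\<forall>x\<in>carr X. ract X x 1 = x) \<and>
     (\<forall>x\<in>carr X. \<forall>s\<in>S. \<forall>c. ract X (csc X c x) s = csc X c (ract X x s) \<and>
                              ract X x (c *\<^sub>c s) = csc X c (ract X x s))"

definition right_hilbert_module ::
    "'b::cstar_algebra set \<Rightarrow> ('v, 'b, 'm) corr_scheme \<Rightarrow> bool" where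
  "right_hilbert_module S X \<longleftrightarrow> right_module S X \<and>
     (\<forall>x\<in>carr X. \<forall>y\<in>carr X. rip X x y \<in> S) \<and>
     (\<forall>x\<in>carr X. \<forall>y\<in>carr X. \<forall>z\<in>carr X. rip X x (add X y z) = rip X x y + rip X x z) \<and>
     (\<forall>x\<in>carr X. \<forall>y\<in>carr X. \<forall>c. rip X x (csc X c y) = c *\<^sub>c rip X x y) \<and>
     (\<forall>x\<in>carr X. \<forall>y\<in>carr X. \<forall>s\<in>S. rip X x (ract X y s) = rip X x y * s) \<and>
     (\<forall>x\<in>carr X. \<forall>y\<in>carr X. (rip X x y)\<^sup>\<star> = rip X y x) \<and>
     (\<forall>x\<in>carr X. positive_in S (rip X x x)) \<and>
     (\<forall>x\<in>carr X. rip X x x = 0 \<longrightarrow> x = zero X) \<and>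
     complete_for X (rnorm X)"

definition left_module ::
    "'b::cstar_algebra set \<Rightarrow> ('v, 'b, 'm) corr_scheme \<Rightarrow> bool" where
  "left_module S X \<longleftrightarrow> cvector_space X \<and>
     (\<forall>x\<in>carr X. \<forall>s\<in>S. lact X s x \<in> carr X) \<and>
     (\<forall>x\<in>carr X. \<forall>y\<in>carr X. \<forall>s\<in>S. lact X s (add X x y) = add X (lact X s x) (lact X s y)) \<and>
     (\<forall>x\<in>carr X. \<forall>s\<in>S. \<forall>t\<in>S. lact X (s + t) x = add X (lact X s x) (lact X t x)) \<and>
     (\<forall>x\<in>carr X. \<forall>s\<in>S. \<forall>t\<in>S. lact X s (lact X t x) = lact X (s * t) x) \<and>
     (\<forall>x\<in>carr X. lact X 1 x = x) \<and>
     (\<forall>x\<in>carr X. \<forall>s\<in>S. \<forall>c. lact X s (csc X c x) = csc X c (lact X s x) \<and>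
                              lact X (c *\<^sub>c s) x = csc X c (lact X s x))"

definition left_hilbert_module ::
    "'b::cstar_algebra set \<Rightarrow> ('v, 'b, 'm) bimod_scheme \<Rightarrow> bool" where
  "left_hilbert_module S X \<longleftrightarrow> left_module S X \<and>
     (\<forall>x\<in>carr X. \<forall>y\<in>carr X. lip X x y \<in> S) \<and>
     (\<forall>x\<in>carr X. \<forall>y\<in>carr X. \<forall>z\<in>carr X. lip X (add X x y) z = lip X x z + lip X y z) \<and>
     (\<forall>x\<in>carr X. \<forall>y\<in>carr X. \<forall>c. lip X (csc X c x) y = c *\<^sub>c lip X x y) \<and>
     (\<forall>x\<in>carr X. \<forall>y\<in>carr X. \<forall>s\<in>S. lip X (lact X s x) y = s * lip X x y) \<and>
     (\<forall>x\<in>carr X. \<forall>y\<in>carr X. (lip X x y)\<^sup>\<star> = lip X y x) \<and>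
     (\<forall>x\<in>carr X. positive_in S (lip X x x)) \<and>
     (\<forall>x\<in>carr X. lip X x x = 0 \<longrightarrow> x = zero X) \<and>
     complete_for X (lnorm X)"

text \<open>The left action is a unital *-homomorphism into the adjointable operators: the operator of
  \<open>r\<close> has the operator of \<open>r\<^sup>\<star>\<close> as its adjoint.\<close>

definition correspondence ::
    "'b::cstar_algebra set \<Rightarrow> 'b set \<Rightarrow> ('v, 'b, 'm) corr_scheme \<Rightarrow> bool" where
  "correspondence R S X \<longleftrightarrow> right_hilbert_module S X \<and>
     (\<forall>r\<in>R. \<forall>x\<in>carr X. lact X r x \<in> carr X) \<and>
     (\<forall>r\<in>R. \<forall>x\<in>carr X. \<forall>y\<in>carr X. rip X (lact X r x) y = rip X x (lact X (r\<^sup>\<star>) y)) \<and>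
     (\<forall>r\<in>R. \<forall>t\<in>R. \<forall>x\<in>carr X. lact X (r + t) x = add X (lact X r x) (lact X t x)) \<and>
     (\<forall>r\<in>R. \<forall>c. \<forall>x\<in>carr X. lact X (c *\<^sub>c r) x = csc X c (lact X r x)) \<and>
     (\<forall>r\<in>R. \<forall>t\<in>R. \<forall>x\<in>carr X. lact X (r * t) x = lact X r (lact X t x)) \<and>
     (\<forall>x\<in>carr X. lact X 1 x = x)"

definition hilbert_bimodule ::
    "'b::cstar_algebra set \<Rightarrow> ('v, 'b, 'm) bimod_scheme \<Rightarrow> bool" where
  "hilbert_bimodule A X \<longleftrightarrow> correspondence A A X \<and> left_hilbert_module A X \<and>
     (\<forall>a\<in>A. \<forall>x\<in>carr X. \<forall>y\<in>carr X. lip X (ract X x a) y = lip X x (ract X y (a\<^sup>\<star>))) \<and>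
     (\<exists>c>0. \<exists>C>0. \<forall>x\<in>carr X. c * lnorm X x \<le> rnorm X x \<and> rnorm X x \<le> C * lnorm X x)"

text \<open>Vectors in \<open>S\<^sup>n\<close> are functions \<open>nat \<Rightarrow> 'b\<close> vanishing from \<open>n\<close> on. Finitely generated
  projective Hilbert modules are those unitarily isomorphic to \<open>p S\<^sup>n\<close> (right modules) or
  \<open>S\<^sup>n p\<close> (left modules) for a projection \<open>p\<close> in the \<open>n \<times> n\<close> matrices over \<open>S\<close>, with the
  inner products \<open>\<Sum>\<^sub>i v\<^sub>i\<^sup>\<star> w\<^sub>i\<close> and \<open>\<Sum>\<^sub>i v\<^sub>i w\<^sub>i\<^sup>\<star>\<close>.\<close>

definition tuples :: "'b::cstar_algebra set \<Rightarrow> nat \<Rightarrow> (nat \<Rightarrow> 'b) set" where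
  "tuples S n = {v. (\<forall>i<n. v i \<in> S) \<and> (\<forall>i\<ge>n. v i = 0)}"

definition matrix_projection ::
    "'b::cstar_algebra set \<Rightarrow> nat \<Rightarrow> (nat \<Rightarrow> nat \<Rightarrow> 'b) \<Rightarrow> bool" where
  "matrix_projection S n p \<longleftrightarrow>
     (\<forall>i<n. \<forall>j<n. p i j \<in> S \<and> p i j = (p j i)\<^sup>\<star> \<and> (\<Sum>k<n. p i k * p k j) = p i j)"

definition right_fgp :: "'b::cstar_algebra set \<Rightarrow> ('v, 'b, 'm) corr_scheme \<Rightarrow> bool" where
  "right_fgp S X \<longleftrightarrow> (\<exists>n p u. matrix_projection S n p \<and>
     bij_betw u (carr X) {v \<in> tuples S n. \<forall>i<n. (\<Sum>j<n. p i j * v j) = v i} \<and>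
     (\<forall>x\<in>carr X. \<forall>y\<in>carr X. \<forall>i<n. u (add X x y) i = u x i + u y i) \<and>
     (\<forall>x\<in>carr X. \<forall>s\<in>S. \<forall>i<n. u (ract X x s) i = u x i * s) \<and>
     (\<forall>x\<in>carr X. \<forall>y\<in>carr X. rip X x y = (\<Sum>i<n. (u x i)\<^sup>\<star> * u y i)))"

definition left_fgp :: "'b::cstar_algebra set \<Rightarrow> ('v, 'b, 'm) bimod_scheme \<Rightarrow> bool" where
  "left_fgp S X \<longleftrightarrow> (\<exists>n p u. matrix_projection S n p \<and>
     bij_betw u (carr X) {v \<in> tuples S n. \<forall>j<n. (\<Sum>i<n. v i * p i j) = v j} \<and>
     (\<forall>x\<in>carr X. \<forall>y\<in>carr X. \<forall>i<n. u (add X x y) i = u x i + u y i) \<and>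
     (\<forall>x\<in>carr X. \<forall>s\<in>S. \<forall>i<n. u (lact X s x) i = s * u x i) \<and>
     (\<forall>x\<in>carr X. \<forall>y\<in>carr X. lip X x y = (\<Sum>i<n. u x i * (u y i)\<^sup>\<star>)))"


section \<open>Spaces of adjointable bimodular maps\<close>

text \<open>Maps are extensional (\<^const>\<open>undefined\<close> off the carrier), so that equality of functions is
  equality of maps.\<close>

definition adj_maps ::
    "'b::cstar_algebra set \<Rightarrow> 'b set \<Rightarrow> ('v, 'b, 'm) corr_scheme \<Rightarrow> ('w, 'b, 'n) corr_scheme
      \<Rightarrow> ('v \<Rightarrow> 'w) set" where
  "adj_maps R S X Y = {f \<in> carr X \<rightarrow>\<^sub>E carr Y.
     (\<exists>g \<in> carr Y \<rightarrow> carr X. \<forall>x\<in>carr X. \<forall>y\<in>carr Y. rip Y (f x) y = rip X x (g y)) \<and>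
     (\<forall>r\<in>R. \<forall>x\<in>carr X. f (lact X r x) = lact Y r (f x)) \<and>
     (\<forall>s\<in>S. \<forall>x\<in>carr X. f (ract X x s) = ract Y (f x) s)}"

definition map_space ::
    "('v, 'm) cvs_scheme \<Rightarrow> ('w, 'n) cvs_scheme \<Rightarrow> ('v \<Rightarrow> 'w) set \<Rightarrow> ('v \<Rightarrow> 'w) cvs" where
  "map_space X Y H = \<lparr>carr = H,
     add = (\<lambda>f g. \<lambda>x\<in>carr X. add Y (f x) (g x)),
     zero = (\<lambda>x\<in>carr X. zero Y),
     csc = (\<lambda>c f. \<lambda>x\<in>carr X. csc Y c (f x))\<rparr>"


section \<open>Completions and interior tensor products\<close>

text \<open>Completion of a semi-inner-product module (after dividing out the null vectors): classes of
  Cauchy sequences modulo sequences tending to 0.\<close>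

definition cauchy_class ::
    "('v, 'b::cstar_algebra, 'm) corr_scheme \<Rightarrow> (nat \<Rightarrow> 'v) \<Rightarrow> (nat \<Rightarrow> 'v) set" where
  "cauchy_class X s = {t. cauchy_seq X (rnorm X) t \<and> (\<lambda>n. rnorm X (diff X (s n) (t n))) \<longlonglongrightarrow> 0}"

definition rep :: "(nat \<Rightarrow> 'v) set \<Rightarrow> nat \<Rightarrow> 'v" where
  "rep \<xi> = (SOME s. s \<in> \<xi>)"

definition completion ::
    "('v, 'b::cstar_algebra, 'm) corr_scheme \<Rightarrow> ((nat \<Rightarrow> 'v) set, 'b) corr" where
  "completion X = \<lparr>carr = cauchy_class X ` {s. cauchy_seq X (rnorm X) s},
     add = (\<lambda>\<xi> \<eta>. cauchy_class X (\<lambda>n. add X (rep \<xi> n) (rep \<eta> n))),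
     zero = cauchy_class X (\<lambda>n. zero X),
     csc = (\<lambda>c \<xi>. cauchy_class X (\<lambda>n. csc X c (rep \<xi> n))),
     lact = (\<lambda>a \<xi>. cauchy_class X (\<lambda>n. lact X a (rep \<xi> n))),
     ract = (\<lambda>\<xi> a. cauchy_class X (\<lambda>n. ract X (rep \<xi> n) a)),
     rip = (\<lambda>\<xi> \<eta>. lim (\<lambda>n. rip X (rep \<xi> n) (rep \<eta> n)))\<rparr>"

definition to_completion ::
    "('v, 'b::cstar_algebra, 'm) corr_scheme \<Rightarrow> 'v \<Rightarrow> (nat \<Rightarrow> 'v) set" where
  "to_completion X x = cauchy_class X (\<lambda>n. x)"

definition completion_map ::
    "('v, 'b::cstar_algebra, 'm) corr_scheme \<Rightarrow> ('w, 'b, 'n) corr_scheme \<Rightarrow> ('v \<Rightarrow> 'w)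
      \<Rightarrow> (nat \<Rightarrow> 'v) set \<Rightarrow> (nat \<Rightarrow> 'w) set" where
  "completion_map X Y f = (\<lambda>\<xi>\<in>carr (completion X). cauchy_class Y (\<lambda>n. f (rep \<xi> n)))"

text \<open>A list \<open>[(x\<^sub>1, y\<^sub>1), \<dots>, (x\<^sub>m, y\<^sub>m)]\<close> stands for the formal sum \<open>\<Sum>\<^sub>i x\<^sub>i \<otimes> y\<^sub>i\<close>. The bilinearity
  and balancing relations need not be imposed, since their differences are null vectors for
  \<open>rip\<close> and hence vanish in the completion.\<close>

definition pre_tensor ::
    "('v, 'b::cstar_algebra, 'm) corr_scheme \<Rightarrow> ('w, 'b, 'n) corr_scheme
      \<Rightarrow> (('v \<times> 'w) list, 'b) corr" where
  "pre_tensor X Y = \<lparr>carr = {l. set l \<subseteq> carr X \<times> carr Y},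
     add = (@),
     zero = [],
     csc = (\<lambda>c l. map (\<lambda>(x, y). (x, csc Y c y)) l),
     lact = (\<lambda>a l. map (\<lambda>(x, y). (lact X a x, y)) l),
     ract = (\<lambda>l b. map (\<lambda>(x, y). (x, ract Y y b)) l),
     rip = (\<lambda>l m. \<Sum>(x, y)\<leftarrow>l. \<Sum>(x', y')\<leftarrow>m. rip Y y (lact Y (rip X x x') y'))\<rparr>"

definition tensor ::
    "('v, 'b::cstar_algebra, 'm) corr_scheme \<Rightarrow> ('w, 'b, 'n) corr_scheme
      \<Rightarrow> ((nat \<Rightarrow> ('v \<times> 'w) list) set, 'b) corr" where
  "tensor X Y = completion (pre_tensor X Y)"

definition elem_tensor ::
    "('v, 'b::cstar_algebra, 'm) corr_scheme \<Rightarrow> ('w, 'b, 'n) corr_scheme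
      \<Rightarrow> 'v \<Rightarrow> 'w \<Rightarrow> (nat \<Rightarrow> ('v \<times> 'w) list) set" where
  "elem_tensor X Y x y = to_completion (pre_tensor X Y) [(x, y)]"

text \<open>The map \<open>\<psi> \<boxtimes> id\<^sub>Y : X \<boxtimes> Y \<rightarrow> X' \<boxtimes> Y\<close>.\<close>

definition tensor_map_id ::
    "('v, 'b::cstar_algebra, 'm) corr_scheme \<Rightarrow> ('v', 'b, 'm') corr_scheme
      \<Rightarrow> ('w, 'b, 'n) corr_scheme \<Rightarrow> ('v \<Rightarrow> 'v')
      \<Rightarrow> (nat \<Rightarrow> ('v \<times> 'w) list) set \<Rightarrow> (nat \<Rightarrow> ('v' \<times> 'w) list) set" where
  "tensor_map_id X X' Y \<psi> =
     completion_map (pre_tensor X Y) (pre_tensor X' Y) (map (\<lambda>(x, y). (\<psi> x, y)))"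

definition self_corr :: "('b::cstar_algebra, 'b) corr" where
  "self_corr = \<lparr>carr = UNIV, add = (+), zero = 0, csc = scaleC,
     lact = (*), ract = (*), rip = (\<lambda>b b'. b\<^sup>\<star> * b')\<rparr>"

definition expectation_corr :: "('b::cstar_algebra \<Rightarrow> 'b) \<Rightarrow> ('b, 'b) corr" where
  "expectation_corr E = self_corr\<lparr>rip := (\<lambda>b b'. E (b\<^sup>\<star> * b'))\<rparr>"

definition calB :: "('b::cstar_algebra \<Rightarrow> 'b) \<Rightarrow> ((nat \<Rightarrow> 'b) set, 'b) corr" where
  "calB E = completion (expectation_corr E)"

definition Omega :: "('b::cstar_algebra \<Rightarrow> 'b) \<Rightarrow> 'b \<Rightarrow> (nat \<Rightarrow> 'b) set" where
  "Omega E b = to_completion (expectation_corr E) b"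


section \<open>Linear categories and linear functors to vector spaces\<close>

record ('o, 'f) lincat =
  Ob :: "'o set"
  Mor :: "'o \<Rightarrow> 'o \<Rightarrow> 'f cvs"
  Id :: "'o \<Rightarrow> 'f"
  Comp :: "'o \<Rightarrow> 'o \<Rightarrow> 'o \<Rightarrow> 'f \<Rightarrow> 'f \<Rightarrow> 'f"  \<comment> \<open>\<open>Comp C K L M \<phi> \<psi>\<close> is \<open>\<phi> \<circ> \<psi>\<close> for \<open>\<psi> : K \<rightarrow> L\<close> and \<open>\<phi> : L \<rightarrow> M\<close>\<close>

text \<open>\<open>FMor F K L \<psi> : FOb F L \<rightarrow> FOb F K\<close> for \<open>\<psi> : K \<rightarrow> L\<close>.\<close>

record ('o, 'f, 'v) presheaf =
  FOb :: "'o \<Rightarrow> 'v cvs"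
  FMor :: "'o \<Rightarrow> 'o \<Rightarrow> 'f \<Rightarrow> 'v \<Rightarrow> 'v"

definition linear_presheaf :: "('o, 'f) lincat \<Rightarrow> ('o, 'f, 'v) presheaf \<Rightarrow> bool" where
  "linear_presheaf C F \<longleftrightarrow>
     (\<forall>K\<in>Ob C. cvector_space (FOb F K)) \<and>
     (\<forall>K\<in>Ob C. \<forall>L\<in>Ob C. \<forall>\<psi>\<in>carr (Mor C K L). clinear_map (FOb F L) (FOb F K) (FMor F K L \<psi>)) \<and>
     (\<forall>K\<in>Ob C. \<forall>v\<in>carr (FOb F K). FMor F K K (Id C K) v = v) \<and>
     (\<forall>K\<in>Ob C. \<forall>L\<in>Ob C. \<forall>M\<in>Ob C. \<forall>\<psi>\<in>carr (Mor C K L). \<forall>\<phi>\<in>carr (Mor C L M). \<forall>v\<in>carr (FOb F M).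
        FMor F K M (Comp C K L M \<phi> \<psi>) v = FMor F K L \<psi> (FMor F L M \<phi> v)) \<and>
     (\<forall>K\<in>Ob C. \<forall>L\<in>Ob C. \<forall>v\<in>carr (FOb F L).
        clinear_map (Mor C K L) (FOb F K) (\<lambda>\<psi>. FMor F K L \<psi> v))"

definition natural_transformation ::
    "('o, 'f) lincat \<Rightarrow> ('o, 'f, 'v) presheaf \<Rightarrow> ('o, 'f, 'w) presheaf \<Rightarrow> ('o \<Rightarrow> 'v \<Rightarrow> 'w) \<Rightarrow> bool" where
  "natural_transformation C F G \<eta> \<longleftrightarrow>
     (\<forall>K\<in>Ob C. clinear_map (FOb F K) (FOb G K) (\<eta> K)) \<and>
     (\<forall>K\<in>Ob C. \<forall>L\<in>Ob C. \<forall>\<psi>\<in>carr (Mor C K L). \<forall>v\<in>carr (FOb F L).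
        \<eta> K (FMor F K L \<psi> v) = FMor G K L \<psi> (\<eta> L v))"

definition mutually_inverse ::
    "('o, 'f) lincat \<Rightarrow> ('o, 'f, 'v) presheaf \<Rightarrow> ('o, 'f, 'w) presheaf
      \<Rightarrow> ('o \<Rightarrow> 'v \<Rightarrow> 'w) \<Rightarrow> ('o \<Rightarrow> 'w \<Rightarrow> 'v) \<Rightarrow> bool" where
  "mutually_inverse C F G \<eta> \<theta> \<longleftrightarrow>
     (\<forall>K\<in>Ob C. (\<forall>v\<in>carr (FOb F K). \<theta> K (\<eta> K v) = v) \<and> (\<forall>w\<in>carr (FOb G K). \<eta> K (\<theta> K w) = w))"


section \<open>The category of fgp bimodules, the two functors, and the two transformations\<close>

text \<open>Adjoints in \<open>Bim_fgp\<close> are taken with respect to the right inner products.\<close>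

definition Bim_fgp :: "'b::cstar_algebra set \<Rightarrow> (('k, 'b) bimod, 'k \<Rightarrow> 'k) lincat" where
  "Bim_fgp A = \<lparr>Ob = {K. hilbert_bimodule A K \<and> left_fgp A K \<and> right_fgp A K},
     Mor = (\<lambda>K L. map_space K L (adj_maps A A K L)),
     Id = (\<lambda>K. \<lambda>k\<in>carr K. k),
     Comp = (\<lambda>K L M \<phi> \<psi>. compose (carr K) \<phi> \<psi>)\<rparr>"

definition diamond ::
    "'b::cstar_algebra set \<Rightarrow> ('b \<Rightarrow> 'b) \<Rightarrow> ('k, 'b) bimod \<Rightarrow> ('k \<Rightarrow> (nat \<Rightarrow> 'b) set) set" where
  "diamond A E K = {f \<in> adj_maps A A K (calB E). f ` carr K \<subseteq> range (Omega E)}"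

definition check :: "('b::cstar_algebra \<Rightarrow> 'b) \<Rightarrow> ('k \<Rightarrow> (nat \<Rightarrow> 'b) set) \<Rightarrow> 'k \<Rightarrow> 'b" where
  "check E f k = (THE b. Omega E b = f k)"

definition diamond_functor :: "'b::cstar_algebra set \<Rightarrow> ('b \<Rightarrow> 'b)
    \<Rightarrow> (('k, 'b) bimod, 'k \<Rightarrow> 'k, 'k \<Rightarrow> (nat \<Rightarrow> 'b) set) presheaf" where
  "diamond_functor A E = \<lparr>FOb = (\<lambda>K. map_space K (calB E) (diamond A E K)),
     FMor = (\<lambda>K L \<psi> f. compose (carr K) f \<psi>)\<rparr>"

definition tensor_functor :: "'b::cstar_algebra set
    \<Rightarrow> (('k, 'b) bimod, 'k \<Rightarrow> 'k, (nat \<Rightarrow> ('k \<times> 'b) list) set \<Rightarrow> 'b) presheaf" where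
  "tensor_functor A =
     \<lparr>FOb = (\<lambda>K. map_space (tensor K self_corr) self_corr
                  (adj_maps A UNIV (tensor K self_corr) self_corr)),
      FMor = (\<lambda>K L \<psi> f. compose (carr (tensor K self_corr)) f (tensor_map_id K L self_corr \<psi>))\<rparr>"

text \<open>\<open>Psi_spec\<close> is the prescription on elementary tensors that defines \<open>\<Psi>\<^sub>K(g)\<close>; that exactly
  one adjointable bimodular map meets it is part of the theorem.\<close>

definition Psi_spec :: "'b::cstar_algebra set \<Rightarrow> ('b \<Rightarrow> 'b) \<Rightarrow> ('k, 'b) bimod
    \<Rightarrow> ('k \<Rightarrow> (nat \<Rightarrow> 'b) set) \<Rightarrow> ((nat \<Rightarrow> ('k \<times> 'b) list) set \<Rightarrow> 'b) \<Rightarrow> bool" where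
  "Psi_spec A E K g f \<longleftrightarrow> f \<in> adj_maps A UNIV (tensor K self_corr) self_corr \<and>
     (\<forall>k\<in>carr K. \<forall>b. f (elem_tensor K self_corr k b) = check E g k * b)"

definition Psi :: "'b::cstar_algebra set \<Rightarrow> ('b \<Rightarrow> 'b) \<Rightarrow> ('k, 'b) bimod
    \<Rightarrow> ('k \<Rightarrow> (nat \<Rightarrow> 'b) set) \<Rightarrow> (nat \<Rightarrow> ('k \<times> 'b) list) set \<Rightarrow> 'b" where
  "Psi A E K g = (THE f. Psi_spec A E K g f)"

definition Phi :: "('b::cstar_algebra \<Rightarrow> 'b) \<Rightarrow> ('k, 'b) bimod
    \<Rightarrow> ((nat \<Rightarrow> ('k \<times> 'b) list) set \<Rightarrow> 'b) \<Rightarrow> 'k \<Rightarrow> (nat \<Rightarrow> 'b) set" where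
  "Phi E K f = (\<lambda>k\<in>carr K. Omega E (f (elem_tensor K self_corr k 1)))"

end

theory Submission
  imports Defs
begin

text \<open>
Let \<open>K\<close> be a finitely generated projective bimodule. It has a finite Parseval frame \<open>e\<^sub>i\<close>, that is
\<open>\<langle>x, y\<rangle> = \<Sum>\<^sub>i \<langle>x, e\<^sub>i\<rangle> \<langle>e\<^sub>i, y\<rangle>\<close>, and so every additive right \<open>A\<close>-linear \<open>h : K \<rightarrow> B\<close> satisfies
\<open>h x = \<Sum>\<^sub>i h e\<^sub>i \<langle>e\<^sub>i, x\<rangle>\<close>. Such a map is automatically continuous and adjointable in every sense
that matters here, and both spaces of the theorem turn out to be copies of the space of purely
algebraic \<open>A\<close>-\<open>A\<close> bimodule maps \<open>h : K \<rightarrow> B\<close>.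

On the diamond side \<open>h\<close> corresponds to \<open>x \<mapsto> h x \<Omega>\<close>, with adjoint
\<open>y \<mapsto> \<Sum>\<^sub>i e\<^sub>i \<langle>h e\<^sub>i \<Omega>, y\<rangle>\<close> (lemmas \<open>Omega_map_diamond\<close>, \<open>diamond_is_Omega_map\<close>). On the tensor side
it corresponds to \<open>x \<boxtimes> b \<mapsto> h x b\<close>; this is the inner product with \<open>\<Sum>\<^sub>i e\<^sub>i \<boxtimes> (h e\<^sub>i)\<^sup>\<star>\<close> and hence
well defined, continuous and adjointable (lemmas \<open>eval_map_adj\<close>, \<open>adj_is_eval_map\<close>). Under these two
parametrisations \<open>\<Psi>\<close> and \<open>\<Phi>\<close> both become the identity on bimodule maps, and both functors become
precomposition \<open>h \<mapsto> h \<circ> \<psi>\<close>. Linearity, functoriality, naturality and mutual inverseness are then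
formal; they are derived for all presheaves parametrised in this way (locale
\<open>represented_presheaf\<close>).

The analysis needed is the theory of the two completions: a Cauchy-Schwarz inequality for
algebra-valued semi-inner products, which gives the triangle inequality and continuity of all
operations. It rests on two facts about a C*-algebra, that the norm is monotone on nonnegative
elements (\<open>norm_mono\<close>) and that \<open>c\<^sup>\<star> * c\<close> is nonnegative (\<open>nonneg_star_mult_self\<close>). They are proved
from the C*-identity, with square roots constructed by iteration in place of spectral theory.
\<close>

section \<open>Elementary identities in C*-algebras\<close>

lemma star_zero [simp]: "(0::'b::cstar_algebra)\<^sup>\<star> = 0"
  using star_add[of "0::'b" 0] by simp

lemma star_one [simp]: "(1::'b::cstar_algebra)\<^sup>\<star> = 1"
  using star_mult[of "(1::'b)\<^sup>\<star>" 1] by (simp add: star_star)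

lemma star_scaleR: "(r *\<^sub>R x)\<^sup>\<star> = r *\<^sub>R (x::'b::cstar_algebra)\<^sup>\<star>"
  by (simp add: scaleR_scaleC star_scaleC)

lemma star_minus: "(- x)\<^sup>\<star> = - (x::'b::cstar_algebra)\<^sup>\<star>"
  using star_scaleR[of "-1" x] by simp

lemma star_diff: "(x - y)\<^sup>\<star> = (x::'b::cstar_algebra)\<^sup>\<star> - y\<^sup>\<star>"
  using star_add[of x "- y"] by (simp add: star_minus)

lemma star_of_real [simp]: "(of_real r::'b::cstar_algebra)\<^sup>\<star> = of_real r"
  by (simp add: of_real_def star_scaleR)

lemma of_real_commute: "of_real t * h = h * of_real t" for h :: "'b::cstar_algebra"
  by (simp add: of_real_def)

lemma scaleC_minus_one: "(-1) *\<^sub>c x = - (x::'b::cstar_algebra)"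
  using scaleR_scaleC[of "-1" x] by simp

lemma scaleC_diff_right: "c *\<^sub>c (x - y) = c *\<^sub>c x - c *\<^sub>c (y::'b::cstar_algebra)"
  using scaleC_add_right[of c "x - y" y] by simp

lemma scaleC_zero_right [simp]: "c *\<^sub>c (0::'b::cstar_algebra) = 0"
  using scaleC_add_right[of c "0::'b" 0] by simp

lemma norm_star [simp]: "norm ((x::'b::cstar_algebra)\<^sup>\<star>) = norm x"
proof -
  have le: "norm y \<le> norm (y\<^sup>\<star>)" for y :: 'b
  proof (cases "norm y = 0")
    case False
    have "norm y * norm y \<le> norm (y\<^sup>\<star>) * norm y"
      using cstar_identity[of y] norm_mult_ineq[of "y\<^sup>\<star>" y] by (simp add: power2_eq_square)
    then show ?thesis using False by simp
  qed simp
  show ?thesis using le[of x] le[of "x\<^sup>\<star>"] by (simp add: star_star)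
qed

lemma cstar_identity': "norm (x * (x::'b::cstar_algebra)\<^sup>\<star>) = (norm x)\<^sup>2"
  using cstar_identity[of "x\<^sup>\<star>"] by (simp add: star_star)

lemma bounded_linear_star: "bounded_linear (star :: 'b::cstar_algebra \<Rightarrow> 'b)"
  by (rule bounded_linear_intro[where K=1]) (simp_all add: star_add star_scaleR)

lemmas tendsto_star = bounded_linear.tendsto[OF bounded_linear_star]

lemma star_sum: "(\<Sum>i\<in>I. f i)\<^sup>\<star> = (\<Sum>i\<in>I. (f i :: 'b::cstar_algebra)\<^sup>\<star>)"
  by (induction I rule: infinite_finite_induct) (simp_all add: star_add)

lemma bounded_linear_scaleC: "bounded_linear (\<lambda>x :: 'b::cstar_algebra. c *\<^sub>c x)"
  by (rule bounded_linear_intro[where K="cmod c"])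
    (simp_all add: scaleC_add_right norm_scaleC scaleR_scaleC scaleC_scaleC mult.commute)

lemmas tendsto_scaleC = bounded_linear.tendsto[OF bounded_linear_scaleC]

lemma subalgebra_closures:
  assumes "cstar_subalgebra S"
  shows subalgebra_one: "1 \<in> S"
    and subalgebra_add: "x \<in> S \<Longrightarrow> y \<in> S \<Longrightarrow> x + y \<in> S"
    and subalgebra_mult: "x \<in> S \<Longrightarrow> y \<in> S \<Longrightarrow> x * y \<in> S"
    and subalgebra_star: "x \<in> S \<Longrightarrow> x\<^sup>\<star> \<in> S"
    and subalgebra_scaleC: "x \<in> S \<Longrightarrow> c *\<^sub>c x \<in> S"
    and subalgebra_scaleR: "x \<in> S \<Longrightarrow> r *\<^sub>R x \<in> S"
    and subalgebra_diff: "x \<in> S \<Longrightarrow> y \<in> S \<Longrightarrow> x - y \<in> S"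
    and subalgebra_zero: "0 \<in> S"
    and subalgebra_of_real: "of_real r \<in> S"
    and subalgebra_closed: "closed S"
proof -
  show 1: "1 \<in> S" and 2: "\<And>x y. x \<in> S \<Longrightarrow> y \<in> S \<Longrightarrow> x + y \<in> S"
    and "x \<in> S \<Longrightarrow> y \<in> S \<Longrightarrow> x * y \<in> S" "x \<in> S \<Longrightarrow> x\<^sup>\<star> \<in> S"
    and 3: "\<And>c x. x \<in> S \<Longrightarrow> c *\<^sub>c x \<in> S" and "closed S"
    using assms by (auto simp: cstar_subalgebra_def)
  show 4: "\<And>r x. x \<in> S \<Longrightarrow> r *\<^sub>R x \<in> S" using 3 by (simp add: scaleR_scaleC)
  show "x \<in> S \<Longrightarrow> y \<in> S \<Longrightarrow> x - y \<in> S" using 2[of x "(-1) *\<^sub>R y"] 4[of y "-1"] by simp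
  show "0 \<in> S" using 4[OF 1, of 0] by simp
  show "of_real r \<in> S" using 4[OF 1, of r] by (simp add: of_real_def)
qed

lemma subalgebra_UNIV: "cstar_subalgebra UNIV"
  by (simp add: cstar_subalgebra_def)

section \<open>Positivity\<close>

text \<open>The root of \<open>1 - h\<close> is \<open>1 - y\<close> for a fixed point \<open>y\<close> of \<open>y = (h + y\<^sup>2) / 2\<close>. Iteration from 0
converges on the whole closed unit ball: its increments are dominated in norm by those of the
scalar iteration for \<open>h = 1\<close>, which increases to a limit. The iterates are polynomials in \<open>h\<close>, so \<open>y\<close>
stays in \<open>S\<close> and commutes with everything that commutes with \<open>h\<close>.\<close>

lemma sqrt_one_minus:
  fixes h :: "'b::cstar_algebra"
  assumes S: "cstar_subalgebra S" and h: "h \<in> S" "h\<^sup>\<star> = h" "norm h \<le> 1"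
  shows "\<exists>y\<in>S. y\<^sup>\<star> = y \<and> norm y \<le> 1 \<and> (1 - y) * (1 - y) = 1 - h \<and>
    (\<forall>x. x * h = h * x \<longrightarrow> x * y = y * x)"
proof -
  define y where "y = rec_nat (0::'b) (\<lambda>_ u. (1/2) *\<^sub>R (h + u * u))"
  define z where "z = rec_nat (0::real) (\<lambda>_ u. (1/2) * (1 + u * u))"
  have y0: "y 0 = 0" and yS: "y (Suc n) = (1/2) *\<^sub>R (h + y n * y n)" for n by (simp_all add: y_def)
  have z0: "z 0 = 0" and zS: "z (Suc n) = (1/2) * (1 + z n * z n)" for n by (simp_all add: z_def)
  have comm: "x * y n = y n * x" if "x * h = h * x" for x n
  proof (induction n)
    case (Suc n)
    have "x * (y n * y n) = (y n * y n) * x" by (metis Suc mult.assoc)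
    then show ?case by (simp add: yS algebra_simps that)
  qed (simp add: y0)
  have commy: "y m * y n = y n * y m" for m n
    by (intro comm) (simp add: comm[OF refl])
  have z01: "0 \<le> z n \<and> z n \<le> 1" for n
  proof (induction n)
    case (Suc n) then show ?case using mult_le_one[of "z n" "z n"] by (auto simp: zS)
  qed (simp add: z0)
  \<comment> \<open>\<open>z (n + 1) - z n = (1 - z n)\<^sup>2 / 2\<close>\<close>
  have z_inc: "z n \<le> z (Suc n)" for n
    using zero_le_square[of "z n - 1"] by (simp add: zS algebra_simps)
  have ny: "norm (y n) \<le> z n" for n
  proof (induction n)
    case (Suc n)
    have "norm (h + y n * y n) \<le> 1 + z n * z n"
      by (rule order_trans[OF norm_triangle_ineq] add_mono h(3)
          order_trans[OF norm_mult_ineq] mult_mono Suc norm_ge_zero conjunct1[OF z01])+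
    then show ?case by (simp add: yS zS)
  qed (simp add: y0 z0)
  have step: "norm (y (Suc n) - y n) \<le> z (Suc n) - z n" for n
  proof (induction n)
    case 0 then show ?case using ny[of 1] by (simp add: y0 z0)
  next
    case (Suc n)
    have "y (Suc (Suc n)) - y (Suc n) = (1/2) *\<^sub>R (y (Suc n) * y (Suc n) - y n * y n)"
      by (simp add: yS algebra_simps)
    also have "\<dots> = (1/2) *\<^sub>R ((y (Suc n) - y n) * (y (Suc n) + y n))"
      using commy[of n "Suc n"] by (simp add: algebra_simps)
    also have "norm \<dots> \<le> (1/2) * ((z (Suc n) - z n) * (z (Suc n) + z n))"
      using norm_mult_ineq[of "y (Suc n) - y n" "y (Suc n) + y n"]
        mult_mono[OF Suc order_trans[OF norm_triangle_ineq add_mono[OF ny[of "Suc n"] ny[of n]]]]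
        z_inc[of n]
      by simp
    also have "\<dots> = z (Suc (Suc n)) - z (Suc n)"
      by (simp add: zS[of "Suc n"] zS[of n] field_simps)
    finally show ?case .
  qed
  have dist_add: "norm (y (n + k) - y n) \<le> z (n + k) - z n" for n k
  proof (induction k)
    case (Suc k)
    then show ?case
      using norm_triangle_ineq[of "y (n + Suc k) - y (n + k)" "y (n + k) - y n"] step[of "n + k"]
      by simp
  qed simp
  have dist: "dist (y m) (y n) \<le> dist (z m) (z n)" for m n
  proof (induction m n rule: linorder_wlog)
    case (le m n)
    then show ?case using dist_add[of m "n - m"] by (simp add: dist_norm norm_minus_commute)
  qed (simp add: dist_commute)
  have "incseq z" using z_inc by (intro incseq_SucI)
  moreover have "Bseq z" using z01 by (intro BseqI'[of _ 1]) (auto simp: abs_le_iff)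
  ultimately have "Cauchy z" by (intro convergent_Cauchy Bseq_mono_convergent) (auto simp: incseq_def)
  then have "Cauchy y" unfolding Cauchy_def by (meson dist le_less_trans)
  then obtain l where l: "y \<longlonglongrightarrow> l" using Cauchy_convergent_iff convergentD by blast
  have ySS: "y n \<in> S" for n
    by (induction n) (auto simp: y0 yS intro!: subalgebra_closures[OF S] h(1))
  have star: "(y n)\<^sup>\<star> = y n" for n
    by (induction n) (simp_all add: y0 yS star_scaleR star_add star_mult h(2))
  have "l \<in> S" using closed_sequentially[OF subalgebra_closed[OF S] _ l] ySS by blast
  moreover have "l\<^sup>\<star> = l" using LIMSEQ_unique[OF tendsto_star[OF l]] l by (simp add: star)
  moreover have "norm l \<le> 1"
    by (rule LIMSEQ_le_const2[OF tendsto_norm[OF l]]) (meson ny z01 order_trans)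
  moreover have "(1 - l) * (1 - l) = 1 - h"
  proof -
    have "(\<lambda>n. y (Suc n)) \<longlonglongrightarrow> (1/2) *\<^sub>R (h + l * l)"
      unfolding yS by (intro tendsto_intros l)
    then have *: "l = (1/2) *\<^sub>R (h + l * l)"
      using LIMSEQ_unique LIMSEQ_Suc[OF l] by blast
    have "2 *\<^sub>R l = h + l * l" by (subst *) simp
    then have "l + l = h + l * l" by (simp add: scaleR_2)
    then show ?thesis by (simp add: algebra_simps)
  qed
  moreover have "x * l = l * x" if "x * h = h * x" for x
  proof (rule LIMSEQ_unique)
    show "(\<lambda>n. x * y n) \<longlonglongrightarrow> x * l" by (intro tendsto_intros l)
    show "(\<lambda>n. x * y n) \<longlonglongrightarrow> l * x" unfolding comm[OF that] by (intro tendsto_intros l)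
  qed
  ultimately show ?thesis by blast
qed

text \<open>For a self-adjoint element this says that the spectrum lies in \<open>[0, 2t]\<close> for some \<open>t\<close>. In this
form sums are nonnegative by the triangle inequality; that every \<open>c\<^sup>\<star> * c\<close> is nonnegative is
lemma \<open>nonneg_star_mult_self\<close>.\<close>

definition nonneg :: "'b::cstar_algebra \<Rightarrow> bool" where
  "nonneg h \<longleftrightarrow> h\<^sup>\<star> = h \<and> (\<exists>t. norm (of_real t - h) \<le> t)"

lemma nonneg_star: "nonneg h \<Longrightarrow> h\<^sup>\<star> = h"
  by (simp add: nonneg_def)

lemma nonneg_add:
  assumes "nonneg h" "nonneg k" shows "nonneg (h + k)"
proof -
  obtain s t where "norm (of_real s - h) \<le> s" "norm (of_real t - k) \<le> t"
    using assms by (auto simp: nonneg_def)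
  then have "norm (of_real (s + t) - (h + k)) \<le> s + t"
    using norm_triangle_ineq[of "of_real s - h" "of_real t - k"] by (simp add: algebra_simps)
  moreover have "(h + k)\<^sup>\<star> = h + k" using assms by (simp add: nonneg_def star_add)
  ultimately show ?thesis unfolding nonneg_def by blast
qed

lemma nonneg_scaleR:
  assumes "nonneg h" "0 \<le> r" shows "nonneg (r *\<^sub>R h)"
proof -
  obtain t where t: "norm (of_real t - h) \<le> t" using assms by (auto simp: nonneg_def)
  have "norm (of_real (r * t) - r *\<^sub>R h) = norm (r *\<^sub>R (of_real t - h))"
    by (simp add: of_real_def scaleR_diff_right)
  also have "\<dots> \<le> r * t" using t assms(2) by (simp add: mult_left_mono)
  finally have "norm (of_real (r * t) - r *\<^sub>R h) \<le> r * t" .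
  moreover have "(r *\<^sub>R h)\<^sup>\<star> = r *\<^sub>R h" using assms by (simp add: nonneg_def star_scaleR)
  ultimately show ?thesis unfolding nonneg_def by blast
qed

lemma nonneg_minus:
  assumes "h\<^sup>\<star> = h" "norm h \<le> t" shows "nonneg (of_real t - h)"
proof -
  have "norm (of_real t - (of_real t - h)) \<le> t" using assms by simp
  moreover have "(of_real t - h)\<^sup>\<star> = of_real t - h" using assms by (simp add: star_diff)
  ultimately show ?thesis unfolding nonneg_def by blast
qed

lemma nonneg_plus:
  assumes "h\<^sup>\<star> = h" "norm h \<le> t" shows "nonneg (of_real t + h)"
  using nonneg_minus[of "- h" t] assms by (simp add: star_minus)

text \<open>Rescaling by some \<open>t\<close> with \<open>norm (t - h) \<le> t\<close> turns \<open>h\<close> into \<open>1 - g\<close> with \<open>g\<close> in the unit ball. The root of a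
nonnegative element then commutes with everything that commutes with the element, which makes
products of commuting roots self-adjoint below.\<close>

lemma nonneg_sqrt_in:
  assumes S: "cstar_subalgebra S" and h: "nonneg h" "h \<in> S"
  obtains d where "d \<in> S" "nonneg d" "d * d = h" "\<And>x. x * h = h * x \<Longrightarrow> x * d = d * x"
proof -
  obtain t0 where t0: "norm (of_real t0 - h) \<le> t0" using h by (auto simp: nonneg_def)
  define t where "t = t0 + 1"
  have "0 \<le> t0" using t0 order_trans[OF norm_ge_zero] by blast
  then have tpos: "t > 0" by (simp add: t_def)
  have "norm (of_real t - h) \<le> t"
    using t0 norm_triangle_ineq[of "of_real t0 - h" 1] by (simp add: t_def algebra_simps)
  \<comment> \<open>normalise, so that \<open>h / t = 1 - g\<close> with \<open>g\<close> in the unit ball\<close>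
  define g where "g = 1 - (1/t) *\<^sub>R h"
  have g: "g = (1/t) *\<^sub>R (of_real t - h)"
    using tpos by (simp add: g_def of_real_def scaleR_diff_right)
  have "norm g \<le> 1"
    unfolding g using tpos \<open>norm (of_real t - h) \<le> t\<close> by simp
  moreover have "g \<in> S" unfolding g_def by (intro subalgebra_closures[OF S] h)
  moreover have "g\<^sup>\<star> = g" by (simp add: g_def star_diff star_scaleR nonneg_star[OF h(1)])
  ultimately obtain y where y: "y \<in> S" "y\<^sup>\<star> = y" "norm y \<le> 1" "(1 - y) * (1 - y) = 1 - g"
    and c: "\<And>x. x * g = g * x \<Longrightarrow> x * y = y * x"
    using sqrt_one_minus[OF S] by metis
  show thesis
  proof
    show "sqrt t *\<^sub>R (1 - y) \<in> S" by (intro subalgebra_closures[OF S] y)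
    have "nonneg (1 - y)" using nonneg_minus[OF y(2,3)] by simp
    then show "nonneg (sqrt t *\<^sub>R (1 - y))" using tpos by (intro nonneg_scaleR) auto
    show "sqrt t *\<^sub>R (1 - y) * sqrt t *\<^sub>R (1 - y) = h" using tpos y(4) by (simp add: g_def)
    show "x * sqrt t *\<^sub>R (1 - y) = sqrt t *\<^sub>R (1 - y) * x" if "x * h = h * x" for x
      using c[of x] that by (simp add: g_def algebra_simps)
  qed
qed

lemmas nonneg_sqrt = nonneg_sqrt_in[OF subalgebra_UNIV _ UNIV_I]

text \<open>With \<open>u = h + \<i>d\<close> one has \<open>u\<^sup>\<star> * u = h\<^sup>2 + d\<^sup>2 = t\<^sup>2\<close>, so \<open>u\<close> has norm \<open>t\<close> by the C*-identity, and \<open>h\<close> is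
its real part.\<close>

lemma norm_le_of_squares:
  fixes h d :: "'b::cstar_algebra"
  assumes "h\<^sup>\<star> = h" "d\<^sup>\<star> = d" "h * d = d * h" "h * h + d * d = of_real (t\<^sup>2)" "0 \<le> t"
  shows "norm h \<le> t"
proof -
  define u where "u = h + \<i> *\<^sub>c d"
  have us: "u\<^sup>\<star> = h - \<i> *\<^sub>c d"
    using scaleC_scaleC[of "-1" \<i> d] scaleC_minus_one[of "\<i> *\<^sub>c d"]
    by (simp add: u_def star_add star_scaleC assms)
  have ii: "\<i> *\<^sub>c \<i> *\<^sub>c x = - x" for x :: 'b by (simp add: scaleC_scaleC scaleC_minus_one)
  have "u\<^sup>\<star> * u = of_real (t\<^sup>2)"
    unfolding us unfolding u_def using assms(3,4)
    by (simp add: algebra_simps mult_scaleC_left mult_scaleC_right scaleC_diff_right ii)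
  then have "(norm u)\<^sup>2 = t\<^sup>2" using cstar_identity[of u] by (simp del: of_real_power)
  then have "norm u = t" using assms(5) by (simp add: power2_eq_iff_nonneg)
  moreover have "2 *\<^sub>R h = u + u\<^sup>\<star>" by (simp only: us) (simp add: u_def scaleR_2)
  then have "2 * norm h \<le> norm u + norm (u\<^sup>\<star>)"
    using norm_triangle_ineq[of u "u\<^sup>\<star>"] by (metis abs_numeral norm_scaleR)
  ultimately show ?thesis by simp
qed

lemma commuting_product_square:
  fixes a b :: "'b::cstar_algebra"
  assumes "a * b = b * a" shows "(a * b) * (a * b) = (a * a) * (b * b)"
  by (metis assms mult.assoc)

lemma nonneg_mult:
  assumes "nonneg h" "nonneg k" "h * k = k * h"
  obtains d where "d\<^sup>\<star> = d" "d * d = h * k"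
    "\<And>x. x * h = h * x \<Longrightarrow> x * k = k * x \<Longrightarrow> x * d = d * x"
proof -
  obtain a where a: "nonneg a" "a * a = h" "\<And>x. x * h = h * x \<Longrightarrow> x * a = a * x"
    using nonneg_sqrt[OF assms(1)] by metis
  obtain b where b: "nonneg b" "b * b = k" "\<And>x. x * k = k * x \<Longrightarrow> x * b = b * x"
    using nonneg_sqrt[OF assms(2)] by metis
  have "k * a = a * k" using a(3)[of k] assms(3) by simp
  then have ab: "a * b = b * a" using b(3)[of a] by simp
  show thesis
  proof
    show "(a * b)\<^sup>\<star> = a * b" using a(1) b(1) ab by (simp add: star_mult nonneg_star)
    show "(a * b) * (a * b) = h * k" using a(2) b(2) by (simp add: commuting_product_square[OF ab])
    show "x * (a * b) = (a * b) * x" if "x * h = h * x" "x * k = k * x" for x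
      by (metis a(3) b(3) mult.assoc that)
  qed
qed

text \<open>\<open>d\<close> is a root of \<open>t\<^sup>2 - h\<^sup>2 = (t - h) * (t + h)\<close>.\<close>

lemma square_complement:
  fixes h :: "'b::cstar_algebra"
  assumes "nonneg (of_real t - h)" "nonneg (of_real t + h)"
  obtains d where "d\<^sup>\<star> = d" "h * d = d * h" "h * h + d * d = of_real (t\<^sup>2)"
proof -
  have "(of_real t - h) * (of_real t + h) = (of_real t + h) * (of_real t - h)"
    by (simp add: algebra_simps of_real_commute[of t h])
  from nonneg_mult[OF assms this]
  obtain d where d: "d\<^sup>\<star> = d" "d * d = (of_real t - h) * (of_real t + h)"
    and c: "\<And>x. x * (of_real t - h) = (of_real t - h) * x \<Longrightarrow>
          x * (of_real t + h) = (of_real t + h) * x \<Longrightarrow> x * d = d * x"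
    by blast
  show thesis
  proof
    show "d\<^sup>\<star> = d" by (rule d)
    show "h * d = d * h" by (rule c) (simp_all add: algebra_simps of_real_commute[of t h])
    show "h * h + d * d = of_real (t\<^sup>2)"
      unfolding d(2) by (simp add: algebra_simps power2_eq_square of_real_commute[of t h])
  qed
qed

lemma nonneg_square:
  fixes h :: "'b::cstar_algebra"
  assumes h: "h\<^sup>\<star> = h" shows "nonneg (h * h)"
proof -
  define t where "t = norm h"
  have "nonneg (of_real t - h)" "nonneg (of_real t + h)"
    using h by (auto intro: nonneg_minus nonneg_plus simp: t_def)
  then obtain d where d: "d\<^sup>\<star> = d" "h * d = d * h" "h * h + d * d = of_real (t\<^sup>2)"
    by (rule square_complement)
  have "norm d \<le> t"
    using d h by (intro norm_le_of_squares[of d h]) (auto simp: t_def add.commute)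
  have "norm (of_real (t\<^sup>2) - h * h) = norm (d * d)" by (simp only: d(3)[symmetric] add_diff_cancel_left')
  also have "\<dots> \<le> norm d * norm d" by (rule norm_mult_ineq)
  also have "\<dots> \<le> t\<^sup>2" unfolding power2_eq_square
    by (intro mult_mono \<open>norm d \<le> t\<close>) (auto simp: t_def)
  finally have "norm (of_real (t\<^sup>2) - h * h) \<le> t\<^sup>2" .
  moreover have "(h * h)\<^sup>\<star> = h * h" using h by (simp add: star_mult)
  ultimately show ?thesis unfolding nonneg_def by blast
qed

lemma nonneg_of_real: "0 \<le> t \<Longrightarrow> nonneg (of_real t)"
  using nonneg_plus[of 0 t] by simp

lemma nonneg_mult_commuting:
  assumes "nonneg h" "nonneg k" "h * k = k * h" shows "nonneg (h * k)"
  by (rule nonneg_mult[OF assms]) (metis nonneg_square)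

text \<open>For \<open>t = norm q\<close> both \<open>t - p\<close> and \<open>t + p\<close> are nonnegative, so \<open>p\<^sup>2\<close> has a complement in \<open>t\<^sup>2\<close> and
\<open>norm p \<le> t\<close>. This is how all norm estimates for inner products arise from positivity.\<close>

lemma norm_mono:
  fixes p q :: "'b::cstar_algebra"
  assumes "nonneg p" "nonneg (q - p)" shows "norm p \<le> norm q"
proof -
  define t where "t = norm q"
  have "q\<^sup>\<star> = q" using nonneg_star[OF nonneg_add[OF assms]] by simp
  then have "nonneg (of_real t - q)" by (simp add: nonneg_minus t_def)
  from nonneg_add[OF this assms(2)] have 1: "nonneg (of_real t - p)" by simp
  have "nonneg (of_real t + p)" by (intro nonneg_add nonneg_of_real assms) (simp add: t_def)
  with 1 obtain d where "d\<^sup>\<star> = d" "p * d = d * p" "p * p + d * d = of_real (t\<^sup>2)"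
    by (rule square_complement)
  then show ?thesis
    using norm_le_of_squares[of p d t] nonneg_star[OF assms(1)] by (simp add: t_def)
qed

text \<open>Put \<open>h = - x\<^sup>\<star> * x\<close>, \<open>k = x * x\<^sup>\<star>\<close> and \<open>r = (norm x)\<^sup>2\<close>, the norm of both. Since \<open>x\<^sup>\<star> * x + x * x\<^sup>\<star>\<close> is a
sum of squares of self-adjoint elements, \<open>k\<close> is nonnegative as well. Now
\<open>(r - k) * x = x * (r + h)\<close>; the squared norm is at most \<open>r\<^sup>3 / 4\<close> on the left, because
\<open>s * (r - s) \<le> r\<^sup>2 / 4\<close>, and at least \<open>r\<^sup>3\<close> on the right. Hence \<open>r = 0\<close>.\<close>

lemma star_mult_self_negative_imp_zero:
  fixes x w :: "'b::cstar_algebra"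
  assumes w: "w\<^sup>\<star> = w" and xw: "x\<^sup>\<star> * x = - (w * w)"
  shows "x = 0"
proof -
  define h where "h = w * w"
  define k where "k = x * x\<^sup>\<star>"
  define r where "r = (norm x)\<^sup>2"
  have h: "nonneg h" unfolding h_def by (rule nonneg_square[OF w])
  have xh: "x\<^sup>\<star> * x = - h" by (simp add: xw h_def)
  have "nonneg k"
  proof -
    \<comment> \<open>\<open>a\<close> and \<open>b\<close> are twice the real and (up to sign) the imaginary part of \<open>x\<close>\<close>
    define a where "a = x + x\<^sup>\<star>"
    define b where "b = \<i> *\<^sub>c (x - x\<^sup>\<star>)"
    have "a\<^sup>\<star> = a" by (simp add: a_def star_add star_star)
    moreover have "b\<^sup>\<star> = b"
    proof -
      have "b\<^sup>\<star> = (- \<i>) *\<^sub>c (x\<^sup>\<star> - x)" by (simp add: b_def star_scaleC star_diff star_star)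
      also have "\<dots> = \<i> *\<^sub>c ((-1) *\<^sub>c (x\<^sup>\<star> - x))" by (simp only: scaleC_scaleC) simp
      finally show ?thesis by (simp only: b_def scaleC_minus_one minus_diff_eq)
    qed
    ultimately have "nonneg (a * a + b * b)" by (intro nonneg_add nonneg_square)
    moreover have "b * b = - ((x - x\<^sup>\<star>) * (x - x\<^sup>\<star>))"
      by (simp add: b_def mult_scaleC_left mult_scaleC_right scaleC_scaleC scaleC_minus_one
          flip: scaleC_minus_one)
    then have "a * a + b * b = 2 *\<^sub>R (x * x\<^sup>\<star> + x\<^sup>\<star> * x)"
      by (simp add: a_def algebra_simps scaleR_2)
    ultimately have "nonneg ((1/2) *\<^sub>R (2 *\<^sub>R (x * x\<^sup>\<star> + x\<^sup>\<star> * x)))"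
      by (intro nonneg_scaleR[where r = "1/2"]) (simp, simp)
    then have "nonneg (k - h)" by (simp add: k_def xh)
    from nonneg_add[OF this h] show ?thesis by simp
  qed
  have nh: "norm h = r" using cstar_identity[of x] by (simp add: xh r_def)
  have nk: "norm k = r" using cstar_identity'[of x] by (simp add: k_def r_def)
  have r0: "0 \<le> r" by (simp add: r_def)
  have ks: "k\<^sup>\<star> = k" and hs: "h\<^sup>\<star> = h" using h \<open>nonneg k\<close> by (simp_all add: nonneg_star)
  have rk: "nonneg (of_real r - k)" by (rule nonneg_minus) (simp_all add: ks nk)
  \<comment> \<open>both sides of \<open>(r - k) x = x (r + h)\<close> are measured, the left one from above\<close>
  have "norm (of_real r - k) \<le> norm (of_real r :: 'b)"
    by (rule norm_mono[OF rk]) (simp add: \<open>nonneg k\<close>)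
  then have n1: "norm (of_real r - k) \<le> r" using r0 by simp
  have "norm (k * (of_real r - k)) \<le> norm (of_real (r\<^sup>2 / 4) :: 'b)"
  proof (rule norm_mono)
    show "nonneg (k * (of_real r - k))"
      by (rule nonneg_mult_commuting[OF \<open>nonneg k\<close> rk])
        (simp add: algebra_simps of_real_commute[of r k])
    have "nonneg ((of_real (r/2) - k) * (of_real (r/2) - k))"
      by (rule nonneg_square) (simp only: star_diff star_of_real ks)
    moreover have "of_real (r/2) * k + k * of_real (r/2) = k * of_real r"
      by (simp add: of_real_def flip: scaleR_add_left)
    then have "(of_real (r/2) - k) * (of_real (r/2) - k) = of_real (r\<^sup>2/4) - k * (of_real r - k)"
      by (simp add: algebra_simps power2_eq_square flip: of_real_mult)
    ultimately show "nonneg (of_real (r\<^sup>2/4) - k * (of_real r - k))" by simp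
  qed
  then have n2: "norm (k * (of_real r - k)) \<le> r\<^sup>2/4" by (simp only: norm_of_real) simp
  have "norm ((of_real r - k) * x) ^ 2 = norm ((of_real r - k) * (k * (of_real r - k)))"
  proof -
    have "((of_real r - k) * x) * ((of_real r - k) * x)\<^sup>\<star> = (of_real r - k) * (k * (of_real r - k))"
      by (simp only: star_mult star_diff ks star_of_real) (simp only: k_def mult.assoc)
    then show ?thesis using cstar_identity'[of "(of_real r - k) * x"] by simp
  qed
  also have "\<dots> \<le> r * (r\<^sup>2/4)"
    by (rule order_trans[OF norm_mult_ineq mult_mono[OF n1 n2 r0]]) simp
  finally have up: "norm ((of_real r - k) * x) ^ 2 \<le> r ^ 3 / 4"
    by (simp add: power3_eq_cube power2_eq_square)
  have "of_real r * x = x * of_real r" by (simp add: of_real_def)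
  then have eq: "(of_real r - k) * x = x * (of_real r + h)"
    using xh by (simp add: k_def algebra_simps)
  have "norm (of_real (r\<^sup>2) * h) \<le> norm ((of_real r + h) * h * (of_real r + h))"
  proof (rule norm_mono)
    show "nonneg (of_real (r\<^sup>2) * h)" using nonneg_scaleR[OF h, of "r\<^sup>2"] by (simp add: of_real_def)
    have hh: "nonneg (h * h)" by (rule nonneg_square[OF hs])
    have "nonneg ((2 * r) *\<^sub>R (h * h) + h * (h * h))"
      by (intro nonneg_add nonneg_scaleR nonneg_mult_commuting h hh) (simp_all add: r0 mult.assoc)
    moreover have "(of_real r + h) * h * (of_real r + h) - of_real (r\<^sup>2) * h
        = (2 * r) *\<^sub>R (h * h) + h * (h * h)"
      by (simp add: of_real_def algebra_simps power2_eq_square scaleR_2 flip: scaleR_scaleR)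
    ultimately show "nonneg ((of_real r + h) * h * (of_real r + h) - of_real (r\<^sup>2) * h)" by simp
  qed
  moreover have "norm (of_real (r\<^sup>2) * h) = r ^ 3"
    using r0 nh by (simp add: of_real_def power3_eq_cube power2_eq_square)
  moreover have "norm (x * (of_real r + h)) ^ 2 = norm ((of_real r + h) * h * (of_real r + h))"
  proof -
    have "(x * (of_real r + h))\<^sup>\<star> * (x * (of_real r + h)) = (of_real r + h) * (x\<^sup>\<star> * x) * (of_real r + h)"
      by (simp add: star_mult star_add hs mult.assoc)
    then show ?thesis using cstar_identity[of "x * (of_real r + h)"] by (simp add: xh)
  qed
  ultimately have "r ^ 3 \<le> norm (x * (of_real r + h)) ^ 2" by metis
  with up have "r ^ 3 \<le> r ^ 3 / 4" unfolding eq by linarith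
  then have "r ^ 3 \<le> 0" by simp
  then have "r = 0" using r0 by (metis le_less not_le zero_less_power)
  then show ?thesis by (simp add: r_def)
qed

text \<open>The positivity theorem for C*-algebras. With \<open>s = \<bar>p\<bar>\<close> the element \<open>v = s - p\<close> is twice the negative
part of \<open>p = c\<^sup>\<star> * c\<close>, and \<open>(c * v)\<^sup>\<star> * (c * v) = v * p * v = - s * v\<^sup>2\<close> is minus a square. By the
previous lemma \<open>c * v = 0\<close>, whence \<open>v = 0\<close> and \<open>p = s\<close>.\<close>

lemma nonneg_star_mult_self: "nonneg ((c::'b::cstar_algebra)\<^sup>\<star> * c)"
proof -
  define p where "p = c\<^sup>\<star> * c"
  have ps: "p\<^sup>\<star> = p" by (simp add: p_def star_mult star_star)
  obtain s where s: "nonneg s" "s * s = p * p" "\<And>x. x * (p * p) = (p * p) * x \<Longrightarrow> x * s = s * x"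
    using nonneg_sqrt[OF nonneg_square[OF ps]] by metis
  have sp: "p * s = s * p" by (rule s(3)) (simp add: mult.assoc)
  obtain r where r: "nonneg r" "r * r = s" "\<And>x. x * s = s * x \<Longrightarrow> x * r = r * x"
    using nonneg_sqrt[OF s(1)] by metis
  \<comment> \<open>\<open>v\<close> is twice the negative part of \<open>p\<close>\<close>
  define v where "v = s - p"
  have vs: "v\<^sup>\<star> = v" by (simp add: v_def star_diff ps nonneg_star[OF s(1)])
  have pv: "p * v = - (s * v)" using sp s(2) by (simp add: v_def algebra_simps)
  have sv: "v * s = s * v" using sp by (simp add: v_def algebra_simps)
  have vr: "v * r = r * v" by (rule r(3)[OF sv])
  have "c * v = 0"
  proof (rule star_mult_self_negative_imp_zero)
    show "(r * v)\<^sup>\<star> = r * v" by (simp add: star_mult vs nonneg_star[OF r(1)] vr)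
    have "(c * v)\<^sup>\<star> * (c * v) = v * (p * v)" by (simp add: p_def star_mult vs mult.assoc)
    also have "\<dots> = - (s * v * v)" by (simp add: pv mult.assoc[symmetric] sv)
    also have "s * v * v = (r * v) * (r * v)"
      unfolding commuting_product_square[OF vr[symmetric]] r(2) by (simp add: mult.assoc)
    finally show "(c * v)\<^sup>\<star> * (c * v) = - ((r * v) * (r * v))" .
  qed
  then have "p * v = 0" by (simp add: p_def mult.assoc)
  moreover from this have "s * v = 0" using pv by simp
  ultimately have "v * v = 0" by (simp add: v_def left_diff_distrib)
  then have "v = 0" using cstar_identity[of v] by (simp add: vs)
  then show ?thesis using s(1) by (simp add: v_def p_def)
qed

lemma positive_in_nonneg: "positive_in S a \<Longrightarrow> nonneg a"
  by (auto simp: positive_in_def nonneg_star_mult_self)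

lemma nonneg_conj:
  assumes "nonneg h" shows "nonneg (a\<^sup>\<star> * h * a)"
proof -
  obtain d where d: "nonneg d" "d * d = h" using nonneg_sqrt[OF assms] by metis
  have "a\<^sup>\<star> * h * a = (d * a)\<^sup>\<star> * (d * a)"
    by (simp add: star_mult nonneg_star[OF d(1)] mult.assoc flip: d(2))
  then show ?thesis by (simp add: nonneg_star_mult_self)
qed

lemma nonneg_sum: "(\<And>i. i \<in> I \<Longrightarrow> nonneg (f i)) \<Longrightarrow> nonneg (\<Sum>i\<in>I. f i)"
  using nonneg_of_real[of 0]
  by (induction I rule: infinite_finite_induct) (auto intro: nonneg_add)

section \<open>Semi-inner-product correspondences and their completions\<close>

text \<open>Correspondences before division by null vectors and before completion. Vector identities such as
commutativity of addition hold only up to null vectors, for instance for formal sums of tensors, so the axioms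
speak about inner products of vectors instead of vectors.\<close>

locale pre_correspondence =
  fixes R S :: "'b::cstar_algebra set" and X :: "('v, 'b, 'm) corr_scheme"
  assumes R: "cstar_subalgebra R" and S: "cstar_subalgebra S"
    and add_closed: "x \<in> carr X \<Longrightarrow> y \<in> carr X \<Longrightarrow> add X x y \<in> carr X"
    and csc_closed: "x \<in> carr X \<Longrightarrow> csc X c x \<in> carr X"
    and lact_closed: "x \<in> carr X \<Longrightarrow> r \<in> R \<Longrightarrow> lact X r x \<in> carr X"
    and ract_closed: "x \<in> carr X \<Longrightarrow> s \<in> S \<Longrightarrow> ract X x s \<in> carr X"
    and rip_closed: "x \<in> carr X \<Longrightarrow> y \<in> carr X \<Longrightarrow> rip X x y \<in> S"
    and rip_add: "x \<in> carr X \<Longrightarrow> y \<in> carr X \<Longrightarrow> z \<in> carr X \<Longrightarrow>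
      rip X x (add X y z) = rip X x y + rip X x z"
    and rip_csc: "x \<in> carr X \<Longrightarrow> y \<in> carr X \<Longrightarrow> rip X x (csc X c y) = c *\<^sub>c rip X x y"
    and rip_ract: "x \<in> carr X \<Longrightarrow> y \<in> carr X \<Longrightarrow> s \<in> S \<Longrightarrow> rip X x (ract X y s) = rip X x y * s"
    and rip_star: "x \<in> carr X \<Longrightarrow> y \<in> carr X \<Longrightarrow> (rip X x y)\<^sup>\<star> = rip X y x"
    and rip_nonneg: "x \<in> carr X \<Longrightarrow> nonneg (rip X x x)"
    and rip_lact_left: "x \<in> carr X \<Longrightarrow> y \<in> carr X \<Longrightarrow> r \<in> R \<Longrightarrow>
      rip X (lact X r x) y = rip X x (lact X (r\<^sup>\<star>) y)"
    and rip_lact_add: "x \<in> carr X \<Longrightarrow> y \<in> carr X \<Longrightarrow> r \<in> R \<Longrightarrow> t \<in> R \<Longrightarrow>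
      rip X y (lact X (r + t) x) = rip X y (lact X r x) + rip X y (lact X t x)"
    and rip_lact_scaleC: "x \<in> carr X \<Longrightarrow> y \<in> carr X \<Longrightarrow> r \<in> R \<Longrightarrow>
      rip X y (lact X (c *\<^sub>c r) x) = c *\<^sub>c rip X y (lact X r x)"
    and rip_lact_mult: "x \<in> carr X \<Longrightarrow> y \<in> carr X \<Longrightarrow> r \<in> R \<Longrightarrow> t \<in> R \<Longrightarrow>
      rip X y (lact X (r * t) x) = rip X y (lact X r (lact X t x))"
    and rip_lact_one: "x \<in> carr X \<Longrightarrow> y \<in> carr X \<Longrightarrow> rip X y (lact X 1 x) = rip X y x"
begin

abbreviation d :: "'v \<Rightarrow> 'v \<Rightarrow> real" where "d x y \<equiv> rnorm X (diff X x y)"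
abbreviation cauchy :: "(nat \<Rightarrow> 'v) \<Rightarrow> bool" where "cauchy \<equiv> cauchy_seq X (rnorm X)"

lemma diff_closed: "x \<in> carr X \<Longrightarrow> y \<in> carr X \<Longrightarrow> diff X x y \<in> carr X"
  by (simp add: diff_def add_closed csc_closed)

lemma rip_diff: "x \<in> carr X \<Longrightarrow> y \<in> carr X \<Longrightarrow> z \<in> carr X \<Longrightarrow>
    rip X z (diff X x y) = rip X z x - rip X z y"
  by (simp add: diff_def rip_add rip_csc csc_closed scaleC_minus_one)

lemma rip_diff_left: "x \<in> carr X \<Longrightarrow> y \<in> carr X \<Longrightarrow> z \<in> carr X \<Longrightarrow>
    rip X (diff X x y) z = rip X x z - rip X y z"
  by (simp only: rip_star[of z, symmetric] rip_diff diff_closed star_diff)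

lemma rip_add_left: "x \<in> carr X \<Longrightarrow> y \<in> carr X \<Longrightarrow> z \<in> carr X \<Longrightarrow>
    rip X (add X x y) z = rip X x z + rip X y z"
  by (simp only: rip_star[of z, symmetric] rip_add add_closed star_add)

lemma rip_ract_left: "x \<in> carr X \<Longrightarrow> y \<in> carr X \<Longrightarrow> s \<in> S \<Longrightarrow>
    rip X (ract X x s) y = s\<^sup>\<star> * rip X x y"
  by (simp only: rip_star[of y, symmetric] rip_ract ract_closed star_mult)

lemma rnorm_nonneg: "0 \<le> rnorm X x"
  by (simp add: rnorm_def)

lemma rnorm_sq: "(rnorm X x)\<^sup>2 = norm (rip X x x)"
  by (simp add: rnorm_def)

text \<open>For \<open>a = \<langle>x, y\<rangle>\<close> and \<open>t = 1 / M\<close>, expanding \<open>0 \<le> \<langle>y - x t a, y - x t a\<rangle>\<close> gives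
\<open>t a\<^sup>\<star> a \<le> \<langle>y, y\<rangle>\<close>. Taking a positive \<open>M\<close> above the norm of \<open>\<langle>x, x\<rangle>\<close> includes the case
of a null vector \<open>x\<close>.\<close>

lemma cauchy_schwarz_aux:
  assumes x: "x \<in> carr X" and y: "y \<in> carr X" and M: "M > 0" "norm (rip X x x) \<le> M"
  shows "(norm (rip X x y))\<^sup>2 \<le> M * norm (rip X y y)"
proof -
  define a where "a = rip X x y"
  define t where "t = 1 / M"
  define v where "v = diff X y (ract X x (t *\<^sub>R a))"
  have aS: "t *\<^sub>R a \<in> S" unfolding a_def by (intro subalgebra_closures[OF S] rip_closed x y)
  have as: "a\<^sup>\<star> = rip X y x" by (simp add: a_def rip_star x y)
  have rx: "ract X x (t *\<^sub>R a) \<in> carr X" by (intro ract_closed x aS)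
  have v: "v \<in> carr X" unfolding v_def by (intro diff_closed y rx)
  have vv: "rip X v v = rip X y y - (2 * t) *\<^sub>R (a\<^sup>\<star> * a) + (t * t) *\<^sub>R (a\<^sup>\<star> * rip X x x * a)"
  proof -
    have "rip X v v = rip X y v - rip X (ract X x (t *\<^sub>R a)) v"
      using v y rx by (simp add: v_def rip_diff_left)
    also have "rip X y v = rip X y y - t *\<^sub>R (a\<^sup>\<star> * a)"
      by (simp add: v_def rip_diff y rx rip_ract x aS as)
    also have "rip X (ract X x (t *\<^sub>R a)) v = t *\<^sub>R (a\<^sup>\<star> * (a - rip X x x * (t *\<^sub>R a)))"
      by (simp add: rip_ract_left x v aS star_scaleR)
        (simp add: v_def rip_diff y rx x rip_ract aS flip: a_def)
    finally show ?thesis by (simp add: algebra_simps flip: scaleR_add_left)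
  qed
  have "nonneg (rip X v v + (t * t) *\<^sub>R (a\<^sup>\<star> * (of_real M - rip X x x) * a))"
    by (intro nonneg_add nonneg_scaleR nonneg_conj nonneg_minus rip_nonneg v M)
      (simp_all add: rip_star x)
  moreover have "rip X v v + (t * t) *\<^sub>R (a\<^sup>\<star> * (of_real M - rip X x x) * a)
      = rip X y y - t *\<^sub>R (a\<^sup>\<star> * a)"
  proof -
    have "a\<^sup>\<star> * (of_real M - rip X x x) * a = M *\<^sub>R (a\<^sup>\<star> * a) - a\<^sup>\<star> * rip X x x * a"
      by (simp add: of_real_def algebra_simps)
    moreover have "(t * t * M) *\<^sub>R z = t *\<^sub>R z" "(2 * t) *\<^sub>R z = t *\<^sub>R z + t *\<^sub>R z" for z :: 'b
      using M by (simp_all add: t_def flip: scaleR_add_left)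
    ultimately show ?thesis by (simp add: vv scaleR_diff_right)
  qed
  ultimately have "nonneg (rip X y y - t *\<^sub>R (a\<^sup>\<star> * a))" by simp
  from norm_mono[OF _ this] have "norm (t *\<^sub>R (a\<^sup>\<star> * a)) \<le> norm (rip X y y)"
    using M by (simp add: nonneg_scaleR nonneg_star_mult_self t_def)
  then show ?thesis using M by (simp add: cstar_identity t_def field_simps flip: a_def)
qed

lemma cauchy_schwarz:
  assumes x: "x \<in> carr X" and y: "y \<in> carr X"
  shows "norm (rip X x y) \<le> rnorm X x * rnorm X y"
proof -
  have "(norm (rip X x y))\<^sup>2 \<le> (rnorm X x * rnorm X y)\<^sup>2"
  proof (rule field_le_epsilon)
    fix e :: real assume e: "e > 0"
    \<comment> \<open>the second summand costs at most \<open>e\<close> after multiplication by the norm of \<open>\<langle>y, y\<rangle>\<close>\<close>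
    define M where "M = norm (rip X x x) + e / (norm (rip X y y) + 1)"
    have pos: "norm (rip X y y) + 1 > 0" by (simp add: add_nonneg_pos)
    have "(norm (rip X x y))\<^sup>2 \<le> M * norm (rip X y y)"
      using e pos by (intro cauchy_schwarz_aux x y) (simp_all add: M_def add_nonneg_pos)
    also have "\<dots> = norm (rip X x x) * norm (rip X y y)
        + e * (norm (rip X y y) / (norm (rip X y y) + 1))"
      by (simp add: M_def algebra_simps)
    also have "\<dots> \<le> norm (rip X x x) * norm (rip X y y) + e * 1"
      using e pos by (intro add_left_mono mult_left_mono) simp_all
    finally show "(norm (rip X x y))\<^sup>2 \<le> (rnorm X x * rnorm X y)\<^sup>2 + e"
      by (simp add: power_mult_distrib rnorm_sq)
  qed
  then show ?thesis by (rule power2_le_imp_le) (simp add: rnorm_nonneg)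
qed

text \<open>That \<open>z\<close> is the sum of \<open>x\<close> and \<open>y\<close> is expressed by inner products; the lemma is applied to differences
that are equal as vectors only after division by null vectors.\<close>

lemma rnorm_triangle:
  assumes "x \<in> carr X" "y \<in> carr X" "z \<in> carr X"
    and eq: "\<And>w. w \<in> carr X \<Longrightarrow> rip X w z = rip X w x + rip X w y"
  shows "rnorm X z \<le> rnorm X x + rnorm X y"
proof (cases "rnorm X z = 0")
  case False
  have "rnorm X z * rnorm X z = norm (rip X z x + rip X z y)"
    using rnorm_sq[of z] eq[of z] assms by (simp add: power2_eq_square)
  also have "\<dots> \<le> rnorm X z * rnorm X x + rnorm X z * rnorm X y"
    using norm_triangle_ineq[of "rip X z x" "rip X z y"]
      cauchy_schwarz[of z x] cauchy_schwarz[of z y] assms by linarith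
  also have "\<dots> = rnorm X z * (rnorm X x + rnorm X y)" by (simp add: distrib_left)
  finally show ?thesis using False rnorm_nonneg[of z] by simp
qed (simp add: rnorm_nonneg)

lemma dist_self: "x \<in> carr X \<Longrightarrow> d x x = 0"
  by (simp add: rnorm_def rip_diff diff_closed)

lemma dist_commute: "x \<in> carr X \<Longrightarrow> y \<in> carr X \<Longrightarrow> d x y = d y x"
  by (simp add: rnorm_def rip_diff rip_diff_left diff_closed algebra_simps)

lemma dist_triangle:
  "x \<in> carr X \<Longrightarrow> y \<in> carr X \<Longrightarrow> z \<in> carr X \<Longrightarrow> d x z \<le> d x y + d y z"
  by (rule rnorm_triangle) (simp_all add: diff_closed rip_diff)

lemma dist_triangle': "x \<in> carr X \<Longrightarrow> y \<in> carr X \<Longrightarrow> rnorm X x \<le> d x y + rnorm X y"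
  by (rule rnorm_triangle) (simp_all add: diff_closed rip_diff)

lemma rnorm_dist: "x \<in> carr X \<Longrightarrow> y \<in> carr X \<Longrightarrow> \<bar>rnorm X x - rnorm X y\<bar> \<le> d x y"
  using dist_triangle'[of x y] dist_triangle'[of y x] dist_commute[of x y] by linarith

lemma dist_csc:
  assumes "x \<in> carr X" "y \<in> carr X"
  shows "d (csc X c x) (csc X c y) \<le> cmod c * d x y"
proof -
  let ?u = "diff X (csc X c x) (csc X c y)"
  have u: "?u \<in> carr X" using assms by (intro diff_closed csc_closed)
  have e: "rip X w ?u = c *\<^sub>c rip X w (diff X x y)" if "w \<in> carr X" for w
    using that assms by (simp add: rip_diff rip_csc csc_closed scaleC_diff_right)
  have "rip X ?u ?u = c *\<^sub>c (rip X (diff X x y) ?u)\<^sup>\<star>"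
    using e[OF u] u assms by (simp add: rip_star diff_closed)
  also have "\<dots> = c *\<^sub>c (c *\<^sub>c rip X (diff X x y) (diff X x y))\<^sup>\<star>"
    using e assms by (simp add: diff_closed)
  finally have "norm (rip X ?u ?u) = cmod c * (cmod c * norm (rip X (diff X x y) (diff X x y)))"
    by (simp add: norm_scaleC)
  then have "(rnorm X ?u)\<^sup>2 = (cmod c * d x y)\<^sup>2"
    by (simp add: power_mult_distrib rnorm_sq power2_eq_square[of "cmod c"])
  then show ?thesis by (rule power2_le_imp_le[OF eq_refl]) (simp add: rnorm_nonneg)
qed

lemma dist_ract:
  assumes "x \<in> carr X" "y \<in> carr X" "s \<in> S"
  shows "d (ract X x s) (ract X y s) \<le> norm s * d x y"
proof -
  let ?u = "diff X (ract X x s) (ract X y s)"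
  have u: "?u \<in> carr X" using assms by (intro diff_closed ract_closed)
  have e: "rip X w ?u = rip X w (diff X x y) * s" if "w \<in> carr X" for w
    using that assms by (simp add: rip_diff rip_ract ract_closed left_diff_distrib)
  have "rip X ?u ?u = (rip X (diff X x y) ?u)\<^sup>\<star> * s"
    using e[OF u] u assms by (simp add: rip_star diff_closed)
  also have "\<dots> = (rip X (diff X x y) (diff X x y) * s)\<^sup>\<star> * s"
    using e assms by (simp add: diff_closed)
  also have "\<dots> = s\<^sup>\<star> * rip X (diff X x y) (diff X x y) * s"
    using assms by (simp add: star_mult rip_star diff_closed)
  also have "norm \<dots> \<le> norm (s\<^sup>\<star> * rip X (diff X x y) (diff X x y)) * norm s"
    by (rule norm_mult_ineq)
  also have "\<dots> \<le> norm (s\<^sup>\<star>) * norm (rip X (diff X x y) (diff X x y)) * norm s"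
    by (intro mult_right_mono norm_mult_ineq norm_ge_zero)
  finally have "norm (rip X ?u ?u) \<le> norm s * norm (rip X (diff X x y) (diff X x y)) * norm s"
    by simp
  then have "(rnorm X ?u)\<^sup>2 \<le> (norm s * d x y)\<^sup>2"
    by (simp add: power_mult_distrib rnorm_sq power2_eq_square[of "norm s"] mult_ac)
  then show ?thesis by (rule power2_le_imp_le) (simp add: rnorm_nonneg)
qed

text \<open>The defect \<open>(norm r)\<^sup>2 \<langle>x, x\<rangle> - \<langle>r x, r x\<rangle>\<close> is \<open>\<langle>e x, e x\<rangle>\<close> for the root \<open>e\<close> of
\<open>(norm r)\<^sup>2 - r\<^sup>\<star> * r\<close>, which lies in \<open>R\<close> and therefore acts on \<open>X\<close>.\<close>

lemma lact_bounded:
  assumes x: "x \<in> carr X" and r: "r \<in> R"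
  shows "rnorm X (lact X r x) \<le> norm r * rnorm X x"
proof -
  define t where "t = (norm r)\<^sup>2"
  define h where "h = of_real t - r\<^sup>\<star> * r"
  have rr: "r\<^sup>\<star> * r \<in> R" and one: "1 \<in> R" and rs: "r\<^sup>\<star> \<in> R"
    using r by (auto intro!: subalgebra_closures[OF R])
  have hR: "h \<in> R" unfolding h_def by (intro subalgebra_closures[OF R] r)
  have "nonneg h" unfolding h_def
    by (rule nonneg_minus) (simp_all add: star_mult star_star cstar_identity t_def)
  then obtain e where e: "e \<in> R" "nonneg e" "e * e = h"
    using nonneg_sqrt_in[OF R _ hR] by metis
  have "nonneg (rip X (lact X e x) (lact X e x))" by (intro rip_nonneg lact_closed x e)
  also have "rip X (lact X e x) (lact X e x) = rip X x (lact X (e * e) x)"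
    by (simp add: rip_lact_left rip_lact_mult x e(1,2) lact_closed nonneg_star)
  also have "e * e = complex_of_real t *\<^sub>c 1 + (-1) *\<^sub>c (r\<^sup>\<star> * r)"
    by (simp add: e h_def scaleC_minus_one of_real_def scaleR_scaleC)
  also have "rip X x (lact X \<dots> x)
      = complex_of_real t *\<^sub>c rip X x x + (-1) *\<^sub>c rip X (lact X r x) (lact X r x)"
    using x r rr one rs
    by (simp add: rip_lact_add rip_lact_scaleC rip_lact_one subalgebra_scaleC[OF R]
        rip_lact_left rip_lact_mult lact_closed)
  also have "\<dots> = t *\<^sub>R rip X x x - rip X (lact X r x) (lact X r x)"
    by (simp add: scaleC_minus_one scaleR_scaleC)
  finally have "norm (rip X (lact X r x) (lact X r x)) \<le> norm (t *\<^sub>R rip X x x)"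
    by (intro norm_mono rip_nonneg lact_closed x r)
  then have "(rnorm X (lact X r x))\<^sup>2 \<le> (norm r * rnorm X x)\<^sup>2"
    by (simp add: rnorm_sq power_mult_distrib t_def)
  then show ?thesis by (rule power2_le_imp_le) (simp add: rnorm_nonneg)
qed

lemma dist_lact:
  assumes "x \<in> carr X" "y \<in> carr X" "r \<in> R"
  shows "d (lact X r x) (lact X r y) \<le> norm r * d x y"
proof -
  let ?u = "diff X (lact X r x) (lact X r y)" and ?v = "lact X r (diff X x y)"
  have u: "?u \<in> carr X" and v: "?v \<in> carr X" using assms by (auto intro!: diff_closed lact_closed)
  have rs: "r\<^sup>\<star> \<in> R" using assms by (auto intro: subalgebra_closures[OF R])
  have adj: "rip X w (lact X r z) = rip X (lact X (r\<^sup>\<star>) w) z" if "w \<in> carr X" "z \<in> carr X" for w z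
    using that rs by (simp add: rip_lact_left star_star)
  have eq: "rip X w ?u = rip X w ?v" if "w \<in> carr X" for w
    using that assms rs by (simp add: rip_diff lact_closed adj diff_closed)
  have "rip X ?u ?u = (rip X ?v ?u)\<^sup>\<star>" using eq[OF u] u v by (simp add: rip_star)
  also have "\<dots> = rip X ?v ?v" using eq[OF v] v by (simp add: rip_star)
  finally show ?thesis using lact_bounded[of "diff X x y" r] assms by (simp add: rnorm_def diff_closed)
qed

lemma dist_add:
  assumes "x \<in> carr X" "y \<in> carr X" "x' \<in> carr X" "y' \<in> carr X"
  shows "d (add X x x') (add X y y') \<le> d x y + d x' y'"
  using assms by (intro rnorm_triangle) (simp_all add: diff_closed add_closed rip_diff rip_add)

lemma cauchy_carr: "cauchy s \<Longrightarrow> s n \<in> carr X"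
  by (simp add: cauchy_seq_def)

lemma cauchy_const: "x \<in> carr X \<Longrightarrow> cauchy (\<lambda>n. x)"
  by (simp add: cauchy_seq_def dist_self)

lemma class_mem_iff: "t \<in> cauchy_class X s \<longleftrightarrow> cauchy t \<and> (\<lambda>n. d (s n) (t n)) \<longlonglongrightarrow> 0"
  by (simp add: cauchy_class_def)

lemma class_self: "cauchy s \<Longrightarrow> s \<in> cauchy_class X s"
  by (simp add: class_mem_iff cauchy_carr dist_self)

lemma class_eq:
  assumes s: "cauchy s" and t: "cauchy t" and st: "(\<lambda>n. d (s n) (t n)) \<longlonglongrightarrow> 0"
  shows "cauchy_class X s = cauchy_class X t"
proof -
  have le: "cauchy_class X s \<subseteq> cauchy_class X t"
    if s: "cauchy s" and t: "cauchy t" and st: "(\<lambda>n. d (s n) (t n)) \<longlonglongrightarrow> 0" for s t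
  proof
    fix u assume "u \<in> cauchy_class X s"
    then have u: "cauchy u" "(\<lambda>n. d (s n) (u n)) \<longlonglongrightarrow> 0" by (simp_all add: class_mem_iff)
    have "(\<lambda>n. d (t n) (u n)) \<longlonglongrightarrow> 0"
    proof (rule real_tendsto_sandwich[OF _ _ tendsto_const])
      show "(\<lambda>n. d (s n) (t n) + d (s n) (u n)) \<longlonglongrightarrow> 0" using tendsto_add[OF st u(2)] by simp
      show "\<forall>\<^sub>F n in sequentially. d (t n) (u n) \<le> d (s n) (t n) + d (s n) (u n)"
      proof (rule always_eventually, rule allI)
        fix n
        show "d (t n) (u n) \<le> d (s n) (t n) + d (s n) (u n)"
          using dist_triangle[of "t n" "s n" "u n"] dist_commute[of "t n" "s n"]
            cauchy_carr[OF s, of n] cauchy_carr[OF t, of n] cauchy_carr[OF u(1), of n] by simp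
      qed
    qed (simp add: rnorm_nonneg)
    then show "u \<in> cauchy_class X t" by (simp add: class_mem_iff u)
  qed
  have "(\<lambda>n. d (t n) (s n)) \<longlonglongrightarrow> 0" using st s t by (simp add: dist_commute cauchy_carr)
  with le[OF assms] le[OF t s] show ?thesis by blast
qed

lemma rep_class:
  assumes "cauchy s"
  shows "cauchy (rep (cauchy_class X s))"
    and "(\<lambda>n. d (s n) (rep (cauchy_class X s) n)) \<longlonglongrightarrow> 0"
    and "cauchy_class X (rep (cauchy_class X s)) = cauchy_class X s"
proof -
  have "rep (cauchy_class X s) \<in> cauchy_class X s"
    unfolding rep_def by (rule someI[of "\<lambda>t. t \<in> cauchy_class X s", OF class_self[OF assms]])
  then show 1: "cauchy (rep (cauchy_class X s))"
    and 2: "(\<lambda>n. d (s n) (rep (cauchy_class X s) n)) \<longlonglongrightarrow> 0"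
    by (simp_all add: class_mem_iff)
  show "cauchy_class X (rep (cauchy_class X s)) = cauchy_class X s"
    by (rule class_eq[OF assms 1 2, symmetric])
qed

lemma class_carr: "cauchy s \<Longrightarrow> cauchy_class X s \<in> carr (completion X)"
  by (simp add: completion_def)

lemma carr_rep:
  assumes "\<xi> \<in> carr (completion X)"
  shows "cauchy (rep \<xi>)" "cauchy_class X (rep \<xi>) = \<xi>"
  using assms rep_class by (auto simp: completion_def)

lemma to_completion_carr: "x \<in> carr X \<Longrightarrow> to_completion X x \<in> carr (completion X)"
  by (simp add: to_completion_def class_carr cauchy_const)

lemma to_completion_eq:
  assumes "x \<in> carr X" "y \<in> carr X" "to_completion X x = to_completion X y"
  shows "d x y = 0"
proof -
  have "(\<lambda>n. y) \<in> cauchy_class X (\<lambda>n. x)"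
    using class_self[OF cauchy_const[OF assms(2)]] assms(3) by (simp add: to_completion_def)
  then have "(\<lambda>n::nat. d x y) \<longlonglongrightarrow> 0" by (simp add: class_mem_iff)
  then show ?thesis by (simp add: LIMSEQ_const_iff)
qed

lemma cauchy_bounded:
  assumes s: "cauchy s" obtains M where "\<And>n. rnorm X (s n) \<le> M"
proof -
  have "Cauchy (\<lambda>n. rnorm X (s n))"
  proof (rule metric_CauchyI)
    fix e :: real assume "e > 0"
    then obtain N where N: "\<And>m n. m \<ge> N \<Longrightarrow> n \<ge> N \<Longrightarrow> d (s m) (s n) < e"
      using s unfolding cauchy_seq_def by metis
    have "dist (rnorm X (s m)) (rnorm X (s n)) < e" if "m \<ge> N" "n \<ge> N" for m n
      using le_less_trans[OF rnorm_dist[OF cauchy_carr[OF s] cauchy_carr[OF s]] N[OF that]]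
      by (simp add: dist_real_def)
    then show "\<exists>N. \<forall>m\<ge>N. \<forall>n\<ge>N. dist (rnorm X (s m)) (rnorm X (s n)) < e" by blast
  qed
  then have "Bseq (\<lambda>n. rnorm X (s n))" by (rule Cauchy_Bseq)
  then show thesis using that by (auto simp: Bseq_def abs_le_iff)
qed

lemma rip_dist:
  assumes "x \<in> carr X" "y \<in> carr X" "x' \<in> carr X" "y' \<in> carr X"
  shows "norm (rip X x y - rip X x' y') \<le> d x x' * rnorm X y + rnorm X x' * d y y'"
proof -
  have "rip X x y - rip X x' y' = rip X (diff X x x') y + rip X x' (diff X y y')"
    using assms by (simp add: rip_diff rip_diff_left)
  then show ?thesis
    using norm_triangle_ineq[of "rip X (diff X x x') y" "rip X x' (diff X y y')"]
      cauchy_schwarz[of "diff X x x'" y] cauchy_schwarz[of x' "diff X y y'"] assms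
    by (simp add: diff_closed)
qed

lemma rip_Cauchy:
  assumes s: "cauchy s" and t: "cauchy t"
  shows "Cauchy (\<lambda>n. rip X (s n) (t n))"
proof (rule metric_CauchyI)
  fix e :: real assume e: "e > 0"
  obtain M1 where M1: "\<And>n. rnorm X (s n) \<le> M1" using cauchy_bounded[OF s] by blast
  obtain M2 where M2: "\<And>n. rnorm X (t n) \<le> M2" using cauchy_bounded[OF t] by blast
  define M where "M = max 1 (max M1 M2)"
  have M: "M > 0" "\<And>n. rnorm X (s n) \<le> M" "\<And>n. rnorm X (t n) \<le> M"
    using M1 M2 by (auto simp: M_def le_max_iff_disj)
  have eM: "e / (2 * M) > 0" using e M(1) by simp
  obtain N1 where N1: "\<And>m n. m \<ge> N1 \<Longrightarrow> n \<ge> N1 \<Longrightarrow> d (s m) (s n) < e / (2 * M)"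
    using s eM unfolding cauchy_seq_def by metis
  obtain N2 where N2: "\<And>m n. m \<ge> N2 \<Longrightarrow> n \<ge> N2 \<Longrightarrow> d (t m) (t n) < e / (2 * M)"
    using t eM unfolding cauchy_seq_def by metis
  have "dist (rip X (s m) (t m)) (rip X (s n) (t n)) < e" if "m \<ge> max N1 N2" "n \<ge> max N1 N2" for m n
  proof -
    have "norm (rip X (s m) (t m) - rip X (s n) (t n))
        \<le> d (s m) (s n) * rnorm X (t m) + rnorm X (s n) * d (t m) (t n)"
      using s t by (intro rip_dist cauchy_carr)
    also have "\<dots> \<le> d (s m) (s n) * M + M * d (t m) (t n)"
      using M by (intro add_mono mult_left_mono mult_right_mono rnorm_nonneg) auto
    also have "\<dots> < e / (2 * M) * M + M * (e / (2 * M))"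
      using N1[of m n] N2[of m n] that M(1)
      by (intro add_strict_mono mult_strict_right_mono mult_strict_left_mono) auto
    also have "\<dots> = e" using M(1) by simp
    finally show ?thesis by (simp add: dist_norm)
  qed
  then show "\<exists>N. \<forall>m\<ge>N. \<forall>n\<ge>N. dist (rip X (s m) (t m)) (rip X (s n) (t n)) < e" by blast
qed

lemma rip_equiv:
  assumes "cauchy s" "cauchy t" "cauchy s'" "cauchy t'"
    and ss: "(\<lambda>n. d (s n) (s' n)) \<longlonglongrightarrow> 0" and tt: "(\<lambda>n. d (t n) (t' n)) \<longlonglongrightarrow> 0"
  shows "(\<lambda>n. rip X (s n) (t n) - rip X (s' n) (t' n)) \<longlonglongrightarrow> 0"
proof -
  obtain M1 where M1: "\<And>n. rnorm X (t n) \<le> M1" using cauchy_bounded[OF assms(2)] by blast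
  obtain M2 where M2: "\<And>n. rnorm X (s' n) \<le> M2" using cauchy_bounded[OF assms(3)] by blast
  show ?thesis
  proof (rule Lim_null_comparison)
    show "(\<lambda>n. d (s n) (s' n) * M1 + M2 * d (t n) (t' n)) \<longlonglongrightarrow> 0"
      using tendsto_add[OF tendsto_mult[OF ss tendsto_const] tendsto_mult[OF tendsto_const tt]]
      by simp
    show "\<forall>\<^sub>F n in sequentially. norm (rip X (s n) (t n) - rip X (s' n) (t' n))
        \<le> d (s n) (s' n) * M1 + M2 * d (t n) (t' n)"
    proof (rule always_eventually, rule allI)
      fix n
      have "norm (rip X (s n) (t n) - rip X (s' n) (t' n))
          \<le> d (s n) (s' n) * rnorm X (t n) + rnorm X (s' n) * d (t n) (t' n)"
        using assms by (intro rip_dist cauchy_carr)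
      also have "\<dots> \<le> d (s n) (s' n) * M1 + M2 * d (t n) (t' n)"
        using M1 M2 by (intro add_mono mult_left_mono mult_right_mono rnorm_nonneg) auto
      finally show "norm (rip X (s n) (t n) - rip X (s' n) (t' n))
          \<le> d (s n) (s' n) * M1 + M2 * d (t n) (t' n)" .
    qed
  qed
qed

text \<open>The completed inner product is defined along chosen representatives; by Cauchy-Schwarz it can be
computed along any.\<close>

lemma rip_completion:
  assumes s: "cauchy s" and t: "cauchy t"
  shows "(\<lambda>n. rip X (s n) (t n)) \<longlonglongrightarrow> rip (completion X) (cauchy_class X s) (cauchy_class X t)"
proof -
  let ?s = "rep (cauchy_class X s)" and ?t = "rep (cauchy_class X t)"
  have "convergent (\<lambda>n. rip X (?s n) (?t n))"
    using rip_Cauchy[OF rep_class(1)[OF s] rep_class(1)[OF t]] by (rule Cauchy_convergent)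
  then have 1: "(\<lambda>n. rip X (?s n) (?t n)) \<longlonglongrightarrow> rip (completion X) (cauchy_class X s) (cauchy_class X t)"
    by (simp add: completion_def convergent_LIMSEQ_iff)
  have 2: "(\<lambda>n. rip X (s n) (t n) - rip X (?s n) (?t n)) \<longlonglongrightarrow> 0"
    by (intro rip_equiv s t rep_class)
  show ?thesis using tendsto_add[OF 2 1] by simp
qed

lemma rip_completion_rep:
  assumes "\<xi> \<in> carr (completion X)" "\<eta> \<in> carr (completion X)"
  shows "(\<lambda>n. rip X (rep \<xi> n) (rep \<eta> n)) \<longlonglongrightarrow> rip (completion X) \<xi> \<eta>"
  using rip_completion[OF carr_rep(1) carr_rep(1), OF assms] carr_rep(2) assms by simp

lemma rip_completion_left:
  assumes "x \<in> carr X" "\<eta> \<in> carr (completion X)"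
  shows "(\<lambda>n. rip X x (rep \<eta> n)) \<longlonglongrightarrow> rip (completion X) (to_completion X x) \<eta>"
  using rip_completion[OF cauchy_const carr_rep(1), OF assms] carr_rep(2) assms
  by (simp add: to_completion_def)

lemma rip_to_completion:
  assumes "x \<in> carr X" "y \<in> carr X"
  shows "rip (completion X) (to_completion X x) (to_completion X y) = rip X x y"
  using rip_completion[OF cauchy_const cauchy_const, OF assms]
  by (simp add: to_completion_def LIMSEQ_const_iff)

lemma rip_completion_closed:
  assumes "\<xi> \<in> carr (completion X)" "\<eta> \<in> carr (completion X)"
  shows "rip (completion X) \<xi> \<eta> \<in> S"
  by (rule closed_sequentially[OF subalgebra_closed[OF S] _ rip_completion_rep[OF assms]])
    (intro rip_closed cauchy_carr carr_rep(1) assms)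

lemma cauchy_lipschitz:
  assumes s: "cauchy s" and f: "\<And>x. x \<in> carr X \<Longrightarrow> f x \<in> carr Y"
    and lip: "\<And>x y. x \<in> carr X \<Longrightarrow> y \<in> carr X \<Longrightarrow> rnorm Y (diff Y (f x) (f y)) \<le> C * d x y"
  shows "cauchy_seq Y (rnorm Y) (\<lambda>n. f (s n))"
  unfolding cauchy_seq_def
proof (intro conjI allI impI)
  fix n show "f (s n) \<in> carr Y" by (intro f cauchy_carr[OF s])
next
  fix e :: real assume e: "e > 0"
  define D where "D = max C 1"
  have D: "D > 0" and eD: "e / D > 0" using e by (simp_all add: D_def)
  obtain N where N: "\<And>m n. m \<ge> N \<Longrightarrow> n \<ge> N \<Longrightarrow> d (s m) (s n) < e / D"
    using s eD unfolding cauchy_seq_def by metis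
  have "rnorm Y (diff Y (f (s m)) (f (s n))) < e" if "m \<ge> N" "n \<ge> N" for m n
  proof -
    have "rnorm Y (diff Y (f (s m)) (f (s n))) \<le> C * d (s m) (s n)"
      by (intro lip cauchy_carr[OF s])
    also have "\<dots> \<le> D * d (s m) (s n)" by (intro mult_right_mono rnorm_nonneg) (simp add: D_def)
    also have "\<dots> < D * (e / D)" using N[OF that] D by (intro mult_strict_left_mono)
    finally show ?thesis using D by simp
  qed
  then show "\<exists>N. \<forall>m\<ge>N. \<forall>n\<ge>N. rnorm Y (diff Y (f (s m)) (f (s n))) < e" by blast
qed

text \<open>Operations of the completion are defined on chosen representatives. A Lipschitz operation does not
depend on that choice; this covers scalars and both actions.\<close>

lemma class_lipschitz:
  assumes s: "cauchy s" and f: "\<And>x. x \<in> carr X \<Longrightarrow> f x \<in> carr X"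
    and lip: "\<And>x y. x \<in> carr X \<Longrightarrow> y \<in> carr X \<Longrightarrow> d (f x) (f y) \<le> C * d x y"
  shows "cauchy_class X (\<lambda>n. f (rep (cauchy_class X s) n)) = cauchy_class X (\<lambda>n. f (s n))"
proof (rule class_eq[symmetric])
  let ?t = "rep (cauchy_class X s)"
  show "cauchy (\<lambda>n. f (s n))" by (rule cauchy_lipschitz[OF s f lip])
  show "cauchy (\<lambda>n. f (?t n))" by (rule cauchy_lipschitz[OF rep_class(1)[OF s] f lip])
  show "(\<lambda>n. d (f (s n)) (f (?t n))) \<longlonglongrightarrow> 0"
  proof (rule real_tendsto_sandwich[OF _ _ tendsto_const])
    show "(\<lambda>n. C * d (s n) (?t n)) \<longlonglongrightarrow> 0"
      using tendsto_mult[OF tendsto_const rep_class(2)[OF s]] by simp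
    show "\<forall>\<^sub>F n in sequentially. d (f (s n)) (f (?t n)) \<le> C * d (s n) (?t n)"
      by (intro always_eventually allI lip cauchy_carr rep_class s)
  qed (simp add: rnorm_nonneg)
qed

lemma lact_cauchy: "cauchy s \<Longrightarrow> r \<in> R \<Longrightarrow> cauchy (\<lambda>n. lact X r (s n))"
  by (rule cauchy_lipschitz[where f="lact X r" and C="norm r"]) (simp_all add: lact_closed dist_lact)

lemma ract_cauchy: "cauchy s \<Longrightarrow> a \<in> S \<Longrightarrow> cauchy (\<lambda>n. ract X (s n) a)"
  by (rule cauchy_lipschitz[where f="\<lambda>x. ract X x a" and C="norm a"])
    (simp_all add: ract_closed dist_ract)

lemma lact_class: "cauchy s \<Longrightarrow> r \<in> R \<Longrightarrow>
    lact (completion X) r (cauchy_class X s) = cauchy_class X (\<lambda>n. lact X r (s n))"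
  using class_lipschitz[where f="lact X r" and C="norm r"]
  by (simp add: completion_def lact_closed dist_lact)

lemma ract_class: "cauchy s \<Longrightarrow> a \<in> S \<Longrightarrow>
    ract (completion X) (cauchy_class X s) a = cauchy_class X (\<lambda>n. ract X (s n) a)"
  using class_lipschitz[where f="\<lambda>x. ract X x a" and C="norm a"]
  by (simp add: completion_def ract_closed dist_ract)

lemma csc_class: "cauchy s \<Longrightarrow>
    csc (completion X) c (cauchy_class X s) = cauchy_class X (\<lambda>n. csc X c (s n))"
  using class_lipschitz[where f="csc X c" and C="cmod c"]
  by (simp add: completion_def csc_closed dist_csc)

lemma add_to_completion:
  assumes x: "x \<in> carr X" and y: "y \<in> carr X"
  shows "add (completion X) (to_completion X x) (to_completion X y) = to_completion X (add X x y)"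
proof -
  let ?s = "rep (cauchy_class X (\<lambda>n. x))" and ?t = "rep (cauchy_class X (\<lambda>n. y))"
  note s = rep_class[OF cauchy_const[OF x]] and t = rep_class[OF cauchy_const[OF y]]
  have lim: "(\<lambda>n. d (add X x y) (add X (?s n) (?t n))) \<longlonglongrightarrow> 0"
  proof (rule real_tendsto_sandwich[OF _ _ tendsto_const])
    show "(\<lambda>n. d x (?s n) + d y (?t n)) \<longlonglongrightarrow> 0" using tendsto_add[OF s(2) t(2)] by simp
    show "\<forall>\<^sub>F n in sequentially. d (add X x y) (add X (?s n) (?t n)) \<le> d x (?s n) + d y (?t n)"
      by (intro always_eventually allI dist_add x y cauchy_carr s t)
  qed (simp add: rnorm_nonneg)
  have "cauchy (\<lambda>n. add X (?s n) (?t n))"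
    unfolding cauchy_seq_def
  proof (intro conjI allI impI)
    fix n show "add X (?s n) (?t n) \<in> carr X" by (intro add_closed cauchy_carr s t)
  next
    fix e :: real assume "e > 0"
    then have e: "e / 2 > 0" by simp
    obtain N1 where N1: "\<And>m n. m \<ge> N1 \<Longrightarrow> n \<ge> N1 \<Longrightarrow> d (?s m) (?s n) < e / 2"
      using s(1) e unfolding cauchy_seq_def by metis
    obtain N2 where N2: "\<And>m n. m \<ge> N2 \<Longrightarrow> n \<ge> N2 \<Longrightarrow> d (?t m) (?t n) < e / 2"
      using t(1) e unfolding cauchy_seq_def by metis
    have "d (add X (?s m) (?t m)) (add X (?s n) (?t n)) < e" if "m \<ge> max N1 N2" "n \<ge> max N1 N2" for m n
      using dist_add[of "?s m" "?s n" "?t m" "?t n"] N1[of m n] N2[of m n] that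
        cauchy_carr[OF s(1)] cauchy_carr[OF t(1)] by simp
    then show "\<exists>N. \<forall>m\<ge>N. \<forall>n\<ge>N. d (add X (?s m) (?t m)) (add X (?s n) (?t n)) < e" by blast
  qed
  from class_eq[OF cauchy_const[OF add_closed[OF x y]] this lim] show ?thesis
    by (simp add: completion_def to_completion_def)
qed

lemma csc_to_completion: "x \<in> carr X \<Longrightarrow>
    csc (completion X) c (to_completion X x) = to_completion X (csc X c x)"
  by (simp add: to_completion_def csc_class cauchy_const)

lemma lact_to_completion: "x \<in> carr X \<Longrightarrow> r \<in> R \<Longrightarrow>
    lact (completion X) r (to_completion X x) = to_completion X (lact X r x)"
  by (simp add: to_completion_def lact_class cauchy_const)

lemma ract_to_completion: "x \<in> carr X \<Longrightarrow> a \<in> S \<Longrightarrow>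
    ract (completion X) (to_completion X x) a = to_completion X (ract X x a)"
  by (simp add: to_completion_def ract_class cauchy_const)

end

section \<open>The correspondence of a conditional expectation\<close>

text \<open>Polarisation: \<open>E ((1 + x)\<^sup>\<star> * (1 + x))\<close> is self-adjoint, so \<open>E x + E (x\<^sup>\<star>)\<close> is. For \<open>x = y\<close> and
\<open>x = \<i>y\<close> this determines \<open>E (y\<^sup>\<star>)\<close>.\<close>

lemma expectation_star:
  assumes E: "faithful_conditional_expectation A E"
  shows "E (y\<^sup>\<star>) = (E y)\<^sup>\<star>"
proof -
  have add: "\<And>x y. E (x + y) = E x + E y" and sc: "\<And>c x. E (c *\<^sub>c x) = c *\<^sub>c E x"
    and pos: "\<And>x. nonneg (E (x\<^sup>\<star> * x))"
    using E by (auto simp: faithful_conditional_expectation_def intro: positive_in_nonneg)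
  have sum: "(E x)\<^sup>\<star> + (E (x\<^sup>\<star>))\<^sup>\<star> = E x + E (x\<^sup>\<star>)" for x
  proof -
    have "E ((1 + x)\<^sup>\<star> * (1 + x)) = E 1 + E x + (E (x\<^sup>\<star>) + E (x\<^sup>\<star> * x))"
      by (simp add: star_add distrib_left distrib_right add)
    then have "(E 1 + E x + (E (x\<^sup>\<star>) + E (x\<^sup>\<star> * x)))\<^sup>\<star> = E 1 + E x + (E (x\<^sup>\<star>) + E (x\<^sup>\<star> * x))"
      by (metis nonneg_star pos)
    moreover have "(E 1)\<^sup>\<star> = E 1" using nonneg_star[OF pos[of 1]] by simp
    moreover have "(E (x\<^sup>\<star> * x))\<^sup>\<star> = E (x\<^sup>\<star> * x)" by (rule nonneg_star[OF pos])
    ultimately show ?thesis by (simp add: star_add)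
  qed
  have 1: "(E y)\<^sup>\<star> + (E (y\<^sup>\<star>))\<^sup>\<star> = E y + E (y\<^sup>\<star>)" by (rule sum)
  have "(\<i> *\<^sub>c E y)\<^sup>\<star> + ((-\<i>) *\<^sub>c E (y\<^sup>\<star>))\<^sup>\<star> = \<i> *\<^sub>c E y + (-\<i>) *\<^sub>c E (y\<^sup>\<star>)"
    using sum[of "\<i> *\<^sub>c y"] by (simp add: star_scaleC sc)
  then have "(-\<i>) *\<^sub>c (E y)\<^sup>\<star> + \<i> *\<^sub>c (E (y\<^sup>\<star>))\<^sup>\<star> = \<i> *\<^sub>c E y + (-\<i>) *\<^sub>c E (y\<^sup>\<star>)"
    by (simp add: star_scaleC)
  \<comment> \<open>multiplication by \<open>\<i>\<close> isolates the difference, to be added to the sum in the first equation\<close>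
  from arg_cong[OF this, of "\<lambda>u. \<i> *\<^sub>c u"]
  have 2: "(E y)\<^sup>\<star> - (E (y\<^sup>\<star>))\<^sup>\<star> = E (y\<^sup>\<star>) - E y"
    using scaleR_scaleC[of 1 "(E y)\<^sup>\<star>"] scaleR_scaleC[of 1 "E (y\<^sup>\<star>)"]
    by (simp add: scaleC_add_right scaleC_scaleC scaleC_minus_one)
  have "2 *\<^sub>R (E (y\<^sup>\<star>))= 2 *\<^sub>R ((E y)\<^sup>\<star>)"
    using arg_cong2[OF 1 2, of "(+)"] by (simp add: scaleR_2)
  then show ?thesis by simp
qed

lemma expectation_corr_simps [simp]:
  "carr (expectation_corr E) = UNIV" "add (expectation_corr E) x y = x + y"
  "zero (expectation_corr E) = 0" "csc (expectation_corr E) c x = c *\<^sub>c x"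
  "lact (expectation_corr E) x y = x * y" "ract (expectation_corr E) x y = x * y"
  "rip (expectation_corr E) x y = E (x\<^sup>\<star> * y)"
  by (simp_all add: expectation_corr_def self_corr_def)

lemma self_corr_simps [simp]:
  "carr self_corr = UNIV" "add self_corr x y = x + y" "zero self_corr = 0"
  "csc self_corr c x = c *\<^sub>c x" "lact self_corr x y = x * y" "ract self_corr x y = x * y"
  "rip self_corr x y = x\<^sup>\<star> * y"
  by (simp_all add: self_corr_def)

locale expectation =
  fixes A :: "'b::cstar_algebra set" and E :: "'b \<Rightarrow> 'b"
  assumes A: "cstar_subalgebra A" and E: "faithful_conditional_expectation A E"
begin

lemma E_closed: "E x \<in> A"
  and E_add: "E (x + y) = E x + E y"
  and E_scaleC: "E (c *\<^sub>c x) = c *\<^sub>c E x"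
  and E_pos: "nonneg (E (x\<^sup>\<star> * x))"
  and E_faithful: "E (x\<^sup>\<star> * x) = 0 \<Longrightarrow> x = 0"
proof -
  note E' = E[unfolded faithful_conditional_expectation_def]
  from E' have "\<forall>b. E b \<in> A" by (elim conjE)
  then show "E x \<in> A" ..
  from E' have "\<forall>b b'. E (b + b') = E b + E b'" by (elim conjE)
  then show "E (x + y) = E x + E y" by (elim allE)
  from E' have "\<forall>c b. E (c *\<^sub>c b) = c *\<^sub>c E b" by (elim conjE)
  then show "E (c *\<^sub>c x) = c *\<^sub>c E x" by (elim allE)
  from E' have "\<forall>b. positive_in A (E (b\<^sup>\<star> * b))" by (elim conjE)
  then show "nonneg (E (x\<^sup>\<star> * x))" by (intro positive_in_nonneg[of A]) (elim allE)
  from E' have "\<forall>b. E (b\<^sup>\<star> * b) = 0 \<longrightarrow> b = 0" by (elim conjE)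
  then have "E (x\<^sup>\<star> * x) = 0 \<longrightarrow> x = 0" by (rule spec)
  then show "E (x\<^sup>\<star> * x) = 0 \<Longrightarrow> x = 0" by (rule mp)
qed

lemma E_mult: "a \<in> A \<Longrightarrow> E (x * a) = E x * a"
proof -
  assume "a \<in> A"
  then have "E (1 * x * a) = 1 * E x * a"
    using E[unfolded faithful_conditional_expectation_def, THEN conjunct2, THEN conjunct2,
        THEN conjunct2, THEN conjunct2, THEN conjunct1] subalgebra_one[OF A] by blast
  then show ?thesis by simp
qed

sublocale C: pre_correspondence A A "expectation_corr E"
proof
  fix x y z r t :: 'b and c :: complex
  show "cstar_subalgebra A" by (rule A)
  have star: "(E (x\<^sup>\<star> * y))\<^sup>\<star> = E (y\<^sup>\<star> * x)" for x y
    using expectation_star[OF E, of "x\<^sup>\<star> * y"] by (simp add: star_mult star_star)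
  then show "(rip (expectation_corr E) x y)\<^sup>\<star> = rip (expectation_corr E) y x" by simp
  show "r \<in> A \<Longrightarrow> rip (expectation_corr E) x (ract (expectation_corr E) y r)
      = rip (expectation_corr E) x y * r"
    using E_mult[of r "x\<^sup>\<star> * y"] by (simp add: mult.assoc)
qed (simp_all add: E_closed E_add E_scaleC E_pos distrib_left distrib_right
      mult_scaleC_left mult_scaleC_right star_mult mult.assoc)

end

section \<open>Frames and the tensor product with the large algebra\<close>

definition right_linear :: "'b::cstar_algebra set \<Rightarrow> ('v, 'b, 'm) corr_scheme \<Rightarrow> ('v \<Rightarrow> 'b) \<Rightarrow> bool" where
  "right_linear A K h \<longleftrightarrow>
     (\<forall>x\<in>carr K. \<forall>y\<in>carr K. h (add K x y) = h x + h y) \<and>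
     (\<forall>x\<in>carr K. \<forall>a\<in>A. h (ract K x a) = h x * a)"

definition bimodule_map :: "'b::cstar_algebra set \<Rightarrow> ('v, 'b, 'm) corr_scheme \<Rightarrow> ('v \<Rightarrow> 'b) \<Rightarrow> bool" where
  "bimodule_map A K h \<longleftrightarrow> right_linear A K h \<and> (\<forall>x\<in>carr K. \<forall>a\<in>A. h (lact K a x) = a * h x)"

primrec vsum :: "('v, 'm) cvs_scheme \<Rightarrow> (nat \<Rightarrow> 'v) \<Rightarrow> nat \<Rightarrow> 'v" where
  "vsum V f 0 = zero V"
| "vsum V f (Suc n) = add V (vsum V f n) (f n)"

text \<open>The value on a formal sum of elementary tensors of the map determined by \<open>x \<otimes> b \<mapsto> h x * b\<close>; below,
\<open>tensor_eval\<close> is its extension to the completed tensor product.\<close>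

definition list_eval :: "('v \<Rightarrow> 'b) \<Rightarrow> ('v \<times> 'b) list \<Rightarrow> 'b::cstar_algebra" where
  "list_eval h l = (\<Sum>(x, y)\<leftarrow>l. h x * y)"

definition tensor_eval :: "('v \<Rightarrow> 'b) \<Rightarrow> (nat \<Rightarrow> ('v \<times> 'b) list) set \<Rightarrow> 'b::cstar_algebra" where
  "tensor_eval h \<xi> = lim (\<lambda>n. list_eval h (rep \<xi> n))"

lemma list_eval_simps [simp]:
  "list_eval h [] = 0" "list_eval h ((x, y) # l) = h x * y + list_eval h l"
  "list_eval h (l @ m) = list_eval h l + list_eval h m"
  by (simp_all add: list_eval_def)

lemma list_eval_zero: "list_eval (\<lambda>x. 0) l = 0"
  by (induction l) auto

lemma list_eval_cong: "(\<And>x y. (x, y) \<in> set l \<Longrightarrow> h x = h' x) \<Longrightarrow> list_eval h l = list_eval h' l"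
  by (induction l) fastforce+

lemma list_eval_map_fst: "list_eval h (map (\<lambda>(x, y). (g x, y)) l) = list_eval (\<lambda>x. h (g x)) l"
  by (induction l) auto

lemma list_eval_csc: "list_eval h (map (\<lambda>(x, y). (x, c *\<^sub>c y)) l) = c *\<^sub>c list_eval h l"
  by (induction l) (auto simp: mult_scaleC_right scaleC_add_right)

lemma list_eval_ract: "list_eval h (map (\<lambda>(x, y). (x, y * b)) l) = list_eval h l * b"
  by (induction l) (auto simp: distrib_right mult.assoc)

lemma list_eval_add: "list_eval (\<lambda>x. h x + h' x) l = list_eval h l + list_eval h' l"
  by (induction l) (auto simp: distrib_right)

lemma list_eval_scaleC: "list_eval (\<lambda>x. c *\<^sub>c h x) l = c *\<^sub>c list_eval h l"
  by (induction l) (auto simp: mult_scaleC_left scaleC_add_right)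

lemma list_eval_mult: "list_eval (\<lambda>x. a * h x) l = a * list_eval h l"
  by (induction l) (auto simp: distrib_left mult.assoc)

text \<open>A finite Parseval frame \<open>e\<close>. This is the form in which finite generation and projectivity enter: the
frame vectors correspond to the columns of the projection \<open>p\<close> under \<open>K \<cong> p A\<^sup>n\<close>.\<close>

locale framed_correspondence =
  fixes A :: "'b::cstar_algebra set" and K :: "('v, 'b, 'm) corr_scheme" and n :: nat and e :: "nat \<Rightarrow> 'v"
  assumes A: "cstar_subalgebra A" and K: "correspondence A A K"
    and frame_carr: "i < n \<Longrightarrow> e i \<in> carr K"
    and frame: "x \<in> carr K \<Longrightarrow> y \<in> carr K \<Longrightarrow> rip K x y = (\<Sum>i<n. rip K x (e i) * rip K (e i) y)"
begin

lemma hilbert: "right_hilbert_module A K" and module: "right_module A K" and cvs: "cvector_space K"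
  using K by (auto simp: correspondence_def right_hilbert_module_def right_module_def)

sublocale K: pre_correspondence A A K
proof
  fix x y z r t c
  show "cstar_subalgebra A" by (rule A)
  show "x \<in> carr K \<Longrightarrow> y \<in> carr K \<Longrightarrow> add K x y \<in> carr K" "x \<in> carr K \<Longrightarrow> csc K c x \<in> carr K"
    using cvs unfolding cvector_space_def by blast+
  show "x \<in> carr K \<Longrightarrow> r \<in> A \<Longrightarrow> ract K x r \<in> carr K"
    using module unfolding right_module_def by blast
  show "x \<in> carr K \<Longrightarrow> y \<in> carr K \<Longrightarrow> rip K x y \<in> A"
    "x \<in> carr K \<Longrightarrow> y \<in> carr K \<Longrightarrow> z \<in> carr K \<Longrightarrow> rip K x (add K y z) = rip K x y + rip K x z"
    "x \<in> carr K \<Longrightarrow> y \<in> carr K \<Longrightarrow> rip K x (csc K c y) = c *\<^sub>c rip K x y"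
    "x \<in> carr K \<Longrightarrow> y \<in> carr K \<Longrightarrow> r \<in> A \<Longrightarrow> rip K x (ract K y r) = rip K x y * r"
    "x \<in> carr K \<Longrightarrow> y \<in> carr K \<Longrightarrow> (rip K x y)\<^sup>\<star> = rip K y x"
    using hilbert unfolding right_hilbert_module_def by blast+
  show "x \<in> carr K \<Longrightarrow> nonneg (rip K x x)"
    using hilbert positive_in_nonneg unfolding right_hilbert_module_def by blast
  show lact: "x \<in> carr K \<Longrightarrow> r \<in> A \<Longrightarrow> lact K r x \<in> carr K" for x r
    using K unfolding correspondence_def by blast
  show "x \<in> carr K \<Longrightarrow> y \<in> carr K \<Longrightarrow> r \<in> A \<Longrightarrow> rip K (lact K r x) y = rip K x (lact K (r\<^sup>\<star>) y)"
    using K unfolding correspondence_def by blast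
  show "rip K y (lact K (r + t) x) = rip K y (lact K r x) + rip K y (lact K t x)"
    if "x \<in> carr K" "y \<in> carr K" "r \<in> A" "t \<in> A"
  proof -
    have "lact K (r + t) x = add K (lact K r x) (lact K t x)"
      using K that unfolding correspondence_def by blast
    then show ?thesis
      using hilbert that lact unfolding right_hilbert_module_def by metis
  qed
  show "rip K y (lact K (c *\<^sub>c r) x) = c *\<^sub>c rip K y (lact K r x)"
    if "x \<in> carr K" "y \<in> carr K" "r \<in> A"
  proof -
    have "lact K (c *\<^sub>c r) x = csc K c (lact K r x)"
      using K that unfolding correspondence_def by blast
    then show ?thesis
      using hilbert that lact unfolding right_hilbert_module_def by metis
  qed
  show "x \<in> carr K \<Longrightarrow> y \<in> carr K \<Longrightarrow> r \<in> A \<Longrightarrow> t \<in> A \<Longrightarrow>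
      rip K y (lact K (r * t) x) = rip K y (lact K r (lact K t x))"
    "x \<in> carr K \<Longrightarrow> y \<in> carr K \<Longrightarrow> rip K y (lact K 1 x) = rip K y x"
    using K unfolding correspondence_def by metis+
qed

lemma lact_mult: "x \<in> carr K \<Longrightarrow> r \<in> A \<Longrightarrow> t \<in> A \<Longrightarrow> lact K (r * t) x = lact K r (lact K t x)"
  and lact_one: "x \<in> carr K \<Longrightarrow> lact K 1 x = x"
  using K unfolding correspondence_def by blast+

lemma zero_carr: "zero K \<in> carr K" and add_zero: "x \<in> carr K \<Longrightarrow> add K (zero K) x = x"
  and add_comm: "x \<in> carr K \<Longrightarrow> y \<in> carr K \<Longrightarrow> add K x y = add K y x"
  and add_assoc: "x \<in> carr K \<Longrightarrow> y \<in> carr K \<Longrightarrow> z \<in> carr K \<Longrightarrow>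
    add K (add K x y) z = add K x (add K y z)"
  and add_inv: "x \<in> carr K \<Longrightarrow> \<exists>y\<in>carr K. add K x y = zero K"
  and csc_add: "x \<in> carr K \<Longrightarrow> csc K (c + c') x = add K (csc K c x) (csc K c' x)"
  and csc_one: "x \<in> carr K \<Longrightarrow> csc K 1 x = x"
  using cvs unfolding cvector_space_def by blast+

lemma csc_zero:
  assumes x: "x \<in> carr K" shows "csc K 0 x = zero K"
proof -
  let ?z = "csc K 0 x"
  have z: "?z \<in> carr K" by (rule K.csc_closed[OF x])
  obtain w where w: "w \<in> carr K" "add K ?z w = zero K" using add_inv[OF z] by blast
  have "add K ?z ?z = ?z" using csc_add[OF x, of 0 0] by simp
  then have "add K ?z (add K ?z w) = add K ?z w" using add_assoc[OF z z w(1)] by simp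
  then show ?thesis using w(2) add_comm[OF z zero_carr] add_zero[OF z] by simp
qed

lemma csc_ract: "x \<in> carr K \<Longrightarrow> csc K c x = ract K x (c *\<^sub>c 1)"
  using module subalgebra_one[OF A] unfolding right_module_def by metis

text \<open>The inner product on \<open>K\<close> itself is definite, so here identities of inner products do give
identities of vectors.\<close>

lemma eq_by_rip:
  assumes x: "x \<in> carr K" and y: "y \<in> carr K" and eq: "\<And>z. z \<in> carr K \<Longrightarrow> rip K z x = rip K z y"
  shows "x = y"
proof -
  let ?m = "csc K (-1) y"
  have m: "?m \<in> carr K" by (rule K.csc_closed[OF y])
  have "rip K (diff K x y) (diff K x y) = 0" using x y eq by (simp add: K.rip_diff K.diff_closed)
  then have d: "add K x ?m = zero K"
    using hilbert K.diff_closed[OF x y] unfolding right_hilbert_module_def diff_def by blast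
  have "add K ?m y = zero K" using csc_add[OF y, of "-1" 1] by (simp add: csc_one csc_zero y)
  then have "add K x (zero K) = add K (zero K) y" using add_assoc[OF x m y] d by simp
  then show ?thesis using add_comm[OF x zero_carr] add_zero x y by simp
qed

lemma rip_zero: "x \<in> carr K \<Longrightarrow> rip K x (zero K) = 0"
  using K.rip_add[of x "zero K" "zero K"] add_zero[OF zero_carr] zero_carr by simp

lemma vsum_carr: "(\<And>i. i < m \<Longrightarrow> f i \<in> carr K) \<Longrightarrow> vsum K f m \<in> carr K"
  by (induction m) (simp_all add: zero_carr K.add_closed)

lemma rip_vsum: "x \<in> carr K \<Longrightarrow> (\<And>i. i < m \<Longrightarrow> f i \<in> carr K) \<Longrightarrow>
    rip K x (vsum K f m) = (\<Sum>i<m. rip K x (f i))"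
  by (induction m) (simp_all add: rip_zero vsum_carr K.rip_add)

lemma frame_term: "x \<in> carr K \<Longrightarrow> i < n \<Longrightarrow> ract K (e i) (rip K (e i) x) \<in> carr K"
  by (simp add: K.ract_closed frame_carr K.rip_closed)

lemma frame_expansion:
  assumes x: "x \<in> carr K" shows "vsum K (\<lambda>i. ract K (e i) (rip K (e i) x)) n = x"
proof (rule eq_by_rip)
  show "vsum K (\<lambda>i. ract K (e i) (rip K (e i) x)) n \<in> carr K" by (intro vsum_carr frame_term x)
  show "rip K z (vsum K (\<lambda>i. ract K (e i) (rip K (e i) x)) n) = rip K z x" if "z \<in> carr K" for z
    using that x by (simp add: rip_vsum frame_term frame[of z x] K.rip_ract frame_carr K.rip_closed)
qed (rule x)

lemma right_linear_zero: "right_linear A K h \<Longrightarrow> h (zero K) = 0"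
  using add_zero[OF zero_carr] zero_carr unfolding right_linear_def by (metis add_cancel_right_right)

lemma right_linear_vsum:
  "right_linear A K h \<Longrightarrow> (\<And>i. i < m \<Longrightarrow> f i \<in> carr K) \<Longrightarrow> h (vsum K f m) = (\<Sum>i<m. h (f i))"
proof (induction m)
  case (Suc m)
  then show ?case by (simp add: right_linear_def vsum_carr)
qed (simp add: right_linear_zero)

text \<open>A right linear map is determined by its values on the frame. Its continuity, its adjoint and its
extension to the tensor product all come from this formula.\<close>

lemma right_linear_expansion:
  assumes h: "right_linear A K h" and x: "x \<in> carr K"
  shows "h x = (\<Sum>i<n. h (e i) * rip K (e i) x)"
proof -
  have "h x = h (vsum K (\<lambda>i. ract K (e i) (rip K (e i) x)) n)" by (simp add: frame_expansion x)
  also have "\<dots> = (\<Sum>i<n. h (ract K (e i) (rip K (e i) x)))"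
    by (intro right_linear_vsum h frame_term x)
  also have "\<dots> = (\<Sum>i<n. h (e i) * rip K (e i) x)"
    using h x by (intro sum.cong refl) (simp add: right_linear_def frame_carr K.rip_closed)
  finally show ?thesis .
qed

lemma right_linear_csc: "right_linear A K h \<Longrightarrow> x \<in> carr K \<Longrightarrow> h (csc K c x) = c *\<^sub>c h x"
  using subalgebra_scaleC[OF A subalgebra_one[OF A], of c]
  by (simp add: csc_ract right_linear_def mult_scaleC_right)

lemma right_linear_rip: "x \<in> carr K \<Longrightarrow> right_linear A K (rip K x)"
  by (simp add: right_linear_def K.rip_add K.rip_ract)

abbreviation T :: "(('v \<times> 'b) list, 'b) corr" where "T \<equiv> pre_tensor K self_corr"

lemma T_carr: "l \<in> carr T \<longleftrightarrow> (\<forall>(x, y)\<in>set l. x \<in> carr K)"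
  by (auto simp: pre_tensor_def)

lemma T_simps:
  "add T l m = l @ m" "csc T c l = map (\<lambda>(x, y). (x, c *\<^sub>c y)) l"
  "lact T a l = map (\<lambda>(x, y). (lact K a x, y)) l" "ract T l b = map (\<lambda>(x, y). (x, y * b)) l"
  by (simp_all add: pre_tensor_def)

lemma T_rip: "rip T l m = (\<Sum>(x, y)\<leftarrow>l. y\<^sup>\<star> * list_eval (rip K x) m)"
  by (simp add: pre_tensor_def list_eval_def sum_list_const_mult[symmetric] case_prod_unfold)

lemma list_eval_expansion:
  "right_linear A K h \<Longrightarrow> l \<in> carr T \<Longrightarrow> list_eval h l = (\<Sum>i<n. h (e i) * list_eval (rip K (e i)) l)"
proof (induction l)
  case (Cons p l)
  obtain x y where p: "p = (x, y)" by (cases p)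
  have "l \<in> carr T" "x \<in> carr K" using Cons.prems by (auto simp: T_carr p)
  then show ?case
    using Cons right_linear_expansion[of h x]
    by (simp add: p distrib_left sum.distrib sum_distrib_right mult.assoc)
qed simp

text \<open>In frame coordinates \<open>\<langle>e\<^sub>i, x\<rangle> b\<close> the formal tensors map to \<open>B\<^sup>n\<close>, preserving
the inner product. Positivity of
the tensor inner product is read off from this.\<close>

lemma T_rip_frame:
  assumes "l \<in> carr T" "m \<in> carr T"
  shows "rip T l m = (\<Sum>i<n. (list_eval (rip K (e i)) l)\<^sup>\<star> * list_eval (rip K (e i)) m)"
  using assms(1)
proof (induction l)
  case (Cons p l)
  obtain x y where p: "p = (x, y)" by (cases p)
  have l: "l \<in> carr T" and x: "x \<in> carr K" using Cons.prems by (auto simp: T_carr p)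
  have "rip T (p # l) m = y\<^sup>\<star> * list_eval (rip K x) m + rip T l m" by (simp add: T_rip p)
  also have "y\<^sup>\<star> * list_eval (rip K x) m = (\<Sum>i<n. (rip K (e i) x * y)\<^sup>\<star> * list_eval (rip K (e i)) m)"
    using list_eval_expansion[OF right_linear_rip[OF x] assms(2)] x
    by (simp add: sum_distrib_left star_mult K.rip_star frame_carr mult.assoc)
  finally show ?case using Cons.IH[OF l] by (simp add: p star_add distrib_right sum.distrib)
qed (simp add: T_rip)

lemma T_closed:
  "l \<in> carr T \<Longrightarrow> m \<in> carr T \<Longrightarrow> add T l m \<in> carr T"
  "l \<in> carr T \<Longrightarrow> csc T c l \<in> carr T"
  "l \<in> carr T \<Longrightarrow> a \<in> A \<Longrightarrow> lact T a l \<in> carr T"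
  "l \<in> carr T \<Longrightarrow> ract T l b \<in> carr T"
  by (auto simp: T_carr T_simps K.lact_closed)

lemma list_eval_lact: "list_eval h (lact T a l) = list_eval (\<lambda>x. h (lact K a x)) l"
  by (simp add: T_simps list_eval_map_fst)

sublocale T: pre_correspondence A UNIV T
proof
  fix l m k :: "('v \<times> 'b) list" and r t a :: 'b and c :: complex
  show "cstar_subalgebra A" by (rule A)
  show "cstar_subalgebra (UNIV :: 'b set)" by (rule subalgebra_UNIV)
  show "l \<in> carr T \<Longrightarrow> m \<in> carr T \<Longrightarrow> add T l m \<in> carr T"
    "l \<in> carr T \<Longrightarrow> csc T c l \<in> carr T"
    "l \<in> carr T \<Longrightarrow> r \<in> A \<Longrightarrow> lact T r l \<in> carr T"
    "l \<in> carr T \<Longrightarrow> a \<in> UNIV \<Longrightarrow> ract T l a \<in> carr T"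
    by (simp_all add: T_closed)
  show "l \<in> carr T \<Longrightarrow> m \<in> carr T \<Longrightarrow> rip T l m \<in> UNIV" by simp
  show "l \<in> carr T \<Longrightarrow> m \<in> carr T \<Longrightarrow> k \<in> carr T \<Longrightarrow> rip T l (add T m k) = rip T l m + rip T l k"
    by (simp add: T_rip_frame T_closed) (simp add: T_simps distrib_left sum.distrib)
  show "l \<in> carr T \<Longrightarrow> m \<in> carr T \<Longrightarrow> rip T l (csc T c m) = c *\<^sub>c rip T l m"
    by (simp add: T_rip_frame T_closed)
      (simp add: T_simps list_eval_csc mult_scaleC_right
        linear_sum[OF bounded_linear.linear[OF bounded_linear_scaleC]])
  show "l \<in> carr T \<Longrightarrow> m \<in> carr T \<Longrightarrow> a \<in> UNIV \<Longrightarrow> rip T l (ract T m a) = rip T l m * a"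
    by (simp add: T_rip_frame T_closed)
      (simp add: T_simps list_eval_ract sum_distrib_right mult.assoc)
  show "l \<in> carr T \<Longrightarrow> m \<in> carr T \<Longrightarrow> (rip T l m)\<^sup>\<star> = rip T m l"
    by (simp add: T_rip_frame star_sum star_mult star_star)
  show "l \<in> carr T \<Longrightarrow> nonneg (rip T l l)"
    by (simp add: T_rip_frame nonneg_sum nonneg_star_mult_self)
  show "rip T (lact T r l) m = rip T l (lact T (r\<^sup>\<star>) m)"
    if l: "l \<in> carr T" and m: "m \<in> carr T" and r: "r \<in> A"
  proof -
    have "list_eval (rip K (lact K r x)) m = list_eval (rip K x) (lact T (r\<^sup>\<star>) m)" if "x \<in> carr K" for x
      unfolding list_eval_lact using m r that by (intro list_eval_cong) (auto simp: T_carr K.rip_lact_left)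
    then show ?thesis using l
    proof (induction l)
      case (Cons p l)
      then show ?case by (cases p) (auto simp: T_carr T_rip T_simps)
    qed (simp add: T_rip T_simps)
  qed
  show "rip T m (lact T (r + t) l) = rip T m (lact T r l) + rip T m (lact T t l)"
    if lm: "l \<in> carr T" "m \<in> carr T" and rt: "r \<in> A" "t \<in> A"
  proof -
    have "list_eval (rip K (e i)) (lact T (r + t) l) = list_eval (rip K (e i)) (lact T r l) + list_eval (rip K (e i)) (lact T t l)"
      if "i < n" for i
      unfolding list_eval_lact list_eval_add[symmetric] using lm rt that
      by (intro list_eval_cong) (auto simp: T_carr K.rip_lact_add frame_carr)
    then show ?thesis using lm rt
      by (simp add: T_rip_frame T_closed subalgebra_add[OF A] distrib_left sum.distrib)
  qed
  show "rip T m (lact T (c *\<^sub>c r) l) = c *\<^sub>c rip T m (lact T r l)"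
    if lm: "l \<in> carr T" "m \<in> carr T" and r: "r \<in> A"
  proof -
    have "list_eval (rip K (e i)) (lact T (c *\<^sub>c r) l) = c *\<^sub>c list_eval (rip K (e i)) (lact T r l)"
      if "i < n" for i
      unfolding list_eval_lact list_eval_scaleC[symmetric] using lm r that
      by (intro list_eval_cong) (auto simp: T_carr K.rip_lact_scaleC frame_carr)
    then show ?thesis using lm r
      by (simp add: T_rip_frame T_closed subalgebra_scaleC[OF A] mult_scaleC_right
        linear_sum[OF bounded_linear.linear[OF bounded_linear_scaleC]])
  qed
  show "rip T m (lact T (r * t) l) = rip T m (lact T r (lact T t l))"
    if "l \<in> carr T" "m \<in> carr T" "r \<in> A" "t \<in> A"
  proof -
    have "lact T (r * t) l = lact T r (lact T t l)"
      using that by (auto simp: T_simps T_carr lact_mult)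
    then show ?thesis by simp
  qed
  show "rip T m (lact T 1 l) = rip T m l" if "l \<in> carr T" "m \<in> carr T"
  proof -
    have "lact T 1 l = l" unfolding T_simps using that by (intro map_idI) (auto simp: T_carr lact_one)
    then show ?thesis by simp
  qed
qed

text \<open>The representing vector is \<open>\<Sum>\<^sub>i e\<^sub>i \<otimes> (h e\<^sub>i)\<^sup>\<star>\<close>, by the frame expansion of \<open>h\<close>. Through Cauchy-Schwarz
this makes evaluation continuous.\<close>

lemma list_eval_representable:
  assumes h: "right_linear A K h"
  obtains z where "z \<in> carr T" "\<And>l. l \<in> carr T \<Longrightarrow> list_eval h l = rip T z l"
proof
  let ?z = "map (\<lambda>i. (e i, (h (e i))\<^sup>\<star>)) [0..<n]"
  show "?z \<in> carr T" by (auto simp: T_carr frame_carr)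
  show "list_eval h l = rip T ?z l" if "l \<in> carr T" for l
    unfolding T_rip list_eval_expansion[OF h that]
    by (simp add: comp_def star_star interv_sum_list_conv_sum_set_nat atLeast0LessThan)
qed

lemma tensor_eval_limit:
  assumes h: "right_linear A K h" and s: "T.cauchy s"
  shows "(\<lambda>n. list_eval h (s n)) \<longlonglongrightarrow> tensor_eval h (cauchy_class T s)"
proof -
  obtain z where z: "z \<in> carr T" "\<And>l. l \<in> carr T \<Longrightarrow> list_eval h l = rip T z l"
    using list_eval_representable[OF h] by blast
  have lim: "(\<lambda>n. list_eval h (s n)) \<longlonglongrightarrow> rip (completion T) (to_completion T z) (cauchy_class T s)"
    if s: "T.cauchy s" for s
    using T.rip_completion[OF T.cauchy_const[OF z(1)] s] z(2)[OF T.cauchy_carr[OF s]]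
    by (simp add: to_completion_def)
  have "tensor_eval h (cauchy_class T s) = rip (completion T) (to_completion T z) (cauchy_class T s)"
    unfolding tensor_eval_def using limI[OF lim[OF T.rep_class(1)[OF s]]] by (simp only: T.rep_class(3)[OF s])
  then show ?thesis using lim[OF s] by simp
qed

lemma tensor_eval_limit_rep:
  "right_linear A K h \<Longrightarrow> \<xi> \<in> carr (tensor K self_corr) \<Longrightarrow> (\<lambda>n. list_eval h (rep \<xi> n)) \<longlonglongrightarrow> tensor_eval h \<xi>"
  using tensor_eval_limit[OF _ T.carr_rep(1)] T.carr_rep(2) by (simp add: tensor_def)

lemma rep_carr: "\<xi> \<in> carr (tensor K self_corr) \<Longrightarrow> rep \<xi> m \<in> carr T"
  using T.cauchy_carr[OF T.carr_rep(1)] by (simp add: tensor_def)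

lemma tensor_eval_to_completion:
  assumes "right_linear A K h" "l \<in> carr T" shows "tensor_eval h (to_completion T l) = list_eval h l"
  using tensor_eval_limit[OF assms(1) T.cauchy_const[OF assms(2)]]
  by (simp add: to_completion_def LIMSEQ_const_iff)

lemma elem_tensor_carr: "x \<in> carr K \<Longrightarrow> elem_tensor K self_corr x b \<in> carr (tensor K self_corr)"
  unfolding elem_tensor_def tensor_def by (rule T.to_completion_carr) (simp add: T_carr)

lemma tensor_eval_elem_tensor:
  "right_linear A K h \<Longrightarrow> x \<in> carr K \<Longrightarrow> tensor_eval h (elem_tensor K self_corr x b) = h x * b"
  unfolding elem_tensor_def by (subst tensor_eval_to_completion) (simp_all add: T_carr)

end

text \<open>If \<open>e\<^sub>j\<close> corresponds to the \<open>j\<close>-th column of \<open>p\<close>, then \<open>\<langle>e\<^sub>j, x\<rangle>\<close> is the \<open>j\<close>-th coordinate of \<open>x\<close>,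
since \<open>p\<close> is self-adjoint and fixes the coordinate vector of \<open>x\<close>.\<close>

lemma frame_exists:
  assumes A: "cstar_subalgebra A" and K: "correspondence A A K" and fgp: "right_fgp A K"
  obtains n e where "framed_correspondence A K n e"
proof -
  obtain n p u where p: "matrix_projection A n p"
    and u: "bij_betw u (carr K) {v \<in> tuples A n. \<forall>i<n. (\<Sum>j<n. p i j * v j) = v i}"
    and rip: "\<And>x y. x \<in> carr K \<Longrightarrow> y \<in> carr K \<Longrightarrow> rip K x y = (\<Sum>i<n. (u x i)\<^sup>\<star> * u y i)"
    using fgp unfolding right_fgp_def by blast
  define col where "col j = (\<lambda>i. if i < n then p i j else 0)" for j
  have pA: "i < n \<Longrightarrow> j < n \<Longrightarrow> p i j \<in> A" and ps: "i < n \<Longrightarrow> j < n \<Longrightarrow> (p i j)\<^sup>\<star> = p j i"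
    and pp: "i < n \<Longrightarrow> j < n \<Longrightarrow> (\<Sum>k<n. p i k * p k j) = p i j" for i j
    using p unfolding matrix_projection_def by (metis star_star)+
  have col: "col j \<in> {v \<in> tuples A n. \<forall>i<n. (\<Sum>j<n. p i j * v j) = v i}" if "j < n" for j
    using that by (simp add: tuples_def col_def pA pp)
  define e where "e j = inv_into (carr K) u (col j)" for j
  have e: "e j \<in> carr K" "u (e j) = col j" if "j < n" for j
    using col[OF that] u unfolding e_def bij_betw_def by (metis inv_into_into, metis f_inv_into_f)
  have coord: "rip K (e j) x = u x j" if "j < n" "x \<in> carr K" for j x
  proof -
    have "u x \<in> {v \<in> tuples A n. \<forall>i<n. (\<Sum>j<n. p i j * v j) = v i}"
      using u that unfolding bij_betw_def by blast
    then show ?thesis using that by (simp add: rip e col_def ps)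
  qed
  have star: "(rip K x y)\<^sup>\<star> = rip K y x" if "x \<in> carr K" "y \<in> carr K" for x y
    using K that unfolding correspondence_def right_hilbert_module_def by blast
  have "framed_correspondence A K n e"
  proof
    show "rip K x y = (\<Sum>i<n. rip K x (e i) * rip K (e i) y)" if "x \<in> carr K" "y \<in> carr K" for x y
    proof -
      have "rip K x (e i) * rip K (e i) y = (u x i)\<^sup>\<star> * u y i" if i: "i < n" for i
        using star[OF e(1)[OF i] \<open>x \<in> carr K\<close>] i by (simp add: coord that \<open>x \<in> carr K\<close> \<open>y \<in> carr K\<close>)
      then show ?thesis using that by (simp add: rip)
    qed
  qed (use A K e in auto)
  then show thesis by (rule that)
qed

section \<open>Bimodule maps into the large algebra parametrise both spaces\<close>

context expectation
begin

lemma E_mult_left: "a \<in> A \<Longrightarrow> E (a * x) = a * E x"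
  using expectation_star[OF E, of "x\<^sup>\<star> * a\<^sup>\<star>"] expectation_star[OF E, of x]
    E_mult[OF subalgebra_star[OF A], of a "x\<^sup>\<star>"]
  by (simp add: star_mult star_star)

lemma Omega_carr: "Omega E b \<in> carr (calB E)"
  unfolding Omega_def calB_def by (rule C.to_completion_carr) simp

lemma Omega_add: "add (calB E) (Omega E b) (Omega E b') = Omega E (b + b')"
  and Omega_csc: "csc (calB E) c (Omega E b) = Omega E (c *\<^sub>c b)"
  and Omega_lact: "a \<in> A \<Longrightarrow> lact (calB E) a (Omega E b) = Omega E (a * b)"
  and Omega_ract: "a \<in> A \<Longrightarrow> ract (calB E) (Omega E b) a = Omega E (b * a)"
  and Omega_rip: "rip (calB E) (Omega E b) (Omega E b') = E (b\<^sup>\<star> * b')"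
  unfolding Omega_def calB_def
  by (simp_all add: C.add_to_completion C.csc_to_completion C.lact_to_completion
      C.ract_to_completion C.rip_to_completion)

lemma Omega_zero: "zero (calB E) = Omega E 0"
  by (simp add: Omega_def calB_def completion_def to_completion_def)

text \<open>Faithfulness of \<open>E\<close> says that \<open>b\<Omega>\<close> has norm zero only for \<open>b = 0\<close>.\<close>

lemma Omega_inject: "Omega E b = Omega E b' \<longleftrightarrow> b = b'"
proof
  assume "Omega E b = Omega E b'"
  then have "C.d b b' = 0" unfolding Omega_def by (intro C.to_completion_eq) auto
  then have "E ((b - b')\<^sup>\<star> * (b - b')) = 0"
    by (simp add: rnorm_def diff_def scaleC_minus_one)
  from E_faithful[OF this] show "b = b'" by simp
qed simp

lemma check_eq: "f k = Omega E b \<Longrightarrow> check E f k = b"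
  unfolding check_def by (rule the_equality) (simp_all add: Omega_inject)

end

text \<open>The two maps attached to a bimodule map \<open>h : K \<rightarrow> B\<close>: the first is \<open>x \<mapsto> h x \<Omega>\<close>, the second sends
\<open>x \<boxtimes> b\<close> to \<open>h x * b\<close>. Both are extensional, as elements of \<^const>\<open>adj_maps\<close> are.\<close>

definition Omega_map :: "('b::cstar_algebra \<Rightarrow> 'b) \<Rightarrow> ('v, 'b, 'm) corr_scheme \<Rightarrow> ('v \<Rightarrow> 'b)
    \<Rightarrow> 'v \<Rightarrow> (nat \<Rightarrow> 'b) set" where
  "Omega_map E K h = (\<lambda>x\<in>carr K. Omega E (h x))"

definition eval_map :: "('v, 'b::cstar_algebra, 'm) corr_scheme \<Rightarrow> ('v \<Rightarrow> 'b)
    \<Rightarrow> (nat \<Rightarrow> ('v \<times> 'b) list) set \<Rightarrow> 'b" where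
  "eval_map K h = (\<lambda>\<xi>\<in>carr (tensor K self_corr). tensor_eval h \<xi>)"

lemma tensor_eval_zero: "tensor_eval (\<lambda>x. 0) \<xi> = 0"
  by (simp add: tensor_eval_def list_eval_zero)

lemma Omega_map_cong: "(\<And>x. x \<in> carr K \<Longrightarrow> h x = h' x) \<Longrightarrow> Omega_map E K h = Omega_map E K h'"
  unfolding Omega_map_def by (rule restrict_ext) simp

context framed_correspondence
begin

lemma eval_map_cong: "(\<And>x. x \<in> carr K \<Longrightarrow> h x = h' x) \<Longrightarrow> eval_map K h = eval_map K h'"
proof -
  assume eq: "\<And>x. x \<in> carr K \<Longrightarrow> h x = h' x"
  have "tensor_eval h \<xi> = tensor_eval h' \<xi>" if \<xi>: "\<xi> \<in> carr (tensor K self_corr)" for \<xi>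
  proof -
    have "list_eval h (rep \<xi> m) = list_eval h' (rep \<xi> m)" for m
      using rep_carr[OF \<xi>, of m] by (intro list_eval_cong eq) (auto simp: T_carr)
    then show ?thesis by (simp add: tensor_eval_def)
  qed
  then show ?thesis by (auto simp: eval_map_def)
qed

lemma bimodule_map_zero: "bimodule_map A K (\<lambda>x. 0)"
  and bimodule_map_add: "bimodule_map A K h \<Longrightarrow> bimodule_map A K h' \<Longrightarrow> bimodule_map A K (\<lambda>x. h x + h' x)"
  and bimodule_map_scaleC: "bimodule_map A K h \<Longrightarrow> bimodule_map A K (\<lambda>x. c *\<^sub>c h x)"
  by (auto simp: bimodule_map_def right_linear_def distrib_left distrib_right scaleC_add_right
      mult_scaleC_left mult_scaleC_right algebra_simps)

lemma tensor_eval_add: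
  assumes "right_linear A K h" "right_linear A K h'" "right_linear A K (\<lambda>x. h x + h' x)"
    and "\<xi> \<in> carr (tensor K self_corr)"
  shows "tensor_eval (\<lambda>x. h x + h' x) \<xi> = tensor_eval h \<xi> + tensor_eval h' \<xi>"
  using LIMSEQ_unique[OF tensor_eval_limit_rep[OF assms(3,4)]]
    tendsto_add[OF tensor_eval_limit_rep[OF assms(1,4)] tensor_eval_limit_rep[OF assms(2,4)]]
  by (simp add: list_eval_add)

lemma tensor_eval_scaleC:
  assumes "right_linear A K h" "right_linear A K (\<lambda>x. c *\<^sub>c h x)" "\<xi> \<in> carr (tensor K self_corr)"
  shows "tensor_eval (\<lambda>x. c *\<^sub>c h x) \<xi> = c *\<^sub>c tensor_eval h \<xi>"
  using LIMSEQ_unique[OF tensor_eval_limit_rep[OF assms(2,3)]] tendsto_scaleC[OF tensor_eval_limit_rep[OF assms(1,3)]]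
  by (simp add: list_eval_scaleC)

lemma bimodule_mapD: "bimodule_map A K h \<Longrightarrow> right_linear A K h"
  by (simp add: bimodule_map_def)

text \<open>If \<open>z\<close> represents \<open>h\<close>, the evaluation map is the inner product with the class of \<open>z\<close>, so its adjoint
is \<open>b \<mapsto> z b\<close>.\<close>

lemma eval_map_adj:
  assumes h: "bimodule_map A K h"
  shows "eval_map K h \<in> adj_maps A UNIV (tensor K self_corr) self_corr"
proof -
  have rl: "right_linear A K h" by (rule bimodule_mapD[OF h])
  obtain z where z: "z \<in> carr T" "\<And>l. l \<in> carr T \<Longrightarrow> list_eval h l = rip T z l"
    using list_eval_representable[OF rl] by blast
  define g where "g b = to_completion T (ract T z b)" for b
  have g: "g b \<in> carr (tensor K self_corr)" for b
    unfolding g_def tensor_def by (intro T.to_completion_carr T_closed z(1))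
  have adj: "(tensor_eval h \<xi>)\<^sup>\<star> * b = rip (tensor K self_corr) \<xi> (g b)"
    if \<xi>: "\<xi> \<in> carr (tensor K self_corr)" for \<xi> b
  proof (rule LIMSEQ_unique)
    show "(\<lambda>n. (list_eval h (rep \<xi> n))\<^sup>\<star> * b) \<longlonglongrightarrow> (tensor_eval h \<xi>)\<^sup>\<star> * b"
      by (intro tendsto_mult tendsto_star tensor_eval_limit_rep rl \<xi> tendsto_const)
    note rep = T.carr_rep[OF \<xi>[unfolded tensor_def]]
    have zb: "ract T z b \<in> carr T" by (intro T_closed z(1))
    have "(list_eval h (rep \<xi> n))\<^sup>\<star> * b = rip T (rep \<xi> n) (ract T z b)" for n
      using rep_carr[OF \<xi>] z by (simp add: T.rip_ract T.rip_star)
    then show "(\<lambda>n. (list_eval h (rep \<xi> n))\<^sup>\<star> * b) \<longlonglongrightarrow> rip (tensor K self_corr) \<xi> (g b)"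
      using T.rip_completion[OF rep(1) T.cauchy_const[OF zb]]
      by (simp add: rep(2) tensor_def g_def to_completion_def)
  qed
  have lact: "lact (tensor K self_corr) a \<xi> \<in> carr (tensor K self_corr)
      \<and> tensor_eval h (lact (tensor K self_corr) a \<xi>) = a * tensor_eval h \<xi>"
    if \<xi>: "\<xi> \<in> carr (tensor K self_corr)" and a: "a \<in> A" for \<xi> a
  proof -
    note rep = T.carr_rep[OF \<xi>[unfolded tensor_def]]
    have c: "T.cauchy (\<lambda>n. lact T a (rep \<xi> n))" by (rule T.lact_cauchy[OF rep(1) a])
    have eq: "lact (tensor K self_corr) a \<xi> = cauchy_class T (\<lambda>n. lact T a (rep \<xi> n))"
      using T.lact_class[OF rep(1) a] by (simp add: rep(2) tensor_def)
    have "list_eval h (lact T a (rep \<xi> n)) = a * list_eval h (rep \<xi> n)" for n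
      unfolding list_eval_lact list_eval_mult[symmetric]
      using h a rep_carr[OF \<xi>, of n] by (intro list_eval_cong) (auto simp: T_carr bimodule_map_def)
    then have "(\<lambda>n. a * list_eval h (rep \<xi> n)) \<longlonglongrightarrow> tensor_eval h (lact (tensor K self_corr) a \<xi>)"
      using tensor_eval_limit[OF rl c] by (simp add: eq)
    from LIMSEQ_unique[OF this tendsto_mult[OF tendsto_const tensor_eval_limit_rep[OF rl \<xi>]]]
    show ?thesis using T.class_carr[OF c, folded tensor_def] unfolding eq by blast
  qed
  have ract: "ract (tensor K self_corr) \<xi> b \<in> carr (tensor K self_corr)
      \<and> tensor_eval h (ract (tensor K self_corr) \<xi> b) = tensor_eval h \<xi> * b"
    if \<xi>: "\<xi> \<in> carr (tensor K self_corr)" for \<xi> b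
  proof -
    note rep = T.carr_rep[OF \<xi>[unfolded tensor_def]]
    have c: "T.cauchy (\<lambda>n. ract T (rep \<xi> n) b)" by (rule T.ract_cauchy[OF rep(1) UNIV_I])
    have eq: "ract (tensor K self_corr) \<xi> b = cauchy_class T (\<lambda>n. ract T (rep \<xi> n) b)"
      using T.ract_class[OF rep(1) UNIV_I] by (simp add: rep(2) tensor_def)
    have "(\<lambda>n. list_eval h (rep \<xi> n) * b) \<longlonglongrightarrow> tensor_eval h (ract (tensor K self_corr) \<xi> b)"
      using tensor_eval_limit[OF rl c] by (simp add: eq T_simps list_eval_ract)
    from LIMSEQ_unique[OF this tendsto_mult[OF tensor_eval_limit_rep[OF rl \<xi>] tendsto_const]]
    show ?thesis using T.class_carr[OF c, folded tensor_def] unfolding eq by blast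
  qed
  show ?thesis unfolding adj_maps_def
  proof (intro CollectI conjI ballI)
    show "eval_map K h \<in> carr (tensor K self_corr) \<rightarrow>\<^sub>E carr self_corr" by (auto simp: eval_map_def)
    show "\<exists>g\<in>carr self_corr \<rightarrow> carr (tensor K self_corr). \<forall>x\<in>carr (tensor K self_corr). \<forall>y\<in>carr self_corr.
        rip self_corr (eval_map K h x) y = rip (tensor K self_corr) x (g y)"
      using g adj by (intro bexI[of _ g]) (auto simp: eval_map_def)
  qed (simp_all add: eval_map_def lact ract)
qed

text \<open>Let \<open>\<eta>\<close> be the image of \<open>1\<close> under the adjoint of \<open>f\<close>, so that \<open>(f \<xi>)\<^sup>\<star> = \<langle>\<xi>, \<eta>\<rangle>\<close>. Restricted to the
vectors \<open>x \<boxtimes> 1\<close> this gives additivity and right linearity of \<open>h\<close>; written in frame coordinates of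
\<open>\<xi>\<close> and \<open>\<eta>\<close> it gives \<open>f \<xi> = \<Sum>\<^sub>i h e\<^sub>i * \<langle>e\<^sub>i, \<xi>\<rangle>\<close>, the frame expansion of evaluation.\<close>

lemma adj_is_eval_map:
  assumes f: "f \<in> adj_maps A UNIV (tensor K self_corr) self_corr"
  defines "h \<equiv> \<lambda>x. f (elem_tensor K self_corr x 1)"
  shows "bimodule_map A K h" and "f = eval_map K h"
proof -
  let ?T = "tensor K self_corr"
  obtain g where g: "g \<in> carr self_corr \<rightarrow> carr ?T"
    and adj: "\<And>x y. x \<in> carr ?T \<Longrightarrow> y \<in> carr self_corr \<Longrightarrow> rip self_corr (f x) y = rip ?T x (g y)"
    using f unfolding adj_maps_def by blast
  have fl: "f (lact ?T a \<xi>) = a * f \<xi>" if "a \<in> A" "\<xi> \<in> carr ?T" for a \<xi>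
    using f that by (simp add: adj_maps_def)
  define \<eta> where "\<eta> = g 1"
  have \<eta>: "\<eta> \<in> carr (completion T)" using g by (auto simp: \<eta>_def tensor_def)
  have f_rip: "(f \<xi>)\<^sup>\<star> = rip (completion T) \<xi> \<eta>" if "\<xi> \<in> carr (completion T)" for \<xi>
    using adj[of \<xi> 1] that by (simp add: \<eta>_def tensor_def)
  have h_lim: "(\<lambda>n. list_eval (rip K x) (rep \<eta> n)) \<longlonglongrightarrow> (h x)\<^sup>\<star>" if x: "x \<in> carr K" for x
  proof -
    have x1: "[(x, 1)] \<in> carr T" using x by (simp add: T_carr)
    show ?thesis
      using T.rip_completion_left[OF x1 \<eta>] f_rip[OF T.to_completion_carr[OF x1]]
      by (simp add: T_rip h_def elem_tensor_def)
  qed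
  have repK: "y \<in> carr K" if "(y, b) \<in> set (rep \<eta> n)" for y b n
    using T.cauchy_carr[OF T.carr_rep(1)[OF \<eta>], of n] that by (auto simp: T_carr)
  show bm: "bimodule_map A K h" unfolding bimodule_map_def right_linear_def
  proof (intro conjI ballI)
    fix x y assume x: "x \<in> carr K" and y: "y \<in> carr K"
    have "list_eval (rip K (add K x y)) (rep \<eta> n) = list_eval (rip K x) (rep \<eta> n) + list_eval (rip K y) (rep \<eta> n)" for n
      unfolding list_eval_add[symmetric] using x y repK by (intro list_eval_cong) (auto intro: K.rip_add_left)
    then have "(\<lambda>n. list_eval (rip K x) (rep \<eta> n) + list_eval (rip K y) (rep \<eta> n)) \<longlonglongrightarrow> (h (add K x y))\<^sup>\<star>"
      using h_lim[OF K.add_closed[OF x y]] by simp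
    from LIMSEQ_unique[OF this tendsto_add[OF h_lim[OF x] h_lim[OF y]]]
    have "((h (add K x y))\<^sup>\<star>)\<^sup>\<star> = ((h x)\<^sup>\<star> + (h y)\<^sup>\<star>)\<^sup>\<star>" by simp
    then show "h (add K x y) = h x + h y" by (simp add: star_add star_star)
  next
    fix x a assume x: "x \<in> carr K" and a: "a \<in> A"
    have "list_eval (rip K (ract K x a)) (rep \<eta> n) = a\<^sup>\<star> * list_eval (rip K x) (rep \<eta> n)" for n
      unfolding list_eval_mult[symmetric] using x a repK by (intro list_eval_cong) (auto intro: K.rip_ract_left)
    then have "(\<lambda>n. a\<^sup>\<star> * list_eval (rip K x) (rep \<eta> n)) \<longlonglongrightarrow> (h (ract K x a))\<^sup>\<star>"
      using h_lim[OF K.ract_closed[OF x a]] by simp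
    from LIMSEQ_unique[OF this tendsto_mult[OF tendsto_const h_lim[OF x]]]
    have "((h (ract K x a))\<^sup>\<star>)\<^sup>\<star> = (a\<^sup>\<star> * (h x)\<^sup>\<star>)\<^sup>\<star>" by simp
    then show "h (ract K x a) = h x * a" by (simp add: star_mult star_star)
  next
    fix x a assume x: "x \<in> carr K" and a: "a \<in> A"
    have x1: "[(x, 1)] \<in> carr T" using x by (simp add: T_carr)
    have "elem_tensor K self_corr (lact K a x) 1 = lact ?T a (elem_tensor K self_corr x 1)"
      using T.lact_to_completion[OF x1 a] by (simp add: elem_tensor_def tensor_def T_simps)
    then show "h (lact K a x) = a * h x"
      using fl[OF a elem_tensor_carr[OF x]] by (simp add: h_def)
  qed
  note rl = bimodule_mapD[OF bm]
  have "f \<xi> = tensor_eval h \<xi>" if \<xi>: "\<xi> \<in> carr ?T" for \<xi>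
  proof -
    let ?c = "\<lambda>i. tensor_eval (rip K (e i)) \<xi>"
    have c: "(\<lambda>m. list_eval (rip K (e i)) (rep \<xi> m)) \<longlonglongrightarrow> ?c i" if "i < n" for i
      by (intro tensor_eval_limit_rep right_linear_rip frame_carr that \<xi>)
    have \<xi>': "\<xi> \<in> carr (completion T)" using \<xi> by (simp add: tensor_def)
    have "(\<lambda>m. \<Sum>i<n. (list_eval (rip K (e i)) (rep \<xi> m))\<^sup>\<star> * list_eval (rip K (e i)) (rep \<eta> m))
        \<longlonglongrightarrow> (\<Sum>i<n. (?c i)\<^sup>\<star> * (h (e i))\<^sup>\<star>)"
      by (intro tendsto_sum tendsto_mult tendsto_star c h_lim frame_carr) auto
    moreover have "rip T (rep \<xi> m) (rep \<eta> m)
        = (\<Sum>i<n. (list_eval (rip K (e i)) (rep \<xi> m))\<^sup>\<star> * list_eval (rip K (e i)) (rep \<eta> m))" for m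
      by (intro T_rip_frame T.cauchy_carr T.carr_rep(1) \<xi>' \<eta>)
    ultimately have "(\<lambda>m. rip T (rep \<xi> m) (rep \<eta> m)) \<longlonglongrightarrow> (\<Sum>i<n. (?c i)\<^sup>\<star> * (h (e i))\<^sup>\<star>)"
      by simp
    from LIMSEQ_unique[OF T.rip_completion_rep[OF \<xi>' \<eta>] this]
    have "((f \<xi>)\<^sup>\<star>)\<^sup>\<star> = (\<Sum>i<n. (?c i)\<^sup>\<star> * (h (e i))\<^sup>\<star>)\<^sup>\<star>" by (simp add: f_rip \<xi>')
    then have 1: "f \<xi> = (\<Sum>i<n. h (e i) * ?c i)" by (simp add: star_sum star_mult star_star)
    have "(\<lambda>m. \<Sum>i<n. h (e i) * list_eval (rip K (e i)) (rep \<xi> m)) \<longlonglongrightarrow> (\<Sum>i<n. h (e i) * ?c i)"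
      by (intro tendsto_sum tendsto_mult tendsto_const c) auto
    then have "(\<lambda>m. list_eval h (rep \<xi> m)) \<longlonglongrightarrow> (\<Sum>i<n. h (e i) * ?c i)"
      by (simp add: list_eval_expansion[OF rl rep_carr[OF \<xi>]])
    from LIMSEQ_unique[OF tensor_eval_limit_rep[OF rl \<xi>] this] 1 show ?thesis by simp
  qed
  moreover have "f \<in> extensional (carr ?T)" using f by (auto simp: adj_maps_def PiE_def)
  ultimately show "f = eval_map K h"
    unfolding eval_map_def by (intro extensionalityI[of f "carr ?T"]) auto
qed

end

locale frobenius = expectation A E + fr: framed_correspondence A K n e
  for A :: "'b::cstar_algebra set" and E and K :: "('k, 'b) bimod" and n e
begin

text \<open>The adjoint of \<open>x \<mapsto> h x \<Omega>\<close> is \<open>y \<mapsto> \<Sum>\<^sub>i e\<^sub>i \<langle>h e\<^sub>i \<Omega>, y\<rangle>\<close>, a finite sum thanks to the frame.\<close>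

lemma Omega_map_diamond:
  assumes h: "bimodule_map A K h" shows "Omega_map E K h \<in> diamond A E K"
proof -
  let ?r = "\<lambda>i y. rip (calB E) (Omega E (h (e i))) y"
  define g where "g y = vsum K (\<lambda>i. ract K (e i) (?r i y)) n" for y
  have r: "?r i y \<in> A" if "y \<in> carr (calB E)" for i y
    using C.rip_completion_closed Omega_carr that by (simp add: calB_def)
  have g_term: "ract K (e i) (?r i y) \<in> carr K" if "i < n" "y \<in> carr (calB E)" for i y
    by (intro fr.K.ract_closed fr.frame_carr r that)
  have adj: "rip (calB E) (Omega E (h x)) y = rip K x (g y)"
    if x: "x \<in> carr K" and y: "y \<in> carr (calB E)" for x y
  proof (rule LIMSEQ_unique)
    have lim: "(\<lambda>m. E (b\<^sup>\<star> * rep y m)) \<longlonglongrightarrow> rip (calB E) (Omega E b) y" for b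
      using C.rip_completion_left[of b y] y by (simp add: calB_def Omega_def)
    show "(\<lambda>m. E ((h x)\<^sup>\<star> * rep y m)) \<longlonglongrightarrow> rip (calB E) (Omega E (h x)) y" by (rule lim)
    have "E ((h x)\<^sup>\<star> * b) = (\<Sum>i<n. rip K x (e i) * E ((h (e i))\<^sup>\<star> * b))" for b
    proof -
      have "(h x)\<^sup>\<star> * b = (\<Sum>i<n. rip K x (e i) * ((h (e i))\<^sup>\<star> * b))"
        using fr.right_linear_expansion[OF fr.bimodule_mapD[OF h] x] x
        by (simp add: star_sum star_mult fr.K.rip_star fr.frame_carr sum_distrib_right mult.assoc)
      moreover have "E (\<Sum>i\<in>I. f i) = (\<Sum>i\<in>I. E (f i))" for f :: "nat \<Rightarrow> 'b" and I
        using E_add[of 0 0] by (induction I rule: infinite_finite_induct) (auto simp: E_add)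
      ultimately show ?thesis using x by (simp add: E_mult_left fr.K.rip_closed fr.frame_carr)
    qed
    moreover have "(\<lambda>m. \<Sum>i<n. rip K x (e i) * E ((h (e i))\<^sup>\<star> * rep y m))
        \<longlonglongrightarrow> (\<Sum>i<n. rip K x (e i) * ?r i y)"
      by (intro tendsto_sum tendsto_mult tendsto_const lim)
    moreover have "rip K x (g y) = (\<Sum>i<n. rip K x (e i) * ?r i y)"
      unfolding g_def using x y by (simp add: fr.rip_vsum g_term fr.K.rip_ract fr.frame_carr r)
    ultimately show "(\<lambda>m. E ((h x)\<^sup>\<star> * rep y m)) \<longlonglongrightarrow> rip K x (g y)" by simp
  qed
  have "g \<in> carr (calB E) \<rightarrow> carr K" unfolding g_def by (auto intro!: fr.vsum_carr g_term)
  with adj have ex: "\<exists>g\<in>carr (calB E) \<rightarrow> carr K. \<forall>x\<in>carr K. \<forall>y\<in>carr (calB E).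
      rip (calB E) (Omega_map E K h x) y = rip K x (g y)"
    by (intro bexI[of _ g]) (auto simp: Omega_map_def)
  show ?thesis unfolding diamond_def adj_maps_def
  proof (intro CollectI conjI ballI)
    show "Omega_map E K h \<in> carr K \<rightarrow>\<^sub>E carr (calB E)" by (auto simp: Omega_map_def Omega_carr)
    show "Omega_map E K h ` carr K \<subseteq> range (Omega E)" by (auto simp: Omega_map_def)
  qed (use h ex in \<open>auto simp: Omega_map_def Omega_lact Omega_ract bimodule_map_def right_linear_def
      fr.K.lact_closed fr.K.ract_closed\<close>)
qed

lemma diamond_check: "g \<in> diamond A E K \<Longrightarrow> k \<in> carr K \<Longrightarrow> Omega E (check E g k) = g k"
proof -
  assume "g \<in> diamond A E K" "k \<in> carr K"
  then obtain b where "g k = Omega E b" by (auto simp: diamond_def)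
  then show ?thesis by (simp add: check_eq)
qed

text \<open>Bimodularity passes from \<open>g\<close> to \<open>check E g\<close> through injectivity of \<open>b \<mapsto> b\<Omega>\<close>. Additivity comes from the
adjoint: the failure \<open>c\<close> of additivity satisfies \<open>E (c\<^sup>\<star> * b) = 0\<close> for all \<open>b\<close>, in particular for
\<open>b = c\<close>.\<close>

lemma diamond_is_Omega_map:
  assumes g: "g \<in> diamond A E K"
  shows "bimodule_map A K (check E g)" and "g = Omega_map E K (check E g)"
proof -
  have g_adj: "g \<in> adj_maps A A K (calB E)" using g by (simp add: diamond_def)
  then have "\<exists>g'\<in>carr (calB E) \<rightarrow> carr K. \<forall>x\<in>carr K. \<forall>y\<in>carr (calB E).
      rip (calB E) (g x) y = rip K x (g' y)"
    unfolding adj_maps_def mem_Collect_eq by (elim conjE)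
  then obtain g' where g': "g' \<in> carr (calB E) \<rightarrow> carr K"
    and adj: "\<And>x y. x \<in> carr K \<Longrightarrow> y \<in> carr (calB E) \<Longrightarrow> rip (calB E) (g x) y = rip K x (g' y)"
    by (elim bexE) metis
  have gl: "g (lact K a x) = lact (calB E) a (g x)" and gr: "g (ract K x a) = ract (calB E) (g x) a"
    if "a \<in> A" "x \<in> carr K" for a x
    using g_adj that by (simp_all add: adj_maps_def)
  let ?h = "check E g"
  note \<Omega> = diamond_check[OF g]
  show "bimodule_map A K ?h" unfolding bimodule_map_def right_linear_def
  proof (intro conjI ballI)
    fix x y assume x: "x \<in> carr K" and y: "y \<in> carr K"
    let ?s = "add K x y"
    have s: "?s \<in> carr K" by (rule fr.K.add_closed[OF x y])
    have E_h: "E ((?h z)\<^sup>\<star> * b) = rip K z (g' (Omega E b))" if "z \<in> carr K" for z b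
      using adj[OF that Omega_carr[of b]] by (simp add: Omega_rip flip: \<Omega>[OF that])
    have "E ((?h ?s - (?h x + ?h y))\<^sup>\<star> * b) = 0" for b
    proof -
      have "rip K ?s (g' (Omega E b)) = rip K x (g' (Omega E b)) + rip K y (g' (Omega E b))"
        using g' Omega_carr by (intro fr.K.rip_add_left x y) auto
      then have "E ((?h ?s)\<^sup>\<star> * b) = E ((?h x + ?h y)\<^sup>\<star> * b)"
        by (simp add: E_h x y s star_add distrib_right E_add)
      moreover have "E ((?h ?s)\<^sup>\<star> * b) = E ((?h ?s - (?h x + ?h y))\<^sup>\<star> * b) + E ((?h x + ?h y)\<^sup>\<star> * b)"
        unfolding E_add[symmetric] by (simp add: star_diff algebra_simps)
      ultimately show ?thesis by simp
    qed
    from E_faithful[OF this] show "?h ?s = ?h x + ?h y" by simp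
  next
    fix x a assume x: "x \<in> carr K" and a: "a \<in> A"
    show "?h (ract K x a) = ?h x * a"
      by (rule check_eq) (simp add: gr[OF a x] Omega_ract[OF a] flip: \<Omega>[OF x])
    show "?h (lact K a x) = a * ?h x"
      by (rule check_eq) (simp add: gl[OF a x] Omega_lact[OF a] flip: \<Omega>[OF x])
  qed
  have "g \<in> extensional (carr K)" using g_adj by (simp add: adj_maps_def PiE_def)
  then show "g = Omega_map E K ?h"
    unfolding Omega_map_def using \<Omega> by (intro extensionalityI[of g "carr K"]) auto
qed

lemma check_Omega_map: "k \<in> carr K \<Longrightarrow> check E (Omega_map E K h) k = h k"
  by (rule check_eq) (simp add: Omega_map_def)

lemma diamond_eq: "diamond A E K = Omega_map E K ` {h. bimodule_map A K h}"
  using diamond_is_Omega_map Omega_map_diamond by blast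

lemma adj_maps_eq: "adj_maps A UNIV (tensor K self_corr) self_corr = eval_map K ` {h. bimodule_map A K h}"
  using fr.adj_is_eval_map fr.eval_map_adj by blast

lemma eval_map_elem: "bimodule_map A K h \<Longrightarrow> k \<in> carr K \<Longrightarrow> eval_map K h (elem_tensor K self_corr k b) = h k * b"
  by (simp add: eval_map_def fr.elem_tensor_carr fr.tensor_eval_elem_tensor fr.bimodule_mapD)

text \<open>An adjointable bimodular map is the evaluation map of its values on the vectors
\<open>x \<boxtimes> 1\<close>, which the prescription fixes to be \<open>h x\<close>.\<close>

lemma Psi_spec_iff:
  assumes h: "bimodule_map A K h"
  shows "Psi_spec A E K (Omega_map E K h) f \<longleftrightarrow> f = eval_map K h"
proof
  assume "Psi_spec A E K (Omega_map E K h) f"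
  then have f: "f \<in> adj_maps A UNIV (tensor K self_corr) self_corr"
    and fh: "\<And>k. k \<in> carr K \<Longrightarrow> f (elem_tensor K self_corr k 1) = h k"
    by (simp_all add: Psi_spec_def check_Omega_map)
  have "f = eval_map K (\<lambda>x. f (elem_tensor K self_corr x 1))" by (rule fr.adj_is_eval_map(2)[OF f])
  also have "\<dots> = eval_map K h" by (rule fr.eval_map_cong[OF fh])
  finally show "f = eval_map K h" .
qed (simp add: Psi_spec_def fr.eval_map_adj h eval_map_elem check_Omega_map)

lemma Psi_Omega_map: "bimodule_map A K h \<Longrightarrow> Psi A E K (Omega_map E K h) = eval_map K h"
  by (simp add: Psi_def Psi_spec_iff)

lemma Phi_eval_map: "bimodule_map A K h \<Longrightarrow> Phi E K (eval_map K h) = Omega_map E K h"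
  unfolding Phi_def Omega_map_def by (rule restrict_ext) (simp add: eval_map_elem)

end

section \<open>Functoriality\<close>

definition bimodule_hom ::
    "'b::cstar_algebra set \<Rightarrow> ('v, 'b, 'm) corr_scheme \<Rightarrow> ('w, 'b, 'n) corr_scheme \<Rightarrow> ('v \<Rightarrow> 'w) \<Rightarrow> bool" where
  "bimodule_hom A K L \<psi> \<longleftrightarrow> (\<forall>x\<in>carr K. \<psi> x \<in> carr L) \<and>
     (\<forall>x\<in>carr K. \<forall>y\<in>carr K. \<psi> (add K x y) = add L (\<psi> x) (\<psi> y)) \<and>
     (\<forall>x\<in>carr K. \<forall>a\<in>A. \<psi> (ract K x a) = ract L (\<psi> x) a \<and> \<psi> (lact K a x) = lact L a (\<psi> x))"

lemma bimodule_map_comp: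
  assumes "bimodule_map A L h" "bimodule_hom A K L \<psi>"
  shows "bimodule_map A K (\<lambda>x. h (\<psi> x))"
  using assms by (simp add: bimodule_map_def bimodule_hom_def right_linear_def)

context framed_correspondence
begin

text \<open>Maps with an adjoint are additive because the inner product of the target is definite.\<close>

lemma adj_maps_hom:
  assumes X: "framed_correspondence A X m f" and \<psi>: "\<psi> \<in> adj_maps A A X K"
  shows "bimodule_hom A X K \<psi>"
proof -
  interpret X: framed_correspondence A X m f by (rule X)
  obtain g where g: "g \<in> carr K \<rightarrow> carr X"
    and adj: "\<And>x y. x \<in> carr X \<Longrightarrow> y \<in> carr K \<Longrightarrow> rip K (\<psi> x) y = rip X x (g y)"
    using \<psi> unfolding adj_maps_def by blast
  have c: "\<psi> x \<in> carr K" if "x \<in> carr X" for x using \<psi> that by (auto simp: adj_maps_def)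
  have "\<psi> (add X x y) = add K (\<psi> x) (\<psi> y)" if x: "x \<in> carr X" and y: "y \<in> carr X" for x y
  proof (rule eq_by_rip)
    fix z assume z: "z \<in> carr K"
    have gz: "g z \<in> carr X" using g z by auto
    have s: "add X x y \<in> carr X" by (rule X.K.add_closed[OF x y])
    have "rip K (\<psi> (add X x y)) z = rip K (add K (\<psi> x) (\<psi> y)) z"
      using x y z gz s by (simp add: adj X.K.rip_add_left K.rip_add_left c)
    then have "(rip K (\<psi> (add X x y)) z)\<^sup>\<star> = (rip K (add K (\<psi> x) (\<psi> y)) z)\<^sup>\<star>" by simp
    then show "rip K z (\<psi> (add X x y)) = rip K z (add K (\<psi> x) (\<psi> y))"
      using x y by (simp add: K.rip_star z c s K.add_closed)
  qed (simp_all add: c X.K.add_closed K.add_closed x y)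
  with c show ?thesis using \<psi> by (auto simp: bimodule_hom_def adj_maps_def)
qed

lemma lact_add_right: "x \<in> carr K \<Longrightarrow> y \<in> carr K \<Longrightarrow> a \<in> A \<Longrightarrow>
    lact K a (add K x y) = add K (lact K a x) (lact K a y)"
proof -
  assume x: "x \<in> carr K" and y: "y \<in> carr K" and a: "a \<in> A"
  have adj: "rip K z (lact K a w) = rip K (lact K (a\<^sup>\<star>) z) w" if "w \<in> carr K" "z \<in> carr K" for w z
    using that a by (simp add: K.rip_lact_left subalgebra_star[OF A] star_star)
  show ?thesis
    by (rule eq_by_rip)
      (simp_all add: x y a adj K.add_closed K.lact_closed K.rip_add subalgebra_star[OF A])
qed

lemma lact_csc: "x \<in> carr K \<Longrightarrow> a \<in> A \<Longrightarrow> lact K a (csc K c x) = csc K c (lact K a x)"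
proof -
  assume x: "x \<in> carr K" and a: "a \<in> A"
  have adj: "rip K z (lact K a w) = rip K (lact K (a\<^sup>\<star>) z) w" if "w \<in> carr K" "z \<in> carr K" for w z
    using that a by (simp add: K.rip_lact_left subalgebra_star[OF A] star_star)
  show ?thesis
    by (rule eq_by_rip)
      (simp_all add: x a adj K.csc_closed K.lact_closed K.rip_csc subalgebra_star[OF A])
qed

lemma ract_add: "x \<in> carr K \<Longrightarrow> y \<in> carr K \<Longrightarrow> a \<in> A \<Longrightarrow>
    ract K (add K x y) a = add K (ract K x a) (ract K y a)"
  using module by (simp add: right_module_def)

lemma ract_csc: "x \<in> carr K \<Longrightarrow> a \<in> A \<Longrightarrow> ract K (csc K c x) a = csc K c (ract K x a)"
  using module by (simp add: right_module_def)

lemma csc_add_right: "x \<in> carr K \<Longrightarrow> y \<in> carr K \<Longrightarrow> csc K c (add K x y) = add K (csc K c x) (csc K c y)"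
  using cvs by (simp add: cvector_space_def)

lemma hom_add:
  assumes "bimodule_hom A X K \<psi>" "bimodule_hom A X K \<phi>" "framed_correspondence A X m f"
  shows "bimodule_hom A X K (\<lambda>x\<in>carr X. add K (\<psi> x) (\<phi> x))"
proof -
  interpret X: framed_correspondence A X m f by (rule assms(3))
  have c: "\<psi> x \<in> carr K" "\<phi> x \<in> carr K" if "x \<in> carr X" for x
    using that assms by (auto simp: bimodule_hom_def)
  have "add K (add K p q) (add K r s) = add K (add K p r) (add K q s)"
    if "p \<in> carr K" "q \<in> carr K" "r \<in> carr K" "s \<in> carr K" for p q r s
    by (rule eq_by_rip) (simp_all add: that K.add_closed K.rip_add)
  then show ?thesis using assms(1,2)
    by (auto simp: bimodule_hom_def c K.add_closed X.K.add_closed X.K.ract_closed X.K.lact_closed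
        ract_add lact_add_right)
qed

lemma hom_csc:
  assumes "bimodule_hom A X K \<psi>" "framed_correspondence A X m f"
  shows "bimodule_hom A X K (\<lambda>x\<in>carr X. csc K c (\<psi> x))"
proof -
  interpret X: framed_correspondence A X m f by (rule assms(2))
  have c: "\<psi> x \<in> carr K" if "x \<in> carr X" for x
    using that assms by (auto simp: bimodule_hom_def)
  show ?thesis using assms(1)
    by (auto simp: bimodule_hom_def c K.csc_closed X.K.add_closed X.K.ract_closed X.K.lact_closed
        ract_csc lact_csc csc_add_right)
qed

text \<open>The frame coordinates \<open>\<langle>e\<^sub>i, \<psi> x\<rangle>\<close> are right linear in \<open>x\<close>, so each is an inner product with a fixed
formal tensor over \<open>X\<close> and is bounded by Cauchy-Schwarz; the norm over \<open>K\<close> involves only finitely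
many of them.\<close>

lemma tensor_map_bounded:
  assumes X: "framed_correspondence A X m f" and \<psi>: "bimodule_hom A X K \<psi>"
  defines "F \<equiv> map (\<lambda>(x, y). (\<psi> x, y))"
  obtains C where "\<And>l. l \<in> carr (pre_tensor X self_corr) \<Longrightarrow>
    F l \<in> carr T \<and> rnorm T (F l) \<le> C * rnorm (pre_tensor X self_corr) l"
proof -
  interpret X: framed_correspondence A X m f by (rule X)
  have rl: "right_linear A X (\<lambda>x. rip K (e i) (\<psi> x))" if "i < n" for i
    using right_linear_rip[OF frame_carr[OF that]] \<psi>
    by (simp add: right_linear_def bimodule_hom_def)
  have "\<exists>z. i < n \<longrightarrow> z \<in> carr X.T \<and> (\<forall>l\<in>carr X.T. list_eval (\<lambda>x. rip K (e i) (\<psi> x)) l = rip X.T z l)" for i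
    using X.list_eval_representable[OF rl] by metis
  then obtain z where z: "\<And>i. i < n \<Longrightarrow> z i \<in> carr X.T"
    "\<And>i l. i < n \<Longrightarrow> l \<in> carr X.T \<Longrightarrow> list_eval (\<lambda>x. rip K (e i) (\<psi> x)) l = rip X.T (z i) l"
    by metis
  define M where "M = (\<Sum>i<n. (rnorm X.T (z i))\<^sup>2)"
  show thesis
  proof (rule that[of "sqrt M"], intro conjI)
    fix l assume l: "l \<in> carr X.T"
    show Fl: "F l \<in> carr T" using l \<psi> by (auto simp: F_def T_carr X.T_carr bimodule_hom_def)
    have "norm (rip T (F l) (F l)) \<le> (\<Sum>i<n. (norm (list_eval (rip K (e i)) (F l)))\<^sup>2)"
      unfolding T_rip_frame[OF Fl Fl] by (rule order_trans[OF norm_sum]) (simp add: cstar_identity)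
    also have "\<dots> \<le> (\<Sum>i<n. (rnorm X.T (z i))\<^sup>2 * (rnorm X.T l)\<^sup>2)"
    proof (rule sum_mono)
      fix i assume "i \<in> {..<n}"
      then have "norm (list_eval (rip K (e i)) (F l)) \<le> rnorm X.T (z i) * rnorm X.T l"
        using z l X.T.cauchy_schwarz by (simp add: F_def list_eval_map_fst)
      then show "(norm (list_eval (rip K (e i)) (F l)))\<^sup>2 \<le> (rnorm X.T (z i))\<^sup>2 * (rnorm X.T l)\<^sup>2"
        by (simp add: power_mono flip: power_mult_distrib)
    qed
    also have "\<dots> = M * (rnorm X.T l)\<^sup>2" by (simp add: M_def sum_distrib_right)
    finally have "rnorm T (F l) \<le> sqrt (M * (rnorm X.T l)\<^sup>2)" by (simp add: rnorm_def[of T])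
    then show "rnorm T (F l) \<le> sqrt M * rnorm X.T l"
      by (simp add: real_sqrt_mult X.T.rnorm_nonneg)
  qed
qed

text \<open>Restriction along \<open>\<psi> \<boxtimes> id\<close> is precomposition of \<open>h\<close> with \<open>\<psi>\<close>; this yields functoriality and
naturality on the tensor side.\<close>

lemma tensor_eval_tensor_map:
  assumes X: "framed_correspondence A X m f" and \<psi>: "bimodule_hom A X K \<psi>"
    and h: "bimodule_map A K h" and \<xi>: "\<xi> \<in> carr (tensor X self_corr)"
  shows "tensor_map_id X K self_corr \<psi> \<xi> \<in> carr (tensor K self_corr)"
    and "tensor_eval h (tensor_map_id X K self_corr \<psi> \<xi>) = tensor_eval (\<lambda>x. h (\<psi> x)) \<xi>"
proof -
  interpret X: framed_correspondence A X m f by (rule X)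
  let ?F = "map (\<lambda>(x, y). (\<psi> x, y)) :: _ \<Rightarrow> ('v \<times> 'b) list"
  obtain C where C: "\<And>l. l \<in> carr X.T \<Longrightarrow> ?F l \<in> carr T \<and> rnorm T (?F l) \<le> C * rnorm X.T l"
    using tensor_map_bounded[OF X \<psi>] by metis
  note rep = X.T.carr_rep[OF \<xi>[unfolded tensor_def]]
  have "?F (diff X.T l k) = diff T (?F l) (?F k)" for l k
    by (simp add: diff_def T_simps X.T_simps comp_def case_prod_unfold)
  then have c: "T.cauchy (\<lambda>n. ?F (rep \<xi> n))"
    using C X.T.diff_closed by (intro X.T.cauchy_lipschitz[OF rep(1), where C=C]) metis+
  have eq: "tensor_map_id X K self_corr \<psi> \<xi> = cauchy_class T (\<lambda>n. ?F (rep \<xi> n))"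
    using \<xi> by (simp add: tensor_map_id_def completion_map_def tensor_def)
  show "tensor_map_id X K self_corr \<psi> \<xi> \<in> carr (tensor K self_corr)"
    unfolding eq by (rule T.class_carr[OF c, folded tensor_def])
  have "(\<lambda>n. list_eval (\<lambda>x. h (\<psi> x)) (rep \<xi> n)) \<longlonglongrightarrow> tensor_eval h (tensor_map_id X K self_corr \<psi> \<xi>)"
    using tensor_eval_limit[OF bimodule_mapD[OF h] c] by (simp add: eq list_eval_map_fst)
  from LIMSEQ_unique[OF this X.tensor_eval_limit_rep[OF X.bimodule_mapD[OF bimodule_map_comp[OF h \<psi>]] \<xi>]]
  show "tensor_eval h (tensor_map_id X K self_corr \<psi> \<xi>) = tensor_eval (\<lambda>x. h (\<psi> x)) \<xi>" .
qed

end

text \<open>The vector space laws hold for functions into \<open>B\<close> and are carried over by \<open>F\<close>.\<close>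

lemma cvector_space_of_functions:
  fixes F :: "('v \<Rightarrow> 'b::cstar_algebra) \<Rightarrow> 'w"
  assumes carr: "carr V = F ` H"
    and zero: "(\<lambda>x. 0) \<in> H" "zero V = F (\<lambda>x. 0)"
    and add: "\<And>h h'. h \<in> H \<Longrightarrow> h' \<in> H \<Longrightarrow> (\<lambda>x. h x + h' x) \<in> H \<and> add V (F h) (F h') = F (\<lambda>x. h x + h' x)"
    and csc: "\<And>h c. h \<in> H \<Longrightarrow> (\<lambda>x. c *\<^sub>c h x) \<in> H \<and> csc V c (F h) = F (\<lambda>x. c *\<^sub>c h x)"
  shows "cvector_space V"
proof -
  have one: "1 *\<^sub>c b = b" for b :: 'b using scaleR_scaleC[of 1 b] by simp
  have inv: "\<exists>y\<in>F ` H. add V (F h) y = zero V" if "h \<in> H" for h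
    using add[OF that conjunct1[OF csc[OF that, of "-1"]]] csc[OF that, of "-1"]
    by (intro bexI[of _ "F (\<lambda>x. (-1) *\<^sub>c h x)"]) (auto simp: zero scaleC_minus_one)
  show ?thesis unfolding cvector_space_def carr
    using zero(1) inv
    by (auto simp: zero(2) add csc one add_ac scaleC_add_left scaleC_add_right scaleC_scaleC)
qed

lemma Ob_framed:
  assumes "cstar_subalgebra A" "K \<in> Ob (Bim_fgp A)"
  obtains n e where "framed_correspondence A K n e"
  using assms frame_exists[of A K] by (auto simp: Bim_fgp_def hilbert_bimodule_def)

text \<open>Presheaves whose value at \<open>K\<close> is parametrised by the bimodule maps \<open>K \<rightarrow> B\<close>, compatibly with the
linear structure and with precomposition. Functoriality, and naturality of any family that matches
the parameters, then follow formally.\<close>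

locale represented_presheaf =
  fixes A :: "'b::cstar_algebra set"
    and P :: "(('k, 'b) bimod, 'k \<Rightarrow> 'k, 'w) presheaf"
    and F :: "('k, 'b) bimod \<Rightarrow> ('k \<Rightarrow> 'b) \<Rightarrow> 'w"
  assumes A: "cstar_subalgebra A"
    and carr_image: "K \<in> Ob (Bim_fgp A) \<Longrightarrow> carr (FOb P K) = F K ` {h. bimodule_map A K h}"
    and zero_eq: "K \<in> Ob (Bim_fgp A) \<Longrightarrow> zero (FOb P K) = F K (\<lambda>x. 0)"
    and add_eq: "K \<in> Ob (Bim_fgp A) \<Longrightarrow> bimodule_map A K h \<Longrightarrow> bimodule_map A K h' \<Longrightarrow>
      add (FOb P K) (F K h) (F K h') = F K (\<lambda>x. h x + h' x)"
    and csc_eq: "K \<in> Ob (Bim_fgp A) \<Longrightarrow> bimodule_map A K h \<Longrightarrow>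
      csc (FOb P K) c (F K h) = F K (\<lambda>x. c *\<^sub>c h x)"
    and F_cong: "K \<in> Ob (Bim_fgp A) \<Longrightarrow> (\<And>x. x \<in> carr K \<Longrightarrow> h x = h' x) \<Longrightarrow> F K h = F K h'"
    and FMor_eq: "K \<in> Ob (Bim_fgp A) \<Longrightarrow> L \<in> Ob (Bim_fgp A) \<Longrightarrow> bimodule_hom A K L \<psi> \<Longrightarrow>
      bimodule_map A L h \<Longrightarrow> FMor P K L \<psi> (F L h) = F K (\<lambda>x. h (\<psi> x))"
begin

lemma bimodule_map_ops:
  assumes "K \<in> Ob (Bim_fgp A)"
  shows "bimodule_map A K (\<lambda>x. 0)"
    and "bimodule_map A K h \<Longrightarrow> bimodule_map A K h' \<Longrightarrow> bimodule_map A K (\<lambda>x. h x + h' x)"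
    and "bimodule_map A K h \<Longrightarrow> bimodule_map A K (\<lambda>x. c *\<^sub>c h x)"
proof -
  obtain n e where "framed_correspondence A K n e" using Ob_framed[OF A assms] .
  then interpret framed_correspondence A K n e .
  show "bimodule_map A K (\<lambda>x. 0)"
    "bimodule_map A K h \<Longrightarrow> bimodule_map A K h' \<Longrightarrow> bimodule_map A K (\<lambda>x. h x + h' x)"
    "bimodule_map A K h \<Longrightarrow> bimodule_map A K (\<lambda>x. c *\<^sub>c h x)"
    by (intro bimodule_map_zero bimodule_map_add bimodule_map_scaleC; assumption)+
qed

lemma Mor_hom:
  assumes "K \<in> Ob (Bim_fgp A)" "L \<in> Ob (Bim_fgp A)" "\<psi> \<in> carr (Mor (Bim_fgp A) K L)"
  shows "bimodule_hom A K L \<psi>"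
proof -
  obtain n e where K: "framed_correspondence A K n e" using Ob_framed[OF A assms(1)] .
  obtain m f where L: "framed_correspondence A L m f" using Ob_framed[OF A assms(2)] .
  show ?thesis
    using framed_correspondence.adj_maps_hom[OF L K] assms(3) by (simp add: Bim_fgp_def map_space_def)
qed

lemma presheaf: "linear_presheaf (Bim_fgp A) P"
  unfolding linear_presheaf_def
proof (intro conjI ballI)
  fix K :: "('k, 'b) bimod" assume K: "K \<in> Ob (Bim_fgp A)"
  show "cvector_space (FOb P K)"
    by (rule cvector_space_of_functions[of _ "F K" "{h. bimodule_map A K h}"])
      (simp_all add: carr_image zero_eq add_eq csc_eq K bimodule_map_ops[OF K])
next
  fix K L :: "('k, 'b) bimod" and \<psi>
  assume K: "K \<in> Ob (Bim_fgp A)" and L: "L \<in> Ob (Bim_fgp A)"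
    and \<psi>: "\<psi> \<in> carr (Mor (Bim_fgp A) K L)"
  note hom = Mor_hom[OF K L \<psi>]
  show "clinear_map (FOb P L) (FOb P K) (FMor P K L \<psi>)"
    unfolding clinear_map_def carr_image[OF L] carr_image[OF K]
    using bimodule_map_comp[OF _ hom]
    by (auto simp: FMor_eq[OF K L hom] add_eq csc_eq K L bimodule_map_ops[OF L])
next
  fix K :: "('k, 'b) bimod" and v assume ob: "K \<in> Ob (Bim_fgp A)" and "v \<in> carr (FOb P K)"
  then obtain h where h: "v = F K h" "bimodule_map A K h" by (auto simp: carr_image)
  obtain n e where "framed_correspondence A K n e" using Ob_framed[OF A ob] .
  then interpret framed_correspondence A K n e .
  have "bimodule_hom A K K (Id (Bim_fgp A) K)"
    by (simp add: bimodule_hom_def Bim_fgp_def K.add_closed K.ract_closed K.lact_closed)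
  from FMor_eq[OF ob ob this h(2)] show "FMor P K K (Id (Bim_fgp A) K) v = v"
    unfolding h(1) by (simp only:) (rule F_cong[OF ob], simp add: Bim_fgp_def)
next
  fix K L M :: "('k, 'b) bimod" and \<psi> \<phi> v
  assume ob: "K \<in> Ob (Bim_fgp A)" and L: "L \<in> Ob (Bim_fgp A)" and M: "M \<in> Ob (Bim_fgp A)"
    and \<psi>: "\<psi> \<in> carr (Mor (Bim_fgp A) K L)" and \<phi>: "\<phi> \<in> carr (Mor (Bim_fgp A) L M)"
    and "v \<in> carr (FOb P M)"
  then obtain h where h: "v = F M h" "bimodule_map A M h" by (auto simp: carr_image)
  note hom = Mor_hom[OF ob L \<psi>] Mor_hom[OF L M \<phi>]
  obtain n e where "framed_correspondence A K n e" using Ob_framed[OF A ob] .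
  then interpret framed_correspondence A K n e .
  let ?c = "Comp (Bim_fgp A) K L M \<phi> \<psi>"
  have "bimodule_hom A K M ?c"
    using hom
    by (auto simp: bimodule_hom_def Bim_fgp_def compose_def K.add_closed K.ract_closed K.lact_closed)
  then have "FMor P K M ?c v = F K (\<lambda>x. h (?c x))" unfolding h(1) by (rule FMor_eq[OF ob M _ h(2)])
  also have "\<dots> = F K (\<lambda>x. h (\<phi> (\<psi> x)))" by (rule F_cong[OF ob]) (simp add: Bim_fgp_def compose_def)
  also have "\<dots> = FMor P K L \<psi> (FMor P L M \<phi> v)"
    by (simp add: h FMor_eq ob L M hom bimodule_map_comp[OF h(2) hom(2)])
  finally show "FMor P K M ?c v = FMor P K L \<psi> (FMor P L M \<phi> v)" .
next
  fix K L :: "('k, 'b) bimod" and v assume K: "K \<in> Ob (Bim_fgp A)" and L: "L \<in> Ob (Bim_fgp A)" and "v \<in> carr (FOb P L)"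
  then obtain h where h: "v = F L h" "bimodule_map A L h" by (auto simp: carr_image)
  obtain n e where fK: "framed_correspondence A K n e" using Ob_framed[OF A K] .
  obtain m f where "framed_correspondence A L m f" using Ob_framed[OF A L] .
  then interpret L: framed_correspondence A L m f .
  let ?M = "Mor (Bim_fgp A) K L"
  have M: "add ?M \<psi> \<phi> = (\<lambda>x\<in>carr K. add L (\<psi> x) (\<phi> x))" "csc ?M c \<psi> = (\<lambda>x\<in>carr K. csc L c (\<psi> x))"
    for \<psi> \<phi> c by (simp_all add: Bim_fgp_def map_space_def)
  have rl: "right_linear A L h" by (rule L.bimodule_mapD[OF h(2)])
  show "clinear_map ?M (FOb P K) (\<lambda>\<psi>. FMor P K L \<psi> v)"
    unfolding clinear_map_def h(1)
  proof (intro conjI ballI allI)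
    fix \<psi> assume "\<psi> \<in> carr ?M"
    note hom = Mor_hom[OF K L this]
    have c: "x \<in> carr K \<Longrightarrow> \<psi> x \<in> carr L" for x using hom by (simp add: bimodule_hom_def)
    show "FMor P K L \<psi> (F L h) \<in> carr (FOb P K)"
      using bimodule_map_comp[OF h(2) hom] by (simp add: FMor_eq K L hom h(2) carr_image)
    show "FMor P K L (csc ?M a \<psi>) (F L h) = csc (FOb P K) a (FMor P K L \<psi> (F L h))" for a
    proof -
      have "FMor P K L (csc ?M a \<psi>) (F L h) = F K (\<lambda>x. h (csc ?M a \<psi> x))"
        unfolding M by (rule FMor_eq[OF K L L.hom_csc[OF hom fK] h(2)])
      also have "\<dots> = F K (\<lambda>x. a *\<^sub>c h (\<psi> x))"
        by (rule F_cong[OF K]) (simp add: M L.right_linear_csc[OF rl] c)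
      finally show ?thesis
        using bimodule_map_comp[OF h(2) hom] by (simp add: FMor_eq K L hom h(2) csc_eq)
    qed
    fix \<phi> assume "\<phi> \<in> carr ?M"
    note hom' = Mor_hom[OF K L this]
    have c': "x \<in> carr K \<Longrightarrow> \<phi> x \<in> carr L" for x using hom' by (simp add: bimodule_hom_def)
    have "FMor P K L (add ?M \<psi> \<phi>) (F L h) = F K (\<lambda>x. h (add ?M \<psi> \<phi> x))"
      unfolding M by (rule FMor_eq[OF K L L.hom_add[OF hom hom' fK] h(2)])
    also have "\<dots> = F K (\<lambda>x. h (\<psi> x) + h (\<phi> x))"
      using rl by (intro F_cong[OF K]) (simp add: M c c' right_linear_def)
    finally show "FMor P K L (add ?M \<psi> \<phi>) (F L h) = add (FOb P K) (FMor P K L \<psi> (F L h)) (FMor P K L \<phi> (F L h))"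
      using bimodule_map_comp[OF h(2) hom] bimodule_map_comp[OF h(2) hom']
      by (simp add: FMor_eq K L hom hom' h(2) add_eq)
  qed
qed

end

lemma natural_represented:
  fixes F :: "('k, 'b::cstar_algebra) bimod \<Rightarrow> ('k \<Rightarrow> 'b) \<Rightarrow> 'w"
    and G :: "('k, 'b) bimod \<Rightarrow> ('k \<Rightarrow> 'b) \<Rightarrow> 'u"
  assumes "represented_presheaf A P F" "represented_presheaf A Q G"
    and \<eta>: "\<And>K h. K \<in> Ob (Bim_fgp A) \<Longrightarrow> bimodule_map A K h \<Longrightarrow> \<eta> K (F K h) = G K h"
  shows "natural_transformation (Bim_fgp A) P Q \<eta>"
proof -
  interpret P: represented_presheaf A P F by fact
  interpret Q: represented_presheaf A Q G by fact
  show ?thesis unfolding natural_transformation_def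
  proof (intro conjI ballI)
    fix K :: "('k, 'b) bimod" assume K: "K \<in> Ob (Bim_fgp A)"
    show "clinear_map (FOb P K) (FOb Q K) (\<eta> K)"
      unfolding clinear_map_def P.carr_image[OF K] Q.carr_image[OF K]
      by (auto simp: \<eta> K P.add_eq Q.add_eq P.csc_eq Q.csc_eq P.bimodule_map_ops[OF K])
  next
    fix K L :: "('k, 'b) bimod" and \<psi> v
    assume K: "K \<in> Ob (Bim_fgp A)" and L: "L \<in> Ob (Bim_fgp A)"
      and \<psi>: "\<psi> \<in> carr (Mor (Bim_fgp A) K L)" and "v \<in> carr (FOb P L)"
    then obtain h where h: "v = F L h" "bimodule_map A L h" by (auto simp: P.carr_image)
    note hom = P.Mor_hom[OF K L \<psi>]
    show "\<eta> K (FMor P K L \<psi> v) = FMor Q K L \<psi> (\<eta> L v)"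
      by (simp add: h K L hom P.FMor_eq Q.FMor_eq \<eta> bimodule_map_comp[OF h(2) hom])
  qed
qed

context expectation
begin

lemma frobenius_Ob:
  fixes K :: "('k, 'b) bimod"
  assumes "K \<in> Ob (Bim_fgp A)" obtains n e where "frobenius A E K n e"
proof -
  obtain n e where "framed_correspondence A K n e" using Ob_framed[OF A assms] .
  then have "frobenius A E K n e" by (simp add: frobenius_def expectation_axioms)
  then show thesis by (rule that)
qed

lemma diamond_represented: "represented_presheaf A (diamond_functor A E) (Omega_map E)"
proof
  show "cstar_subalgebra A" by (rule A)
  fix K :: "('k, 'b) bimod" assume K: "K \<in> Ob (Bim_fgp A)"
  obtain n e where "frobenius A E K n e" using frobenius_Ob[OF K] .
  then interpret frobenius A E K n e .
  show "carr (FOb (diamond_functor A E) K) = Omega_map E K ` {h. bimodule_map A K h}"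
    by (simp add: diamond_functor_def map_space_def diamond_eq)
  show "zero (FOb (diamond_functor A E) K) = Omega_map E K (\<lambda>x. 0)"
    by (simp add: diamond_functor_def map_space_def Omega_map_def Omega_zero)
  show "add (FOb (diamond_functor A E) K) (Omega_map E K h) (Omega_map E K h') = Omega_map E K (\<lambda>x. h x + h' x)" for h h'
    by (simp add: diamond_functor_def map_space_def Omega_map_def Omega_add cong: restrict_cong)
  show "csc (FOb (diamond_functor A E) K) c (Omega_map E K h) = Omega_map E K (\<lambda>x. c *\<^sub>c h x)" for c h
    by (simp add: diamond_functor_def map_space_def Omega_map_def Omega_csc cong: restrict_cong)
  show "(\<And>x. x \<in> carr K \<Longrightarrow> h x = h' x) \<Longrightarrow> Omega_map E K h = Omega_map E K h'" for h h'
    by (rule Omega_map_cong)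
  show "bimodule_hom A K L \<psi> \<Longrightarrow> FMor (diamond_functor A E) K L \<psi> (Omega_map E L h) = Omega_map E K (\<lambda>x. h (\<psi> x))"
    for L :: "('k, 'b) bimod" and \<psi> h
    by (simp add: diamond_functor_def compose_def Omega_map_def bimodule_hom_def cong: restrict_cong)
qed

lemma tensor_represented: "represented_presheaf A (tensor_functor A) eval_map"
proof
  show "cstar_subalgebra A" by (rule A)
  fix K :: "('k, 'b) bimod" assume K: "K \<in> Ob (Bim_fgp A)"
  obtain n e where fr: "frobenius A E K n e" using frobenius_Ob[OF K] .
  then interpret frobenius A E K n e .
  show "carr (FOb (tensor_functor A) K) = eval_map K ` {h. bimodule_map A K h}"
    by (simp add: tensor_functor_def map_space_def adj_maps_eq)
  show "zero (FOb (tensor_functor A) K) = eval_map K (\<lambda>x. 0)"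
    by (simp add: tensor_functor_def map_space_def eval_map_def tensor_eval_zero)
  show "add (FOb (tensor_functor A) K) (eval_map K h) (eval_map K h') = eval_map K (\<lambda>x. h x + h' x)"
    if "bimodule_map A K h" "bimodule_map A K h'" for h h'
    using fr.tensor_eval_add[OF that[THEN fr.bimodule_mapD] fr.bimodule_mapD[OF fr.bimodule_map_add[OF that]]]
    by (auto simp: tensor_functor_def map_space_def eval_map_def)
  show "csc (FOb (tensor_functor A) K) c (eval_map K h) = eval_map K (\<lambda>x. c *\<^sub>c h x)"
    if "bimodule_map A K h" for c h
    using fr.tensor_eval_scaleC[OF fr.bimodule_mapD[OF that] fr.bimodule_mapD[OF fr.bimodule_map_scaleC[OF that]]]
    by (auto simp: tensor_functor_def map_space_def eval_map_def)
  show "(\<And>x. x \<in> carr K \<Longrightarrow> h x = h' x) \<Longrightarrow> eval_map K h = eval_map K h'" for h h'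
    by (rule fr.eval_map_cong)
  show "FMor (tensor_functor A) K L \<psi> (eval_map L h) = eval_map K (\<lambda>x. h (\<psi> x))"
    if L: "L \<in> Ob (Bim_fgp A)" and \<psi>: "bimodule_hom A K L \<psi>" and h: "bimodule_map A L h"
    for L :: "('k, 'b) bimod" and \<psi> h
  proof -
    obtain m f where "framed_correspondence A L m f" using Ob_framed[OF A L] .
    note eval = framed_correspondence.tensor_eval_tensor_map[OF this fr.framed_correspondence_axioms \<psi> h]
    show ?thesis by (auto simp: tensor_functor_def compose_def eval_map_def eval)
  qed
qed

end

section \<open>Frobenius reciprocity\<close>

theorem theorem2p6:
  fixes A :: "'b::cstar_algebra set" and E :: "'b \<Rightarrow> 'b"
    and \<C> :: "(('k, 'b) bimod, 'k \<Rightarrow> 'k) lincat"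
  assumes "cstar_subalgebra A"
    and "faithful_conditional_expectation A E"
    and "\<C> = Bim_fgp A"
  shows
    "(\<forall>K\<in>Ob \<C>.
        (\<forall>g\<in>diamond A E K. (\<forall>k\<in>carr K. \<exists>!b. Omega E b = g k) \<and> (\<exists>!f. Psi_spec A E K g f)) \<and>
        (\<forall>f\<in>adj_maps A UNIV (tensor K self_corr) self_corr. Phi E K f \<in> diamond A E K)) \<and>
     linear_presheaf \<C> (diamond_functor A E) \<and>
     linear_presheaf \<C> (tensor_functor A) \<and>
     natural_transformation \<C> (diamond_functor A E) (tensor_functor A) (Psi A E) \<and>
     natural_transformation \<C> (tensor_functor A) (diamond_functor A E) (Phi E) \<and>
     mutually_inverse \<C> (diamond_functor A E) (tensor_functor A) (Psi A E) (Phi E)"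
proof -
  interpret expectation A E by unfold_locales (rule assms)+
  interpret D: represented_presheaf A "diamond_functor A E" "Omega_map E :: ('k, 'b) bimod \<Rightarrow> _"
    by (rule diamond_represented)
  interpret T: represented_presheaf A "tensor_functor A" "eval_map :: ('k, 'b) bimod \<Rightarrow> _"
    by (rule tensor_represented)
  have Psi: "Psi A E K (Omega_map E K h) = eval_map K h" and Phi: "Phi E K (eval_map K h) = Omega_map E K h"
    if K: "K \<in> Ob (Bim_fgp A)" and h: "bimodule_map A K h" for K :: "('k, 'b) bimod" and h
  proof -
    obtain n e where "frobenius A E K n e" using frobenius_Ob[OF K] .
    then interpret frobenius A E K n e .
    show "Psi A E K (Omega_map E K h) = eval_map K h" "Phi E K (eval_map K h) = Omega_map E K h"
      by (rule Psi_Omega_map[OF h], rule Phi_eval_map[OF h])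
  qed
  have well_defined: "(\<forall>g\<in>diamond A E K. (\<forall>k\<in>carr K. \<exists>!b. Omega E b = g k) \<and> (\<exists>!f. Psi_spec A E K g f)) \<and>
      (\<forall>f\<in>adj_maps A UNIV (tensor K self_corr) self_corr. Phi E K f \<in> diamond A E K)"
    if K: "K \<in> Ob (Bim_fgp A)" for K :: "('k, 'b) bimod"
  proof -
    obtain n e where "frobenius A E K n e" using frobenius_Ob[OF K] .
    then interpret frobenius A E K n e .
    show ?thesis
    proof (intro conjI ballI)
      fix g assume g: "g \<in> diamond A E K"
      show "\<exists>!b. Omega E b = g k" if "k \<in> carr K" for k
        using diamond_check[OF g that] by (metis Omega_inject)
      obtain h where "g = Omega_map E K h" "bimodule_map A K h" using g by (auto simp: diamond_eq)
      then show "\<exists>!f. Psi_spec A E K g f" by (simp add: Psi_spec_iff)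
    next
      fix f assume "f \<in> adj_maps A UNIV (tensor K self_corr) self_corr"
      then show "Phi E K f \<in> diamond A E K" by (auto simp: adj_maps_eq Phi_eval_map Omega_map_diamond)
    qed
  qed
  have inverse: "mutually_inverse (Bim_fgp A :: (('k, 'b) bimod, 'k \<Rightarrow> 'k) lincat) (diamond_functor A E)
      (tensor_functor A) (Psi A E) (Phi E)"
    unfolding mutually_inverse_def by (auto simp: D.carr_image T.carr_image Psi Phi)
  note iso = natural_represented[OF D.represented_presheaf_axioms T.represented_presheaf_axioms,
      where \<eta> = "Psi A E", OF Psi]
    natural_represented[OF T.represented_presheaf_axioms D.represented_presheaf_axioms,
      where \<eta> = "Phi E", OF Phi]
  show ?thesis
    unfolding assms(3)
    by (rule conjI[OF ballI[OF well_defined]], assumption)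
      (intro conjI D.presheaf T.presheaf iso inverse)
qed

end
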